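(* Let $\Omega\subset\mathbb{R}^N$ be a smooth bounded domain, $0<s_2<s_1<1$, $N>s_1p$ and $2\le q<p<r<p^*_{s_1}$. Then there exists $\theta^*>0$ such that for every $\theta>\theta^*$ the problem $$(P)\qquad (-\Delta)^{s_1}_p u+(-\Delta)^{s_2}_q u=\theta|u|^{r-2}u+|u|^{p^*_{s_1}-2}u\ \text{ in }\Omega,\qquad u=0\ \text{ in }\mathbb{R}^N\setminus\Omega,$$ has a nontrivial nonnegative weak solution, i.e. there is a weak solution $u\in X_{0,s_1,p}(\Omega)$ with $u\ge 0$ a.e. and $u\not\equiv 0$.
   Context: For $s\in(0,1)$ and $t\ge 1$, $X_{0,s,t}(\Omega)$ is the space of measurable $u:\mathbb{R}^N\to\mathbb{R}$ with $u|_\Omega\in L^t(\Omega)$, $u=0$ a.e. in $\mathbb{R}^N\setminus\Omega$ and $\|u\|_{0,s,t}:=\Big(\int_{\mathbb{R}^{2N}}\frac{|u(x)-u(y)|^t}{|x-y|^{N+st}}\,dx\,dy\Big)^{1/t}<\infty$. Also $p^*_s=\frac{Np}{N-sp}$. $u\in X_{0,s_1,p}(\Omega)$ is a weak solution of the equation with zero exterior condition if for all $\phi\in X_{0,s_1,p}(\Omega)$ $$\int_{\mathbb{R}^{2N}}\frac{|u(x)-u(y)|^{p-2}(u(x)-u(y))(\phi(x)-\phi(y))}{|x-y|^{N+ps_1}}dxdy+\int_{\mathbb{R}^{2N}}\frac{|u(x)-u(y)|^{q-2}(u(x)-u(y))(\phi(x)-\phi(y))}{|x-y|^{N+qs_2}}dxdy$$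 $$=\theta\int_\Omega|u|^{r-2}u\phi\,dx+\int_\Omega|u|^{p^*_{s_1}-2}u\phi\,dx.$$ *)

theory Defs
  imports "HOL-Analysis.Analysis"
begin

fun C_k :: "nat \<Rightarrow> ('a::euclidean_space \<Rightarrow> real) \<Rightarrow> bool" where
  "C_k 0 f \<longleftrightarrow> continuous_on UNIV f"
| "C_k (Suc k) f \<longleftrightarrow> (\<forall>x. f differentiable (at x)) \<and>
     (\<forall>b\<in>Basis. C_k k (\<lambda>x. frechet_derivative f (at x) b))"

definition smooth_fun :: "('a::euclidean_space \<Rightarrow> real) \<Rightarrow> bool" where
  "smooth_fun f \<longleftrightarrow> (\<forall>k. C_k k f)"

text \<open>Near each boundary point, after a rotation of coordinates, the domain is the region above
  the graph of a smooth function. Here \<^term>\<open>e\<close> is the direction of the last coordinate in the rotated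
  frame, and \<^term>\<open>g\<close> is evaluated only at the orthogonal projection of a point onto the hyperplane
  orthogonal to \<^term>\<open>e\<close>, so it acts as a function of the remaining coordinates.\<close>

definition smooth_boundary :: "'a::euclidean_space set \<Rightarrow> bool" where
  "smooth_boundary \<Omega> \<longleftrightarrow>
     (\<forall>x\<in>frontier \<Omega>. \<exists>\<rho>>0. \<exists>e g. norm e = 1 \<and> smooth_fun g \<and>
        \<Omega> \<inter> ball x \<rho> = {y \<in> ball x \<rho>. g (y - (y \<bullet> e) *\<^sub>R e) < y \<bullet> e})"

definition smooth_bounded_domain :: "'a::euclidean_space set \<Rightarrow> bool" where
  "smooth_bounded_domain \<Omega> \<longleftrightarrow>
     open \<Omega> \<and> connected \<Omega> \<and> \<Omega> \<noteq> {} \<and> bounded \<Omega> \<and> smooth_boundary \<Omega>"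

definition gagliardo_energy :: "real \<Rightarrow> real \<Rightarrow> ('a::euclidean_space \<Rightarrow> real) \<Rightarrow> ennreal" where
  "gagliardo_energy s t u =
     (\<integral>\<^sup>+ (x, y). ennreal (\<bar>u x - u y\<bar> powr t / norm (x - y) powr (real DIM('a) + s * t)) \<partial>lebesgue)"

text \<open>Real powers are not available on \<^typ>\<open>ennreal\<close>, hence the case distinction.\<close>

definition gagliardo_norm :: "real \<Rightarrow> real \<Rightarrow> ('a::euclidean_space \<Rightarrow> real) \<Rightarrow> ennreal" where
  "gagliardo_norm s t u =
     (if gagliardo_energy s t u = \<infinity> then \<infinity>
      else ennreal (enn2real (gagliardo_energy s t u) powr (1 / t)))"

definition X0 :: "real \<Rightarrow> real \<Rightarrow> 'a::euclidean_space set \<Rightarrow> ('a \<Rightarrow> real) set" where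
  "X0 s t \<Omega> =
     {u. u \<in> borel_measurable lebesgue \<and>
         integrable (lebesgue_on \<Omega>) (\<lambda>x. \<bar>u x\<bar> powr t) \<and>
         (AE x in lebesgue. x \<notin> \<Omega> \<longrightarrow> u x = 0) \<and>
         gagliardo_norm s t u < \<infinity>}"

definition crit_exp :: "nat \<Rightarrow> real \<Rightarrow> real \<Rightarrow> real" where
  "crit_exp N s p = real N * p / (real N - s * p)"

text \<open>The integrand of the weak form of the fractional Laplacian of order \<^term>\<open>s\<close> and exponent
  \<^term>\<open>p\<close>. It is \<open>0\<close> on the diagonal, which is a null set.\<close>

definition frac_integrand ::
  "real \<Rightarrow> real \<Rightarrow> ('a::euclidean_space \<Rightarrow> real) \<Rightarrow> ('a \<Rightarrow> real) \<Rightarrow> 'a \<times> 'a \<Rightarrow> real" where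
  "frac_integrand s p u \<phi> = (\<lambda>(x, y).
     \<bar>u x - u y\<bar> powr (p - 2) * (u x - u y) * (\<phi> x - \<phi> y) / norm (x - y) powr (real DIM('a) + p * s))"

text \<open>The integrability clauses state that every integral in the weak formulation exists; without
  them the identity could hold by the convention that a divergent Bochner integral is \<open>0\<close>.\<close>

definition weak_solution ::
  "real \<Rightarrow> real \<Rightarrow> real \<Rightarrow> real \<Rightarrow> real \<Rightarrow> real \<Rightarrow> 'a::euclidean_space set \<Rightarrow> ('a \<Rightarrow> real) \<Rightarrow> bool" where
  "weak_solution s1 s2 p q r \<theta> \<Omega> u \<longleftrightarrow>
     u \<in> X0 s1 p \<Omega> \<and>
     (\<forall>\<phi> \<in> X0 s1 p \<Omega>.
        integrable lebesgue (frac_integrand s1 p u \<phi>) \<and>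
        integrable lebesgue (frac_integrand s2 q u \<phi>) \<and>
        integrable (lebesgue_on \<Omega>) (\<lambda>x. \<bar>u x\<bar> powr (r - 2) * u x * \<phi> x) \<and>
        integrable (lebesgue_on \<Omega>)
          (\<lambda>x. \<bar>u x\<bar> powr (crit_exp DIM('a) s1 p - 2) * u x * \<phi> x) \<and>
        (\<integral>z. frac_integrand s1 p u \<phi> z \<partial>lebesgue) + (\<integral>z. frac_integrand s2 q u \<phi> z \<partial>lebesgue)
        = \<theta> * (\<integral>x. \<bar>u x\<bar> powr (r - 2) * u x * \<phi> x \<partial>lebesgue_on \<Omega>)
          + (\<integral>x. \<bar>u x\<bar> powr (crit_exp DIM('a) s1 p - 2) * u x * \<phi> x \<partial>lebesgue_on \<Omega>))"

end

theory Submission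
  imports Defs "HOL-Real_Asymp.Real_Asymp" "HOL-Complex_Analysis.Great_Picard"
begin

text \<open>The solution is a minimiser of the energy on the Nehari manifold. For large \<open>\<theta>\<close> the minimal
  energy is so small that, by the Sobolev inequality, the critical term of every function in a
  minimising sequence is at most half of its Gagliardo energy. A subsequence converges almost
  everywhere; subtracting the limit and using the Brezis--Lieb lemma shows that the limit lies on
  or below the Nehari manifold, and it does not vanish because the subcritical term passes to the
  limit. Scaling it down to the manifold does not increase the energy, so the minimum is attained.
  Replacing a function by its absolute value and rescaling does not increase the energy either,
  whence nonnegativity. The Euler--Lagrange equation follows from one-dimensional
  calculus, since the fibering map of the minimiser is maximal at \<open>1\<close>.

  The Sobolev inequality is obtained pointwise: if \<open>\<bar>u x\<bar> = a\<close>, then on at least half of a ball around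
  \<open>x\<close> of volume \<open>2 (2/a)\<^sup>\<sigma> \<integral>\<bar>u\<bar>\<^sup>\<sigma>\<close> one has \<open>\<bar>u\<bar> < a/2\<close>, which bounds the inner integral of the
  Gagliardo energy at \<open>x\<close> from below by a multiple of \<open>a\<^sup>\<sigma>\<close>.\<close>

section \<open>Fibering maps\<close>

text \<open>The critical exponent admits no compact embedding: a minimising sequence may lose part
  of its critical mass in the limit. What rescues the limit is a sign. A function h with small
  \<open>A h\<close> has \<open>A h + B h - C h \<ge> 0\<close>, so the part of the sequence that is
  lost contributes nonnegatively to the Nehari identity, and removing it can only push the limit to
  the side \<open>fiber \<le> 0\<close>, from which it can be scaled back. How small
  \<open>A h\<close> must be depends on the Sobolev constant and the exponents but not on \<theta>,
  so \<theta> may be taken large afterwards. The argument works with almost everywhere convergence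
  and bounds on integrals, without weak limits in a reflexive space. For this the Gagliardo energy
  is read as the integral of a power of the difference function against a weighted measure, and the
  almost everywhere convergent subsequence comes from averages over cubic grids.\<close>

definition fib :: "real \<Rightarrow> real \<Rightarrow> real \<Rightarrow> real \<Rightarrow> real \<Rightarrow> real \<Rightarrow> real \<Rightarrow> real \<Rightarrow> real \<Rightarrow> real" where
  "fib p q r \<sigma> A B R C t = A * t powr p + B * t powr q - R * t powr r - C * t powr \<sigma>"

text \<open>The energy of \<open>t u\<close> as a function of \<open>t\<close>, when
  \<open>A\<close>, \<open>B\<close>, \<open>R\<close>, \<open>C\<close> are the two Gagliardo
  energies of \<open>u\<close>, \<theta> times its \<open>L^r\<close> integral and its critical
  integral. \<open>fib\<close> is \<open>t\<close> times the derivative, so its positive zeros are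
  the factors that bring \<open>u\<close> onto the Nehari manifold.\<close>

definition fib_energy :: "real \<Rightarrow> real \<Rightarrow> real \<Rightarrow> real \<Rightarrow> real \<Rightarrow> real \<Rightarrow> real \<Rightarrow> real \<Rightarrow> real \<Rightarrow> real" where
  "fib_energy p q r \<sigma> A B R C t =
     A / p * t powr p + B / q * t powr q - R / r * t powr r - C / \<sigma> * t powr \<sigma>"

text \<open>After division by \<open>t powr p\<close> the function is strictly decreasing: the
  \<open>B\<close> term has the negative exponent \<open>q - p\<close>, the subtracted terms have
  positive ones, and \<open>0 < R\<close> makes the decrease strict. Hence the sign changes at most
  once, from plus to minus.\<close>

lemma fib_pos_below:
  assumes "q < p" "p < r" "p < \<sigma>" "0 < s" "s < t" "0 \<le> B" "0 < R" "0 \<le> C"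
    and "0 \<le> fib p q r \<sigma> A B R C t"
  shows "0 < fib p q r \<sigma> A B R C s"
proof -
  have t: "0 < t" using assms by simp
  have *: "fib p q r \<sigma> A B R C x = x powr p * (A + B * x powr (q - p) - R * x powr (r - p) - C * x powr (\<sigma> - p))"
    if "0 < x" for x
    using that by (simp add: fib_def algebra_simps flip: powr_add)
  have 1: "t powr (q - p) \<le> s powr (q - p)" using assms by (intro powr_mono2') auto
  have 2: "s powr (r - p) < t powr (r - p)" using assms by (intro powr_less_mono2) auto
  have 3: "s powr (\<sigma> - p) \<le> t powr (\<sigma> - p)" using assms by (intro powr_mono2) auto
  have "0 \<le> A + B * t powr (q - p) - R * t powr (r - p) - C * t powr (\<sigma> - p)"
    using assms(9) *[OF t] t by (simp add: zero_le_mult_iff)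
  also have "\<dots> < A + B * s powr (q - p) - R * s powr (r - p) - C * s powr (\<sigma> - p)"
    using mult_left_mono[OF 1, of B] mult_strict_left_mono[OF 2, of R] mult_left_mono[OF 3, of C] assms
    by linarith
  finally show ?thesis using *[of s] assms by simp
qed

lemma continuous_on_fib: "continuous_on {0<..} (fib p q r \<sigma> A B R C)"
  unfolding fib_def by (intro continuous_intros) auto

lemma fib_zero_below:
  assumes "q < p" "p < r" "p < \<sigma>" "0 < A" "0 \<le> B" "0 < T"
    and "fib p q r \<sigma> A B R C T \<le> 0"
  shows "\<exists>t>0. t \<le> T \<and> fib p q r \<sigma> A B R C t = 0"
proof -
  \<comment> \<open>\<open>B * x powr (q - p)\<close> may blow up at 0, so it is added and
    subtracted; what remains tends to \<open>A\<close>, and the nonnegative \<open>B\<close> term is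
    put back when \<open>fib\<close> is evaluated at the point found.\<close>
  have "((\<lambda>x. A + B * x powr (q - p) - R * x powr (r - p) - C * x powr (\<sigma> - p) - B * x powr (q - p)) \<longlongrightarrow> A + 0 - R * 0 - C * 0 - 0) (at_right (0::real))"
  proof -
    have z: "((\<lambda>x. x powr a) \<longlongrightarrow> 0) (at_right (0::real))" if "a > 0" for a
      using that by real_asymp
    have "((\<lambda>x. A + 0 - R * x powr (r - p) - C * x powr (\<sigma> - p) - 0) \<longlongrightarrow> A + 0 - R * 0 - C * 0 - 0) (at_right (0::real))"
      using assms by (intro tendsto_intros z) auto
    then show ?thesis by (simp add: algebra_simps)
  qed
  then have "eventually (\<lambda>x. 0 < A + B * x powr (q - p) - R * x powr (r - p) - C * x powr (\<sigma> - p) - B * x powr (q - p)) (at_right 0)"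
    using assms(4) by (intro order_tendstoD) simp_all
  moreover have "eventually (\<lambda>x. x \<in> {0<..<T}) (at_right (0::real))"
    using assms by (intro eventually_at_right_less[THEN eventually_mono] eventually_at_right_real) auto
  ultimately have "eventually (\<lambda>x. x \<in> {0<..<T} \<and> 0 < A + B * x powr (q - p) - R * x powr (r - p) - C * x powr (\<sigma> - p) - B * x powr (q - p)) (at_right 0)"
    by eventually_elim auto
  from eventually_happens'[OF trivial_limit_at_right_real this]
  obtain s where "s \<in> {0<..<T}"
    "0 < A + B * s powr (q - p) - R * s powr (r - p) - C * s powr (\<sigma> - p) - B * s powr (q - p)"
    by blast
  then have s: "0 < s" "s < T" "0 < A - R * s powr (r - p) - C * s powr (\<sigma> - p)" by simp_all
  have "0 \<le> fib p q r \<sigma> A B R C s"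
  proof -
    have "fib p q r \<sigma> A B R C s = s powr p * (A - R * s powr (r - p) - C * s powr (\<sigma> - p)) + B * s powr q"
      using s by (simp add: fib_def algebra_simps flip: powr_add)
    also have "\<dots> \<ge> 0" using s assms by (intro add_nonneg_nonneg mult_nonneg_nonneg) auto
    finally show ?thesis .
  qed
  then have "\<exists>t\<ge>s. t \<le> T \<and> fib p q r \<sigma> A B R C t = 0"
    using s assms by (intro IVT2' continuous_on_subset[OF continuous_on_fib]) auto
  with s show ?thesis by (metis order_less_le_trans)
qed

lemma fib_zero_exists:
  assumes "q < p" "p < r" "r < \<sigma>" "0 < A" "0 \<le> B" "0 < R" "0 \<le> C"
  shows "\<exists>t>0. fib p q r \<sigma> A B R C t = 0"
proof -
  have "filterlim (\<lambda>x::real. A + B * x powr (q - p) - R * x powr (r - p)) at_bot at_top"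
    using assms by real_asymp
  then have "eventually (\<lambda>x. A + B * x powr (q - p) - R * x powr (r - p) \<le> 0) at_top"
    unfolding filterlim_at_bot by blast
  then have "eventually (\<lambda>x. A + B * x powr (q - p) - R * x powr (r - p) \<le> 0 \<and> 0 < x) at_top"
    using eventually_gt_at_top[of 0] by eventually_elim auto
  then obtain T where T: "A + B * T powr (q - p) - R * T powr (r - p) \<le> 0" "0 < T"
    unfolding eventually_at_top_linorder by blast
  have "fib p q r \<sigma> A B R C T = T powr p * (A + B * T powr (q - p) - R * T powr (r - p)) - C * T powr \<sigma>"
    using T by (simp add: fib_def algebra_simps flip: powr_add)
  also have "\<dots> \<le> 0" using T assms
    by (intro diff_le_0_iff_le[THEN iffD2] order_trans[OF mult_nonneg_nonpos]) auto
  finally show ?thesis using fib_zero_below[of q p r \<sigma> A B T R C] T assms by auto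
qed

lemma fib_energy_deriv:
  assumes "p \<noteq> 0" "q \<noteq> 0" "r \<noteq> 0" "\<sigma> \<noteq> 0" "0 < t"
  shows "(fib_energy p q r \<sigma> A B R C has_real_derivative fib p q r \<sigma> A B R C t / t) (at t)"
  unfolding fib_energy_def[abs_def] fib_def using assms
  by (auto intro!: derivative_eq_intros simp: field_simps powr_diff)

text \<open>The derivative \<open>fib t / t\<close> is nonnegative before 1 and nonpositive after it
  by \<open>fib_pos_below\<close>, so a zero of \<open>fib\<close> at 1 is a global maximum of the
  energy along the ray.\<close>

lemma fib_energy_le_max:
  assumes "0 < q" "q < p" "p < r" "r < \<sigma>" "0 \<le> B" "0 < R" "0 \<le> C" "0 < t"
    and 1: "fib p q r \<sigma> A B R C 1 = 0"
  shows "fib_energy p q r \<sigma> A B R C t \<le> fib_energy p q r \<sigma> A B R C 1"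
proof (cases "t \<le> 1")
  case True
  show ?thesis
  proof (rule DERIV_nonneg_imp_nondecreasing[OF True])
    fix x assume x: "t \<le> x" "x \<le> 1"
    have "0 \<le> fib p q r \<sigma> A B R C x"
      using fib_pos_below[of q p r \<sigma> x 1 B R C A] 1 x assms by (cases "x = 1") auto
    then show "\<exists>y. (fib_energy p q r \<sigma> A B R C has_real_derivative y) (at x) \<and> 0 \<le> y"
      using fib_energy_deriv[of p q r \<sigma> x A B R C] assms x by (intro exI[of _ "fib p q r \<sigma> A B R C x / x"] conjI) auto
  qed
next
  case False
  show ?thesis
  proof (rule DERIV_nonpos_imp_nonincreasing[of 1 t])
    show "1 \<le> t" using False by simp
    fix x assume x: "1 \<le> x" "x \<le> t"
    have "fib p q r \<sigma> A B R C x \<le> 0"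
      using fib_pos_below[of q p r \<sigma> 1 x B R C A] 1 x assms by (cases "x = 1") force+
    then show "\<exists>y. (fib_energy p q r \<sigma> A B R C has_real_derivative y) (at x) \<and> y \<le> 0"
      using fib_energy_deriv[of p q r \<sigma> x A B R C] assms x
      by (intro exI[of _ "fib p q r \<sigma> A B R C x / x"] conjI) (auto simp: divide_le_0_iff)
  qed
qed

text \<open>A curve of fibering maps whose Nehari energies are minimal at parameter 0. Since
  \<open>1\<close> maximises the fibering map at parameter 0, no derivative of the projection time
  \<open>t\<close> with respect to the parameter is needed.\<close>

lemma nehari_one_sided_derivative:
  fixes a b \<rho> \<gamma> :: "real \<Rightarrow> real"
  assumes pq: "0 < q" "q < p" "p < r" "r < \<sigma>"
    and pos: "0 < a 0" "\<And>e. 0 \<le> b e" "0 < \<rho> 0" "\<And>e. 0 \<le> \<gamma> e"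
    and der: "(a has_real_derivative a') (at 0)" "(b has_real_derivative b') (at 0)"
      "(\<rho> has_real_derivative \<rho>') (at 0)" "(\<gamma> has_real_derivative \<gamma>') (at 0)"
    and neh: "fib p q r \<sigma> (a 0) (b 0) (\<rho> 0) (\<gamma> 0) 1 = 0"
    and min: "\<And>e t. 0 < t \<Longrightarrow> 0 < \<rho> e \<Longrightarrow> fib p q r \<sigma> (a e) (b e) (\<rho> e) (\<gamma> e) t = 0 \<Longrightarrow>
        fib_energy p q r \<sigma> (a 0) (b 0) (\<rho> 0) (\<gamma> 0) 1 \<le> fib_energy p q r \<sigma> (a e) (b e) (\<rho> e) (\<gamma> e) t"
  shows "0 \<le> a' / p + b' / q - \<rho>' / r - \<gamma>' / \<sigma>"
proof -
  let ?F = "\<lambda>e t. fib p q r \<sigma> (a e) (b e) (\<rho> e) (\<gamma> e) t"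
  let ?E = "\<lambda>e t. fib_energy p q r \<sigma> (a e) (b e) (\<rho> e) (\<gamma> e) t"
  have lim: "(a \<longlongrightarrow> a 0) (at_right 0)" "(b \<longlongrightarrow> b 0) (at_right 0)" "(\<rho> \<longlongrightarrow> \<rho> 0) (at_right 0)" "(\<gamma> \<longlongrightarrow> \<gamma> 0) (at_right 0)"
    using der[THEN DERIV_isCont] unfolding isCont_def
    by (auto intro: tendsto_within_subset)
  have limF: "((\<lambda>e. ?F e t) \<longlongrightarrow> ?F 0 t) (at_right 0)" for t
    unfolding fib_def by (intro tendsto_intros lim)
  \<comment> \<open>The strict signs of the fibering map at \<open>1 - d/2\<close> and
    \<open>1 + d/2\<close> survive a small change of \<open>e\<close>, and the intermediate value
    theorem gives a projection time close to 1.\<close>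
  have near: "eventually (\<lambda>e. \<exists>t. 1 - d < t \<and> t < 1 + d \<and> 0 < t \<and> ?F e t = 0 \<and> 0 < \<rho> e) (at_right 0)"
    if d: "0 < d" "d < 1" for d
  proof -
    have "0 < ?F 0 (1 - d/2)"
      using fib_pos_below[of q p r \<sigma> "1 - d/2" 1 "b 0" "\<rho> 0" "\<gamma> 0" "a 0"] neh pq pos d by auto
    then have e1: "eventually (\<lambda>e. 0 < ?F e (1 - d/2)) (at_right 0)"
      using order_tendstoD(1)[OF limF] by auto
    have "?F 0 (1 + d/2) < 0"
    proof (rule ccontr)
      assume "\<not> ?F 0 (1 + d/2) < 0"
      then have "0 < ?F 0 1"
        using fib_pos_below[of q p r \<sigma> 1 "1 + d/2" "b 0" "\<rho> 0" "\<gamma> 0" "a 0"] pq pos d by auto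
      with neh show False by simp
    qed
    then have e2: "eventually (\<lambda>e. ?F e (1 + d/2) < 0) (at_right 0)"
      using order_tendstoD(2)[OF limF] by auto
    have e3: "eventually (\<lambda>e. 0 < \<rho> e) (at_right 0)"
      using order_tendstoD(1)[OF lim(3)] pos by auto
    from e1 e2 e3 show ?thesis
    proof eventually_elim
      case (elim e)
      have "\<exists>t\<ge>1 - d/2. t \<le> 1 + d/2 \<and> ?F e t = 0"
        using d elim by (intro IVT2' continuous_on_subset[OF continuous_on_fib]) auto
      then obtain t where "1 - d/2 \<le> t" "t \<le> 1 + d/2" "?F e t = 0" by auto
      with d elim show ?case by (intro exI[of _ t]) auto
    qed
  qed
  define P where "P e t \<longleftrightarrow> 0 < t \<and> ?F e t = 0 \<and> 0 < \<rho> e" for e t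
  have ex: "\<exists>e>0. e < 1 / Suc n \<and> (\<exists>t. \<bar>t - 1\<bar> < 1 / (Suc n) \<and> P e t)" for n
  proof -
    have "eventually (\<lambda>e. \<exists>t. 1 - 1 / Suc (Suc n) < t \<and> t < 1 + 1 / Suc (Suc n) \<and> 0 < t \<and> ?F e t = 0 \<and> 0 < \<rho> e) (at_right 0)"
      by (rule near) auto
    moreover have "eventually (\<lambda>e. e \<in> {0<..<1 / Suc n}) (at_right (0::real))"
      by (intro eventually_at_right_real) auto
    ultimately have "eventually (\<lambda>e. e \<in> {0<..<1 / Suc n} \<and> (\<exists>t. 1 - 1 / Suc (Suc n) < t \<and> t < 1 + 1 / Suc (Suc n) \<and> 0 < t \<and> ?F e t = 0 \<and> 0 < \<rho> e)) (at_right 0)"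
      by eventually_elim auto
    then obtain e t where et: "e \<in> {0<..<1 / Suc n}" "1 - 1 / Suc (Suc n) < t" "t < 1 + 1 / Suc (Suc n)" "0 < t" "?F e t = 0" "0 < \<rho> e"
      using eventually_happens'[OF trivial_limit_at_right_real] by blast
    have "1 / real (Suc (Suc n)) < 1 / Suc n" by (simp add: field_simps)
    then have "\<bar>t - 1\<bar> < 1 / Suc n" using et(2,3) by linarith
    with et show ?thesis unfolding P_def by (intro exI[of _ e]) auto
  qed
  then obtain e t where et: "\<And>n. 0 < e n" "\<And>n. e n < 1 / Suc n" "\<And>n. \<bar>t n - 1\<bar> < 1 / Suc n" "\<And>n. P (e n) (t n)"
    by metis
  have e0: "e \<longlonglongrightarrow> 0"
    by (rule tendsto_sandwich[OF _ _ tendsto_const LIMSEQ_inverse_real_of_nat])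
      (use et in \<open>auto intro!: always_eventually simp: less_imp_le inverse_eq_divide\<close>)
  have t1: "t \<longlonglongrightarrow> 1"
  proof (rule LIMSEQ_I)
    fix d :: real assume "0 < d"
    then obtain m where m: "1 / Suc m < d" by (metis nat_approx_posE)
    have "norm (t n - 1) < d" if "n \<ge> m" for n
    proof -
      have "1 / real (Suc n) \<le> 1 / Suc m" using that by (intro divide_left_mono) auto
      then show ?thesis using et(3)[of n] m by simp
    qed
    then show "\<exists>m. \<forall>n\<ge>m. norm (t n - 1) < d" by blast
  qed
  have "e n \<noteq> 0" for n using et(1)[of n] by simp
  then have e0': "filterlim e (at 0) sequentially"
    using e0 by (intro filterlim_atI) simp_all
  have dq: "(\<lambda>n. (f (e n) - f 0) / e n) \<longlonglongrightarrow> f'" if "(f has_real_derivative f') (at 0)" for f f'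
    using filterlim_compose[OF that[unfolded DERIV_def] e0'] by simp
  have "(\<lambda>n. (a (e n) - a 0) / e n / p * t n powr p + (b (e n) - b 0) / e n / q * t n powr q
      - (\<rho> (e n) - \<rho> 0) / e n / r * t n powr r - (\<gamma> (e n) - \<gamma> 0) / e n / \<sigma> * t n powr \<sigma>)
     \<longlonglongrightarrow> a' / p * 1 powr p + b' / q * 1 powr q - \<rho>' / r * 1 powr r - \<gamma>' / \<sigma> * 1 powr \<sigma>"
    using pq by (intro tendsto_intros dq der t1) auto
  moreover have "0 \<le> (a (e n) - a 0) / e n / p * t n powr p + (b (e n) - b 0) / e n / q * t n powr q
      - (\<rho> (e n) - \<rho> 0) / e n / r * t n powr r - (\<gamma> (e n) - \<gamma> 0) / e n / \<sigma> * t n powr \<sigma>" for n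
  proof -
    \<comment> \<open>Maximality of 1 along the unperturbed ray and minimality over the curve are
      chained at the same time \<open>t n\<close>. The quotient therefore compares energies with
      equal \<open>t\<close>, and only the coefficients are differenced.\<close>
    have "?E 0 (t n) \<le> ?E 0 1"
      using et(4)[of n] pq pos neh by (intro fib_energy_le_max) (auto simp: P_def)
    also have "\<dots> \<le> ?E (e n) (t n)"
      using et(4)[of n] by (intro min) (auto simp: P_def)
    finally have "0 \<le> (?E (e n) (t n) - ?E 0 (t n)) / e n"
      using et(1)[of n] by simp
    also have "\<dots> = (a (e n) - a 0) / e n / p * t n powr p + (b (e n) - b 0) / e n / q * t n powr q
      - (\<rho> (e n) - \<rho> 0) / e n / r * t n powr r - (\<gamma> (e n) - \<gamma> 0) / e n / \<sigma> * t n powr \<sigma>"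
      using et(1)[of n] pq unfolding fib_energy_def
      by (simp add: diff_divide_distrib add_divide_distrib left_diff_distrib right_diff_distrib mult.commute)
    finally show ?thesis .
  qed
  ultimately have "0 \<le> a' / p * 1 powr p + b' / q * 1 powr q - \<rho>' / r * 1 powr r - \<gamma>' / \<sigma> * 1 powr \<sigma>"
    by (intro LIMSEQ_le_const) auto
  then show ?thesis by simp
qed

section \<open>Integrals of powers\<close>

lemma abs_powr_add_le:
  fixes a b :: real assumes "0 \<le> p"
  shows "\<bar>a + b\<bar> powr p \<le> 2 powr p * (\<bar>a\<bar> powr p + \<bar>b\<bar> powr p)"
proof -
  have "\<bar>a + b\<bar> powr p \<le> (2 * max \<bar>a\<bar> \<bar>b\<bar>) powr p"
    using assms by (intro powr_mono2) auto
  also have "\<dots> = 2 powr p * max \<bar>a\<bar> \<bar>b\<bar> powr p" by (simp add: powr_mult)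
  also have "max \<bar>a\<bar> \<bar>b\<bar> powr p \<le> \<bar>a\<bar> powr p + \<bar>b\<bar> powr p" by (simp add: max_def)
  finally show ?thesis by simp
qed

lemma abs_powr_diff_le:
  fixes a b :: real assumes "0 \<le> p"
  shows "\<bar>a - b\<bar> powr p \<le> 2 powr p * (\<bar>a\<bar> powr p + \<bar>b\<bar> powr p)"
  using abs_powr_add_le[OF assms, of a "-b"] by simp

lemma powr_increment_le:
  fixes x y :: real assumes "1 \<le> p" "0 \<le> x" "x \<le> y"
  shows "y powr p - x powr p \<le> p * y powr (p - 1) * (y - x)"
proof (cases "x = 0 \<or> x = y")
  case True
  then show ?thesis
  proof
    assume "x = 0"
    moreover have "y powr p \<le> p * y powr (p - 1) * y"
    proof (cases "y = 0")
      case False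
      then have "y powr (p - 1) * y = y powr p" using assms by (simp add: powr_mult_base mult.commute)
      then show ?thesis using assms mult_right_mono[of 1 p "y powr p"] by (simp add: mult.assoc)
    qed simp
    ultimately show ?thesis by simp
  qed simp
next
  case False
  then have x: "0 < x" "x < y" using assms by auto
  have "\<exists>z>x. z < y \<and> y powr p - x powr p = (y - x) * (p * z powr (p - 1))"
    using x by (intro MVT2[of x y "\<lambda>z. z powr p"] has_real_derivative_powr) auto
  then obtain z where z: "x < z" "z < y" "y powr p - x powr p = (y - x) * (p * z powr (p - 1))" by blast
  have "z powr (p - 1) \<le> y powr (p - 1)" using z x assms by (intro powr_mono2) auto
  then show ?thesis using z x assms by (simp add: mult.commute mult_left_mono)
qed

lemma abs_powr_increment_le:
  fixes a b :: real assumes "1 \<le> p"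
  shows "\<bar>\<bar>a + b\<bar> powr p - \<bar>a\<bar> powr p\<bar> \<le> p * (\<bar>a\<bar> + \<bar>b\<bar>) powr (p - 1) * \<bar>b\<bar>"
proof -
  have *: "y powr p - x powr p \<le> p * (\<bar>a\<bar> + \<bar>b\<bar>) powr (p - 1) * \<bar>b\<bar>" "x powr p \<le> y powr p"
    if "0 \<le> x" "x \<le> y" "y \<le> \<bar>a\<bar> + \<bar>b\<bar>" "y - x \<le> \<bar>b\<bar>" for x y :: real
  proof -
    have "y powr p - x powr p \<le> p * y powr (p - 1) * (y - x)" using powr_increment_le assms that by simp
    also have "\<dots> \<le> p * (\<bar>a\<bar> + \<bar>b\<bar>) powr (p - 1) * \<bar>b\<bar>"
      using that assms by (intro mult_mono powr_mono2) auto
    finally show "y powr p - x powr p \<le> p * (\<bar>a\<bar> + \<bar>b\<bar>) powr (p - 1) * \<bar>b\<bar>" .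
    show "x powr p \<le> y powr p" using that assms by (intro powr_mono2) auto
  qed
  show ?thesis
  proof (cases "\<bar>a\<bar> \<le> \<bar>a + b\<bar>")
    case True then show ?thesis using *[of "\<bar>a\<bar>" "\<bar>a + b\<bar>"] by simp
  next
    case False then show ?thesis using *[of "\<bar>a + b\<bar>" "\<bar>a\<bar>"] by simp
  qed
qed

text \<open>The pointwise inequality behind Brezis--Lieb. If
  \<open>\<bar>b\<bar> \<le> d * \<bar>a\<bar>\<close>, the increment is a small multiple of
  \<open>\<bar>a\<bar> powr p\<close>; otherwise \<open>\<bar>a\<bar>\<close> is controlled by
  \<open>\<bar>b\<bar> / d\<close> and everything is a multiple of
  \<open>\<bar>b\<bar> powr p\<close>.\<close>

lemma abs_powr_increment_young:
  fixes e :: real assumes "1 \<le> p" "0 < e"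
  shows "\<exists>C\<ge>0. \<forall>a b. \<bar>\<bar>a + b\<bar> powr p - \<bar>a\<bar> powr p\<bar> \<le> e * \<bar>a\<bar> powr p + C * \<bar>b\<bar> powr p"
proof -
  \<comment> \<open>For \<open>\<bar>b\<bar> \<le> d * \<bar>a\<bar>\<close> and
    \<open>d \<le> 1\<close> the mean value bound is at most
    \<open>p * (2 * \<bar>a\<bar>) powr (p - 1) * (d * \<bar>a\<bar>)\<close>; \<open>d\<close>
    brings its coefficient down to \<open>e\<close>.\<close>
  define d where "d = min 1 (e / (p * 2 powr (p - 1)))"
  have d: "0 < d" "d \<le> 1" "p * 2 powr (p - 1) * d \<le> e"
    using assms by (auto simp: d_def field_simps min_def)
  define C where "C = p * (1 / d + 1) powr (p - 1)"
  have "\<bar>\<bar>a + b\<bar> powr p - \<bar>a\<bar> powr p\<bar> \<le> e * \<bar>a\<bar> powr p + C * \<bar>b\<bar> powr p" for a b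
  proof (cases "\<bar>b\<bar> \<le> d * \<bar>a\<bar>")
    case True
    have da: "d * \<bar>a\<bar> \<le> \<bar>a\<bar>" using d by (simp add: mult_left_le_one_le)
    have "\<bar>\<bar>a + b\<bar> powr p - \<bar>a\<bar> powr p\<bar> \<le> p * (\<bar>a\<bar> + \<bar>b\<bar>) powr (p - 1) * \<bar>b\<bar>"
      by (rule abs_powr_increment_le[OF assms(1)])
    also have "\<dots> \<le> p * (2 * \<bar>a\<bar>) powr (p - 1) * (d * \<bar>a\<bar>)"
      using assms True da by (intro mult_mono powr_mono2) auto
    also have "\<dots> = (p * 2 powr (p - 1) * d) * (\<bar>a\<bar> * \<bar>a\<bar> powr (p - 1))"
      by (simp add: powr_mult algebra_simps)
    also have "\<bar>a\<bar> * \<bar>a\<bar> powr (p - 1) = \<bar>a\<bar> powr p"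
      by (cases "a = 0") (simp_all add: powr_mult_base)
    also have "(p * 2 powr (p - 1) * d) * \<bar>a\<bar> powr p \<le> e * \<bar>a\<bar> powr p"
      using d by (intro mult_right_mono) auto
    also have "\<dots> \<le> e * \<bar>a\<bar> powr p + C * \<bar>b\<bar> powr p"
      using assms by (auto simp: C_def)
    finally show ?thesis .
  next
    case False
    then have ab: "\<bar>a\<bar> \<le> (1 / d) * \<bar>b\<bar>" using d by (simp add: field_simps)
    have "\<bar>\<bar>a + b\<bar> powr p - \<bar>a\<bar> powr p\<bar> \<le> p * (\<bar>a\<bar> + \<bar>b\<bar>) powr (p - 1) * \<bar>b\<bar>"
      by (rule abs_powr_increment_le[OF assms(1)])
    also have "\<dots> \<le> p * ((1 / d + 1) * \<bar>b\<bar>) powr (p - 1) * \<bar>b\<bar>"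
      using assms ab by (intro mult_right_mono mult_left_mono powr_mono2) (auto simp: algebra_simps)
    also have "\<dots> = C * (\<bar>b\<bar> * \<bar>b\<bar> powr (p - 1))"
      using d by (simp add: powr_mult C_def)
    also have "\<bar>b\<bar> * \<bar>b\<bar> powr (p - 1) = \<bar>b\<bar> powr p"
      by (cases "b = 0") (simp_all add: powr_mult_base)
    also have "C * \<bar>b\<bar> powr p \<le> e * \<bar>a\<bar> powr p + C * \<bar>b\<bar> powr p" using assms by simp
    finally show ?thesis .
  qed
  moreover have "0 \<le> C" using assms by (simp add: C_def)
  ultimately show ?thesis by blast
qed

lemma DERIV_abs_powr:
  fixes x :: real assumes "1 < p"
  shows "((\<lambda>x. \<bar>x\<bar> powr p) has_real_derivative p * \<bar>x\<bar> powr (p - 2) * x) (at x)"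
proof -
  consider "x > 0" | "x < 0" | "x = 0" by linarith
  then show ?thesis
  proof cases
    case 1
    have "((\<lambda>x. x powr p) has_real_derivative p * \<bar>x\<bar> powr (p - 2) * x) (at x)"
      using 1 by (auto intro!: derivative_eq_intros simp: powr_diff field_simps power2_eq_square)
    then show ?thesis
      by (rule has_field_derivative_transform_within_open[of _ _ _ "{0<..}"]) (use 1 in auto)
  next
    case 2
    have "((\<lambda>x. (- x) powr p) has_real_derivative p * \<bar>x\<bar> powr (p - 2) * x) (at x)"
      using 2 by (auto intro!: derivative_eq_intros simp: powr_diff field_simps power2_eq_square)
    then show ?thesis
      by (rule has_field_derivative_transform_within_open[of _ _ _ "{..<0}"]) (use 2 in auto)
  next
    case 3
    have "((\<lambda>h. \<bar>h\<bar> powr (p - 1)) \<longlongrightarrow> \<bar>0\<bar> powr (p - 1)) (at (0::real))"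
      using assms by (intro tendsto_powr2 tendsto_intros tendsto_ident_at) auto
    then have "((\<lambda>h. \<bar>h\<bar> powr (p - 1)) \<longlongrightarrow> 0) (at (0::real))" by simp
    then have "((\<lambda>h. norm (\<bar>h\<bar> powr p / h)) \<longlongrightarrow> 0) (at (0::real))"
      by (rule Lim_transform_within[OF _ zero_less_one]) (auto simp: powr_diff abs_mult)
    then have "((\<lambda>h. \<bar>h\<bar> powr p / h) \<longlongrightarrow> 0) (at (0::real))"
      by (rule tendsto_norm_zero_cancel)
    then show ?thesis using 3 by (simp add: DERIV_def)
  qed
qed

lemma powr_small_le_half:
  assumes "0 < K" "1 < a" shows "\<exists>\<rho>>0. \<forall>x. 0 \<le> x \<longrightarrow> x \<le> \<rho> \<longrightarrow> K * x powr a \<le> x / (2::real)"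
proof (intro exI conjI allI impI)
  \<comment> \<open>The witness solves \<open>K * x powr (a - 1) = 1 / 2\<close>.\<close>
  show "0 < (1 / (2 * K)) powr (1 / (a - 1))" using assms by simp
  fix x :: real assume x: "0 \<le> x" "x \<le> (1 / (2 * K)) powr (1 / (a - 1))"
  have "x powr (a - 1) \<le> ((1 / (2 * K)) powr (1 / (a - 1))) powr (a - 1)"
    using x assms by (intro powr_mono2) auto
  also have "\<dots> = 1 / (2 * K)" using assms by (simp add: powr_powr)
  finally have "K * x powr (a - 1) \<le> 1 / 2" using assms by (simp add: field_simps)
  then have "(K * x powr (a - 1)) * x \<le> (1 / 2) * x" using x by (intro mult_right_mono)
  moreover have "x powr (a - 1) * x = x powr a" using x by (cases "x = 0") (auto simp: powr_mult_base mult.commute)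
  ultimately show "K * x powr a \<le> x / 2" by (simp add: mult.assoc)
qed

section \<open>Limits and derivatives of integrals of powers\<close>

lemma integral_tendsto_zero_young:
  fixes g h :: "nat \<Rightarrow> 'a \<Rightarrow> real"
  assumes [measurable]: "\<And>n. g n \<in> borel_measurable M"
    and g0: "\<And>n x. 0 \<le> g n x" and lim: "AE x in M. (\<lambda>n. g n x) \<longlonglongrightarrow> 0"
    and h: "\<And>n. integrable M (h n)" "\<And>n x. 0 \<le> h n x" "\<And>n. (\<integral>x. h n x \<partial>M) \<le> K"
    and dom: "\<And>e. 0 < e \<Longrightarrow> \<exists>H. integrable M H \<and> (\<forall>n x. g n x \<le> e * h n x + H x)"
  shows "\<And>n. integrable M (g n)" and "(\<lambda>n. \<integral>x. g n x \<partial>M) \<longlonglongrightarrow> 0"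
proof -
  obtain H1 where H1: "integrable M H1" "\<And>n x. g n x \<le> h n x + H1 x" using dom[of 1] by auto
  show gi: "integrable M (g n)" for n
    by (rule Bochner_Integration.integrable_bound[of _ "\<lambda>x. h n x + H1 x"])
      (use h H1 g0 in \<open>auto intro!: AE_I2 order_trans[OF _ abs_ge_self]\<close>)
  have K: "0 \<le> K" using h(2)[of 0] h(3)[of 0] by (intro order_trans[OF integral_nonneg_AE h(3)[of 0]]) simp
  show "(\<lambda>n. \<integral>x. g n x \<partial>M) \<longlonglongrightarrow> 0"
  proof (rule LIMSEQ_I)
    fix d :: real assume d: "0 < d"
    \<comment> \<open>\<open>K + 1\<close> in place of \<open>K\<close> also covers
      \<open>K = 0\<close>.\<close>
    define e where "e = d / (2 * (K + 1))"
    have e: "0 < e" using d K by (simp add: e_def)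
    obtain H where H: "integrable M H" "\<And>n x. g n x \<le> e * h n x + H x" using dom[OF e] by auto
    \<comment> \<open>A Vitali-type argument: the excess over \<open>e * h n\<close> is dominated by
      the fixed function \<open>H\<close>, so its integral tends to 0, and the rest contributes at
      most \<open>e * K\<close>.\<close>
    define f where "f n x = max 0 (g n x - e * h n x)" for n x
    have [measurable]: "h n \<in> borel_measurable M" "H \<in> borel_measurable M" for n using h H by auto
    have fm[measurable]: "f n \<in> borel_measurable M" for n unfolding f_def by measurable
    have fb: "norm (f n x) \<le> norm (H x)" for n x
      using H(2)[of n x] by (auto simp: f_def)
    have fi: "integrable M (f n)" for n
      by (rule Bochner_Integration.integrable_bound[OF H(1)]) (use fb in auto)
    have "(\<lambda>n. \<integral>x. f n x \<partial>M) \<longlonglongrightarrow> (\<integral>x. 0 \<partial>M)"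
    proof (rule integral_dominated_convergence[where w = "\<lambda>x. norm (H x)"])
      show "AE x in M. (\<lambda>n. f n x) \<longlonglongrightarrow> 0" using lim
      proof eventually_elim
        case (elim x)
        show ?case
          by (rule tendsto_sandwich[OF _ _ tendsto_const elim])
            (use g0 h(2) e in \<open>auto simp: f_def intro!: always_eventually mult_nonneg_nonneg\<close>)
      qed
    qed (use H fb in auto)
    then have "eventually (\<lambda>n. (\<integral>x. f n x \<partial>M) < d / 2) sequentially"
      using d by (intro order_tendstoD) auto
    then obtain m where m: "\<And>n. n \<ge> m \<Longrightarrow> (\<integral>x. f n x \<partial>M) < d / 2"
      unfolding eventually_sequentially by blast
    have "norm ((\<integral>x. g n x \<partial>M) - 0) < d" if "n \<ge> m" for n
    proof -
      have "(\<integral>x. g n x \<partial>M) \<le> (\<integral>x. f n x + e * h n x \<partial>M)"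
        using gi fi h(1) by (intro integral_mono) (auto simp: f_def)
      also have "\<dots> = (\<integral>x. f n x \<partial>M) + e * (\<integral>x. h n x \<partial>M)"
        using fi h(1) by simp
      also have "\<dots> < d / 2 + d / 2"
      proof (rule add_less_le_mono[OF m[OF that]])
        have "e * (\<integral>x. h n x \<partial>M) \<le> e * (K + 1)"
          using h(3)[of n] e by (intro mult_left_mono) auto
        also have "\<dots> = d / 2" using K by (simp add: e_def field_simps)
        finally show "e * (\<integral>x. h n x \<partial>M) \<le> d / 2" .
      qed
      finally show ?thesis using g0 by (simp add: integral_nonneg_AE)
    qed
    then show "\<exists>m. \<forall>n\<ge>m. norm ((\<integral>x. g n x \<partial>M) - 0) < d" by blast
  qed
qed

lemma integrable_abs_powr_add:
  fixes f g :: "'a \<Rightarrow> real"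
  assumes "0 \<le> p" "f \<in> borel_measurable M" "g \<in> borel_measurable M"
    and "integrable M (\<lambda>x. \<bar>f x\<bar> powr p)" "integrable M (\<lambda>x. \<bar>g x\<bar> powr p)"
  shows "integrable M (\<lambda>x. \<bar>f x + c * g x\<bar> powr p)"
proof (rule Bochner_Integration.integrable_bound)
  show "integrable M (\<lambda>x. 2 powr p * (\<bar>f x\<bar> powr p + \<bar>c\<bar> powr p * \<bar>g x\<bar> powr p))"
    using assms by (intro integrable_mult_right Bochner_Integration.integrable_add) auto
  show "AE x in M. norm (\<bar>f x + c * g x\<bar> powr p) \<le> norm (2 powr p * (\<bar>f x\<bar> powr p + \<bar>c\<bar> powr p * \<bar>g x\<bar> powr p))"
    using abs_powr_add_le[OF assms(1), of "f x" "c * g x" for x] by (auto simp: abs_mult powr_mult)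
qed (use assms in measurable)

text \<open>Fatou's lemma: the bound passes to the limit and yields its integrability. This is what
  puts almost everywhere limits back into the function space.\<close>

lemma integrable_abs_powr_limit:
  fixes f :: "nat \<Rightarrow> 'a \<Rightarrow> real"
  assumes [measurable]: "\<And>n. f n \<in> borel_measurable M" "g \<in> borel_measurable M"
    and lim: "AE x in M. (\<lambda>n. f n x) \<longlonglongrightarrow> g x" and p: "0 < p"
    and int: "\<And>n. integrable M (\<lambda>x. \<bar>f n x\<bar> powr p)" and K: "\<And>n. (\<integral>x. \<bar>f n x\<bar> powr p \<partial>M) \<le> K"
  shows "integrable M (\<lambda>x. \<bar>g x\<bar> powr p)" "(\<integral>x. \<bar>g x\<bar> powr p \<partial>M) \<le> K"
proof -
  have K0: "0 \<le> K" using K[of 0] by (rule order_trans[rotated]) auto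
  have "(\<integral>\<^sup>+x. ennreal (\<bar>g x\<bar> powr p) \<partial>M) = (\<integral>\<^sup>+x. liminf (\<lambda>n. ennreal (\<bar>f n x\<bar> powr p)) \<partial>M)"
  proof (rule nn_integral_cong_AE, use lim in eventually_elim)
    case (elim x)
    have "(\<lambda>n. ennreal (\<bar>f n x\<bar> powr p)) \<longlonglongrightarrow> ennreal (\<bar>g x\<bar> powr p)"
      using elim p by (intro tendsto_ennrealI tendsto_powr2 tendsto_intros) auto
    then show ?case by (rule lim_imp_Liminf[OF sequentially_bot, symmetric])
  qed
  also have "\<dots> \<le> liminf (\<lambda>n. \<integral>\<^sup>+x. ennreal (\<bar>f n x\<bar> powr p) \<partial>M)"
    by (rule nn_integral_liminf) measurable
  also have "\<dots> \<le> liminf (\<lambda>n::nat. ennreal K)"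
  proof (intro Liminf_mono always_eventually allI)
    show "(\<integral>\<^sup>+x. ennreal (\<bar>f n x\<bar> powr p) \<partial>M) \<le> ennreal K" for n
      using int[of n] K[of n] by (subst nn_integral_eq_integral) (auto intro: ennreal_leI)
  qed
  also have "\<dots> = ennreal K" by (simp add: Liminf_const)
  finally have *: "(\<integral>\<^sup>+x. ennreal (\<bar>g x\<bar> powr p) \<partial>M) \<le> ennreal K" .
  then show "integrable M (\<lambda>x. \<bar>g x\<bar> powr p)"
    by (intro integrableI_bounded) (auto simp: le_less_trans[OF _ ennreal_less_top])
  then show "(\<integral>x. \<bar>g x\<bar> powr p \<partial>M) \<le> K"
    using * K0 by (simp add: nn_integral_eq_integral)
qed

text \<open>Apply \<open>abs_powr_increment_young\<close> with \<open>a = f n x - g x\<close> and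
  \<open>b = g x\<close>: the defect is at most \<open>e * \<bar>f n x - g x\<bar> powr p\<close>,
  whose integral is bounded by a multiple of \<open>e\<close>, plus a fixed integrable function.
  This is the situation of \<open>integral_tendsto_zero_young\<close>.\<close>

lemma brezis_lieb:
  fixes f :: "nat \<Rightarrow> 'a \<Rightarrow> real"
  assumes [measurable]: "\<And>n. f n \<in> borel_measurable M" "g \<in> borel_measurable M"
    and lim: "AE x in M. (\<lambda>n. f n x) \<longlonglongrightarrow> g x" and p: "1 \<le> p"
    and int: "\<And>n. integrable M (\<lambda>x. \<bar>f n x\<bar> powr p)" and K: "\<And>n. (\<integral>x. \<bar>f n x\<bar> powr p \<partial>M) \<le> K"
  shows "(\<lambda>n. (\<integral>x. \<bar>f n x\<bar> powr p \<partial>M) - (\<integral>x. \<bar>f n x - g x\<bar> powr p \<partial>M)) \<longlonglongrightarrow> (\<integral>x. \<bar>g x\<bar> powr p \<partial>M)"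
proof -
  have gi: "integrable M (\<lambda>x. \<bar>g x\<bar> powr p)" "(\<integral>x. \<bar>g x\<bar> powr p \<partial>M) \<le> K"
    by (rule integrable_abs_powr_limit[OF assms(1,2) lim _ int K], use p in simp)+
  have di: "integrable M (\<lambda>x. \<bar>f n x - g x\<bar> powr p)" for n
    using integrable_abs_powr_add[of p "f n" M g "-1"] p int gi by simp
  have dK: "(\<integral>x. \<bar>f n x - g x\<bar> powr p \<partial>M) \<le> 2 powr p * (K + K)" for n
  proof -
    have "(\<integral>x. \<bar>f n x - g x\<bar> powr p \<partial>M) \<le> (\<integral>x. 2 powr p * (\<bar>f n x\<bar> powr p + \<bar>g x\<bar> powr p) \<partial>M)"
      using p int gi di by (intro integral_mono abs_powr_diff_le) auto
    also have "\<dots> = 2 powr p * ((\<integral>x. \<bar>f n x\<bar> powr p \<partial>M) + (\<integral>x. \<bar>g x\<bar> powr p \<partial>M))"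
      using int gi by simp
    also have "\<dots> \<le> 2 powr p * (K + K)" using K gi by (intro mult_left_mono add_mono) auto
    finally show ?thesis .
  qed
  define F where "F n x = \<bar>\<bar>f n x\<bar> powr p - \<bar>f n x - g x\<bar> powr p - \<bar>g x\<bar> powr p\<bar>" for n x
  have "(\<lambda>n. \<integral>x. F n x \<partial>M) \<longlonglongrightarrow> 0"
  proof (rule integral_tendsto_zero_young(2))
    show "integrable M (\<lambda>x. \<bar>f n x - g x\<bar> powr p)" for n by (rule di)
    show "(\<integral>x. \<bar>f n x - g x\<bar> powr p \<partial>M) \<le> 2 powr p * (K + K)" for n by (rule dK)
    show "AE x in M. (\<lambda>n. F n x) \<longlonglongrightarrow> 0" using lim
    proof eventually_elim
      case (elim x)
      have "(\<lambda>n. F n x) \<longlonglongrightarrow> \<bar>\<bar>g x\<bar> powr p - \<bar>g x - g x\<bar> powr p - \<bar>g x\<bar> powr p\<bar>"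
        unfolding F_def using elim p by (intro tendsto_intros tendsto_powr2) auto
      then show ?case by simp
    qed
    fix e :: real assume "0 < e"
    then obtain C where C: "\<And>a b. \<bar>\<bar>a + b\<bar> powr p - \<bar>a\<bar> powr p\<bar> \<le> e * \<bar>a\<bar> powr p + C * \<bar>b\<bar> powr p"
      using abs_powr_increment_young[OF p] by blast
    have "F n x \<le> e * \<bar>f n x - g x\<bar> powr p + (C + 1) * \<bar>g x\<bar> powr p" for n x
      using C[of "f n x - g x" "g x"]
        abs_triangle_ineq4[of "\<bar>f n x\<bar> powr p - \<bar>f n x - g x\<bar> powr p" "\<bar>g x\<bar> powr p"]
      unfolding F_def by (simp add: algebra_simps)
    then show "\<exists>H. integrable M H \<and> (\<forall>n x. F n x \<le> e * \<bar>f n x - g x\<bar> powr p + H x)"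
      using gi by (intro exI[of _ "\<lambda>x. (C + 1) * \<bar>g x\<bar> powr p"]) auto
  qed (auto simp: F_def[abs_def])
  then have "(\<lambda>n. (\<integral>x. \<bar>f n x\<bar> powr p - \<bar>f n x - g x\<bar> powr p - \<bar>g x\<bar> powr p \<partial>M)) \<longlonglongrightarrow> 0"
    by (rule Lim_null_comparison[rotated]) (auto simp: F_def intro!: always_eventually)
  then have "(\<lambda>n. (\<integral>x. \<bar>f n x\<bar> powr p \<partial>M) - (\<integral>x. \<bar>f n x - g x\<bar> powr p \<partial>M) - (\<integral>x. \<bar>g x\<bar> powr p \<partial>M)) \<longlonglongrightarrow> 0"
    using int di gi by simp
  then show ?thesis by (simp add: LIM_zero_iff)
qed

text \<open>The bound at the higher exponent \<open>p\<close> prevents concentration at the exponent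
  \<open>r\<close>, and the finite measure of \<open>S\<close> prevents mass from escaping.\<close>

lemma integral_subcritical_tendsto:
  fixes f :: "nat \<Rightarrow> 'a \<Rightarrow> real"
  assumes [measurable]: "\<And>n. f n \<in> borel_measurable M" "g \<in> borel_measurable M"
    and lim: "AE x in M. (\<lambda>n. f n x) \<longlonglongrightarrow> g x" and r: "0 < r" "r < p"
    and int: "\<And>n. integrable M (\<lambda>x. \<bar>f n x\<bar> powr p)" and K: "\<And>n. (\<integral>x. \<bar>f n x\<bar> powr p \<partial>M) \<le> K"
    and S: "S \<in> sets M" "emeasure M S < \<infinity>" "\<And>n x. x \<notin> S \<Longrightarrow> f n x = 0"
    and gr: "integrable M (\<lambda>x. \<bar>g x\<bar> powr r)"
    and fr: "\<And>n. integrable M (\<lambda>x. \<bar>f n x\<bar> powr r)"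
  shows "(\<lambda>n. \<integral>x. \<bar>f n x\<bar> powr r \<partial>M) \<longlonglongrightarrow> (\<integral>x. \<bar>g x\<bar> powr r \<partial>M)"
proof -
  have "(\<lambda>n. \<integral>x. \<bar>\<bar>f n x\<bar> powr r - \<bar>g x\<bar> powr r\<bar> \<partial>M) \<longlonglongrightarrow> 0"
  proof (rule integral_tendsto_zero_young(2))
    show "integrable M (\<lambda>x. \<bar>f n x\<bar> powr p)" for n by (rule int)
    show "(\<integral>x. \<bar>f n x\<bar> powr p \<partial>M) \<le> K" for n by (rule K)
    show "AE x in M. (\<lambda>n. \<bar>\<bar>f n x\<bar> powr r - \<bar>g x\<bar> powr r\<bar>) \<longlonglongrightarrow> 0" using lim
    proof eventually_elim
      case (elim x)
      have "(\<lambda>n. \<bar>\<bar>f n x\<bar> powr r - \<bar>g x\<bar> powr r\<bar>) \<longlonglongrightarrow> \<bar>\<bar>g x\<bar> powr r - \<bar>g x\<bar> powr r\<bar>"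
        using elim r by (intro tendsto_intros tendsto_powr2) auto
      then show ?case by simp
    qed
    fix e :: real assume e: "0 < e"
    \<comment> \<open>The level satisfies \<open>L powr (r - p) = e\<close>: above it
      \<open>\<bar>f n x\<bar> powr r \<le> e * \<bar>f n x\<bar> powr p\<close>, below it the
      integrand is at most \<open>L powr r\<close> and lives on \<open>S\<close>.\<close>
    define L where "L = (1 / e) powr (1 / (p - r))"
    have "(r - p) / (p - r) = - 1" using r by (simp add: field_simps)
    then have L: "0 < L" "L powr (r - p) = e" using e by (auto simp: L_def powr_powr powr_divide powr_minus field_simps)
    have b: "\<bar>f n x\<bar> powr r \<le> e * \<bar>f n x\<bar> powr p + L powr r * indicator S x" for n x
    proof (cases "\<bar>f n x\<bar> \<le> L")
      case True
      then show ?thesis using S(3)[of x n] e r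
        by (cases "x \<in> S") (auto intro!: add_increasing powr_mono2)
    next
      case False
      have "\<bar>f n x\<bar> powr r = \<bar>f n x\<bar> powr (r - p) * \<bar>f n x\<bar> powr p" by (simp flip: powr_add)
      also have "\<dots> \<le> L powr (r - p) * \<bar>f n x\<bar> powr p"
        using False L r by (intro mult_right_mono powr_mono2') auto
      also have "\<dots> \<le> e * \<bar>f n x\<bar> powr p + L powr r * indicator S x" using L by simp
      finally show ?thesis .
    qed
    have "\<bar>\<bar>f n x\<bar> powr r - \<bar>g x\<bar> powr r\<bar> \<le> e * \<bar>f n x\<bar> powr p + (L powr r * indicator S x + \<bar>g x\<bar> powr r)" for n x
      using b[of n x] powr_ge_zero[of "\<bar>g x\<bar>" r] powr_ge_zero[of "\<bar>f n x\<bar>" r]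
      by (smt (verit))
    then show "\<exists>H. integrable M H \<and> (\<forall>n x. \<bar>\<bar>f n x\<bar> powr r - \<bar>g x\<bar> powr r\<bar> \<le> e * \<bar>f n x\<bar> powr p + H x)"
      using S(1,2) gr by (intro exI[of _ "\<lambda>x. L powr r * indicator S x + \<bar>g x\<bar> powr r"]) auto
  qed auto
  then have "(\<lambda>n. \<integral>x. \<bar>f n x\<bar> powr r - \<bar>g x\<bar> powr r \<partial>M) \<longlonglongrightarrow> 0"
    by (rule Lim_null_comparison[rotated]) (auto intro!: always_eventually)
  then show ?thesis using fr gr by (simp add: LIM_zero_iff)
qed

text \<open>Differentiation under the integral sign by dominated convergence along sequences. The
  difference quotients are bounded by \<open>p * (\<bar>f\<bar> + c * \<bar>g\<bar>) powr p\<close>,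
  where \<open>c\<close> bounds the increments.\<close>

lemma integral_abs_powr_deriv:
  fixes f g :: "'a \<Rightarrow> real"
  assumes [measurable]: "f \<in> borel_measurable M" "g \<in> borel_measurable M"
    and p: "1 < p"
    and fi: "integrable M (\<lambda>x. \<bar>f x\<bar> powr p)" and gi: "integrable M (\<lambda>x. \<bar>g x\<bar> powr p)"
  shows "integrable M (\<lambda>x. \<bar>f x\<bar> powr (p - 2) * f x * g x)"
    and "((\<lambda>e. \<integral>x. \<bar>f x + e * g x\<bar> powr p \<partial>M) has_real_derivative
           p * (\<integral>x. \<bar>f x\<bar> powr (p - 2) * f x * g x \<partial>M)) (at 0)"
proof -
  define dq where "dq e x = (\<bar>f x + e * g x\<bar> powr p - \<bar>f x\<bar> powr p) / e" for e x
  have si: "integrable M (\<lambda>x. p * \<bar>\<bar>f x\<bar> + c * \<bar>g x\<bar>\<bar> powr p)" for c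
    using integrable_abs_powr_add[of p "\<lambda>x. \<bar>f x\<bar>" M "\<lambda>x. \<bar>g x\<bar>" c] fi gi p by simp
  \<comment> \<open>With \<open>1 \<le> c\<close> the sum
    \<open>\<bar>f x\<bar> + c * \<bar>g x\<bar>\<close> also absorbs the leftover factor
    \<open>\<bar>g x\<bar>\<close>, which turns the exponent \<open>p - 1\<close> into
    \<open>p\<close>.\<close>
  have dqb: "\<bar>dq e x\<bar> \<le> p * \<bar>\<bar>f x\<bar> + c * \<bar>g x\<bar>\<bar> powr p" if "e \<noteq> 0" "\<bar>e\<bar> \<le> c" "1 \<le> c" for e c x
  proof -
    have 1: "\<bar>e\<bar> * \<bar>g x\<bar> \<le> c * \<bar>g x\<bar>" "1 * \<bar>g x\<bar> \<le> c * \<bar>g x\<bar>" using that by (intro mult_right_mono; simp)+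
    have "\<bar>dq e x\<bar> = \<bar>\<bar>f x + e * g x\<bar> powr p - \<bar>f x\<bar> powr p\<bar> / \<bar>e\<bar>" by (simp add: dq_def)
    also have "\<dots> \<le> p * (\<bar>f x\<bar> + \<bar>e * g x\<bar>) powr (p - 1) * \<bar>e * g x\<bar> / \<bar>e\<bar>"
      using p by (intro divide_right_mono abs_powr_increment_le) auto
    also have "\<dots> = p * ((\<bar>f x\<bar> + \<bar>e * g x\<bar>) powr (p - 1) * \<bar>g x\<bar>)" using that by (simp add: abs_mult)
    also have "\<dots> \<le> p * ((\<bar>f x\<bar> + c * \<bar>g x\<bar>) powr (p - 1) * (\<bar>f x\<bar> + c * \<bar>g x\<bar>))"
      using that p 1 by (intro mult_left_mono mult_mono powr_mono2) (auto simp: abs_mult)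
    also have "(\<bar>f x\<bar> + c * \<bar>g x\<bar>) powr (p - 1) * (\<bar>f x\<bar> + c * \<bar>g x\<bar>) = \<bar>\<bar>f x\<bar> + c * \<bar>g x\<bar>\<bar> powr p"
      using that by (cases "\<bar>f x\<bar> + c * \<bar>g x\<bar> = 0") (auto simp: powr_mult_base mult.commute)
    finally show ?thesis .
  qed
  have dql: "(\<lambda>n. dq (X n) x) \<longlonglongrightarrow> p * (\<bar>f x\<bar> powr (p - 2) * f x * g x)" if X: "\<And>n. X n \<noteq> 0" "X \<longlonglongrightarrow> 0" for X x
  proof -
    have "((\<lambda>e. \<bar>f x + e * g x\<bar> powr p) has_real_derivative (p * \<bar>f x + 0 * g x\<bar> powr (p - 2) * (f x + 0 * g x)) * g x) (at 0)"
      by (rule DERIV_chain2[where f="\<lambda>x. \<bar>x\<bar> powr p" and g="\<lambda>e. f x + e * g x"], rule DERIV_abs_powr[OF p])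
        (auto intro!: derivative_eq_intros)
    then have "((\<lambda>e. dq e x) \<longlongrightarrow> p * (\<bar>f x\<bar> powr (p - 2) * f x * g x)) (at 0)"
      by (simp add: DERIV_def dq_def mult.assoc)
    moreover have "filterlim X (at 0) sequentially" using X by (intro filterlim_atI) auto
    ultimately show ?thesis by (rule filterlim_compose)
  qed
  have main: "integrable M (\<lambda>x. p * (\<bar>f x\<bar> powr (p - 2) * f x * g x)) \<and>
    (\<lambda>n. \<integral>x. dq (X n) x \<partial>M) \<longlonglongrightarrow> (\<integral>x. p * (\<bar>f x\<bar> powr (p - 2) * f x * g x) \<partial>M)"
    if X: "\<And>n. X n \<noteq> 0" "X \<longlonglongrightarrow> 0" for X
  proof -
    have "Bseq X" using X(2) convergentI by (intro convergent_imp_Bseq)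
    then obtain c where c: "\<And>n. \<bar>X n\<bar> \<le> c" by (auto simp: Bseq_def)
    have bd: "AE x in M. norm (dq (X n) x) \<le> p * \<bar>\<bar>f x\<bar> + max c 1 * \<bar>g x\<bar>\<bar> powr p" for n
      using dqb[OF X(1), of n "max c 1"] c[of n] by (auto simp: le_max_iff_disj)
    have l: "AE x in M. (\<lambda>n. dq (X n) x) \<longlonglongrightarrow> p * (\<bar>f x\<bar> powr (p - 2) * f x * g x)" using dql[OF X] by simp
    have [measurable]: "dq e \<in> borel_measurable M" for e unfolding dq_def by measurable
    show ?thesis
      by (intro conjI integrable_dominated_convergence[OF _ _ si l bd] integral_dominated_convergence[OF _ _ si l bd]) measurable
  qed
  \<comment> \<open>Integrability of the limit is part of dominated convergence, so any one null
    sequence of nonzero increments provides it.\<close>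
  have "(\<lambda>n. inverse (real (Suc n))) \<longlonglongrightarrow> 0" by (rule LIMSEQ_inverse_real_of_nat)
  from main[OF _ this] show "integrable M (\<lambda>x. \<bar>f x\<bar> powr (p - 2) * f x * g x)" using p by simp
  have ii: "integrable M (\<lambda>x. \<bar>f x + e * g x\<bar> powr p)" for e
    using integrable_abs_powr_add[of p f M g e] p fi gi by simp
  have dqi: "(\<integral>x. dq e x \<partial>M) = ((\<integral>x. \<bar>f x + e * g x\<bar> powr p \<partial>M) - (\<integral>x. \<bar>f x + 0 * g x\<bar> powr p \<partial>M)) / e" for e
    unfolding dq_def using ii[of e] fi by simp
  show "((\<lambda>e. \<integral>x. \<bar>f x + e * g x\<bar> powr p \<partial>M) has_real_derivative
           p * (\<integral>x. \<bar>f x\<bar> powr (p - 2) * f x * g x \<partial>M)) (at 0)"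
    unfolding DERIV_def tendsto_at_iff_sequentially
  proof (intro allI impI)
    fix X :: "nat \<Rightarrow> real" assume "\<forall>i. X i \<in> UNIV - {0}" "X \<longlonglongrightarrow> 0"
    then have "(\<lambda>n. \<integral>x. dq (X n) x \<partial>M) \<longlonglongrightarrow> (\<integral>x. p * (\<bar>f x\<bar> powr (p - 2) * f x * g x) \<partial>M)"
      using main[of X] by auto
    then show "((\<lambda>h. ((\<integral>x. \<bar>f x + (0 + h) * g x\<bar> powr p \<partial>M) - (\<integral>x. \<bar>f x + 0 * g x\<bar> powr p \<partial>M)) / h) \<circ> X)
      \<longlonglongrightarrow> p * (\<integral>x. \<bar>f x\<bar> powr (p - 2) * f x * g x \<partial>M)"
      by (simp add: dqi o_def)
  qed
qed

section \<open>Singular kernels and Gagliardo energies\<close>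

lemma nn_integral_lborel_minus:
  fixes f :: "'a::euclidean_space \<Rightarrow> ennreal"
  assumes [measurable]: "f \<in> borel_measurable borel"
  shows "(\<integral>\<^sup>+y. f (x - y) \<partial>lborel) = (\<integral>\<^sup>+y. f y \<partial>lborel)"
proof -
  have "lborel = density (distr lborel borel (\<lambda>y. x + (-1) *\<^sub>R y :: 'a)) (\<lambda>_. ennreal (\<bar>-1\<bar> ^ DIM('a)))"
    by (rule lborel_affine) simp
  then have "(lborel :: 'a measure) = distr lborel borel (\<lambda>y. x - y)"
    by (simp add: density_1)
  then have "(\<integral>\<^sup>+y. f y \<partial>lborel) = (\<integral>\<^sup>+y. f y \<partial>distr lborel borel (\<lambda>y. x - y))"
    by metis
  also have "\<dots> = (\<integral>\<^sup>+y. f (x - y) \<partial>lborel)" by (subst nn_integral_distr) auto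
  finally show ?thesis by simp
qed

lemma nn_integral_lborel_prod:
  fixes f :: "'a::euclidean_space \<times> 'b::euclidean_space \<Rightarrow> ennreal"
  assumes [measurable]: "f \<in> borel_measurable borel"
  shows "(\<integral>\<^sup>+z. f z \<partial>lborel) = (\<integral>\<^sup>+x. \<integral>\<^sup>+y. f (x, y) \<partial>lborel \<partial>lborel)"
proof -
  have "f \<in> borel_measurable (lborel \<Otimes>\<^sub>M lborel)" using assms by (simp add: lborel_prod)
  then have "(\<integral>\<^sup>+x. \<integral>\<^sup>+y. f (x, y) \<partial>lborel \<partial>lborel) = (\<integral>\<^sup>+z. f z \<partial>(lborel \<Otimes>\<^sub>M lborel))"
    by (rule lborel.nn_integral_fst)
  then show ?thesis by (simp add: lborel_prod)
qed

text \<open>A common majorant for Gagliardo integrands. With N the dimension it behaves like the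
  power \<open>\<kappa> - N\<close> of the distance near 0 and like the power
  \<open>- \<kappa> - N\<close> at infinity, hence is integrable at both ends.\<close>

definition sing_kernel :: "real \<Rightarrow> 'a::euclidean_space \<Rightarrow> real" where
  "sing_kernel \<kappa> z = min (norm z powr \<kappa>) (norm z powr (-\<kappa>)) * norm z powr (- real DIM('a))"

lemma borel_measurable_sing_kernel[measurable]: "sing_kernel \<kappa> \<in> borel_measurable borel"
  unfolding sing_kernel_def by measurable

lemma sing_kernel_nonneg[simp]: "0 \<le> sing_kernel \<kappa> z"
  by (simp add: sing_kernel_def)

lemma nn_integral_sing_kernel_finite:
  assumes \<kappa>: "0 < \<kappa>"
  shows "(\<integral>\<^sup>+z. ennreal (sing_kernel \<kappa> (z::'a::euclidean_space)) \<partial>lborel) < \<infinity>"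
proof -
  define N where "N = real DIM('a)"
  define v where "v = unit_ball_vol N"
  have N: "0 \<le> N" by (simp add: N_def)
  have v: "0 \<le> v" by (simp add: v_def N_def)
  \<comment> \<open>Dyadic shells enlarged to balls: the first term covers
    \<open>2 powr -(k+1) \<le> norm z \<le> 2 powr -k\<close>, the second
    \<open>2 powr k \<le> norm z \<le> 2 powr (k+1)\<close>. In both, the volume of the ball cancels
    the factor coming from \<open>norm z powr -N\<close> up to \<open>2 powr N\<close>, so the
    integral of \<open>T k\<close> is a term of a geometric series with ratio
    \<open>2 powr -\<kappa>\<close>.\<close>
  define T :: "nat \<Rightarrow> 'a \<Rightarrow> ennreal" where
    "T k z = ennreal (2 powr (-\<kappa> * k) * 2 powr ((k + 1) * N)) * indicator (cball 0 (2 powr (- real k))) z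
           + ennreal (2 powr (-\<kappa> * k) * 2 powr (- real k * N)) * indicator (cball 0 (2 powr (k + 1))) z" for k z
  have le: "ennreal (sing_kernel \<kappa> z) \<le> (\<Sum>k. T k z)" for z
  proof (cases "z = 0")
    case True then show ?thesis by (simp add: sing_kernel_def)
  next
    case False
    have single: "T k z \<le> (\<Sum>k. T k z)" for k
      using sum_le_suminf[of "\<lambda>k. T k z" "{k}"] by auto
    define \<rho> where "\<rho> = log 2 (norm z)"
    have nz: "norm z = 2 powr \<rho>" using False by (simp add: \<rho>_def)
    show ?thesis
    proof (cases "\<rho> \<le> 0")
      case True
      define k where "k = nat \<lfloor>- \<rho>\<rfloor>"
      have k: "real k \<le> - \<rho>" "- \<rho> \<le> real k + 1" using True unfolding k_def by linarith+
      have "sing_kernel \<kappa> z \<le> norm z powr \<kappa> * norm z powr (- N)"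
        by (simp add: sing_kernel_def N_def mult_right_mono)
      also have "\<dots> = 2 powr (\<rho> * \<kappa>) * 2 powr (- \<rho> * N)" by (simp add: nz powr_powr)
      also have "\<dots> \<le> 2 powr (-\<kappa> * k) * 2 powr ((k + 1) * N)"
        using mult_right_mono[OF k(1), of \<kappa>] mult_right_mono[OF k(2) N] \<kappa>
        by (intro mult_mono[OF powr_mono powr_mono]) (auto simp: algebra_simps)
      finally have "ennreal (sing_kernel \<kappa> z) \<le> ennreal (2 powr (-\<kappa> * k) * 2 powr ((k + 1) * N)) * indicator (cball 0 (2 powr (- real k))) z"
        using k by (auto simp: nz indicator_def intro!: ennreal_leI)
      also have "\<dots> \<le> T k z" by (simp add: T_def add.commute[of 1])
      finally show ?thesis using single[of k] by (rule order_trans)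
    next
      case False
      define k where "k = nat \<lfloor>\<rho>\<rfloor>"
      have k: "real k \<le> \<rho>" "\<rho> \<le> real k + 1" using False unfolding k_def by linarith+
      have "sing_kernel \<kappa> z \<le> norm z powr (-\<kappa>) * norm z powr (- N)"
        by (simp add: sing_kernel_def N_def mult_right_mono)
      also have "\<dots> = 2 powr (\<rho> * - \<kappa>) * 2 powr (- \<rho> * N)" by (simp add: nz powr_powr)
      also have "\<dots> \<le> 2 powr (-\<kappa> * k) * 2 powr (- real k * N)"
        using mult_right_mono[OF k(1), of \<kappa>] mult_right_mono[OF k(1) N] \<kappa>
        by (intro mult_mono[OF powr_mono powr_mono]) (auto simp: algebra_simps)
      finally have "ennreal (sing_kernel \<kappa> z) \<le> ennreal (2 powr (-\<kappa> * k) * 2 powr (- real k * N)) * indicator (cball 0 (2 powr (k + 1))) z"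
        using k by (auto simp: nz indicator_def add.commute intro!: ennreal_leI)
      also have "\<dots> \<le> T k z" by (simp add: T_def add.commute[of 1])
      finally show ?thesis using single[of k] by (rule order_trans)
    qed
  qed
  have [measurable]: "T k \<in> borel_measurable borel" for k
    unfolding T_def by (intro borel_measurable_add borel_measurable_times_ennreal borel_measurable_indicator) auto
  define c where "c = 2 * (2 powr N * v)"
  have int: "(\<integral>\<^sup>+z. T k z \<partial>lborel) = ennreal (c * (2 powr (-\<kappa>)) ^ k)" for k
  proof -
    have pw: "(2 powr a) ^ DIM('a) = 2 powr (a * N)" for a
      by (simp add: powr_power N_def mult.commute)
    have "(\<integral>\<^sup>+z. T k z \<partial>lborel) = ennreal (2 powr (-\<kappa> * k) * 2 powr ((k + 1) * N)) * ennreal (v * 2 powr (- real k * N))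
      + ennreal (2 powr (-\<kappa> * k) * 2 powr (- real k * N)) * ennreal (v * 2 powr ((k + 1) * N))"
    proof -
      have ball: "emeasure lborel (cball (0::'a) (2 powr a)) = ennreal (v * 2 powr (a * N))" for a
        by (simp add: emeasure_cball pw v_def flip: N_def)
      have "(\<integral>\<^sup>+z. c1 * indicator (cball 0 r1) z + c2 * indicator (cball 0 r2) (z::'a) \<partial>lborel)
        = c1 * emeasure lborel (cball (0::'a) r1) + c2 * emeasure lborel (cball (0::'a) r2)" for c1 c2 r1 r2
        by (subst nn_integral_add)
          (simp_all add: nn_integral_cmult_indicator borel_measurable_times_ennreal borel_measurable_indicator)
      then show ?thesis unfolding T_def ball[symmetric] by (simp add: add.commute)
    qed
    also have "\<dots> = ennreal (2 powr (-\<kappa> * k) * 2 powr ((k + 1) * N) * (v * 2 powr (- real k * N))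
      + 2 powr (-\<kappa> * k) * 2 powr (- real k * N) * (v * 2 powr ((k + 1) * N)))"
    proof -
      have *: "ennreal a1 * ennreal a2 + ennreal b1 * ennreal b2 = ennreal (a1 * a2 + b1 * b2)"
        if "0 \<le> a1" "0 \<le> a2" "0 \<le> b1" "0 \<le> b2" for a1 a2 b1 b2
        using that by (simp add: ennreal_mult)
      show ?thesis using v by (intro *) simp_all
    qed
    also have "2 powr (-\<kappa> * k) * 2 powr ((k + 1) * N) * (v * 2 powr (- real k * N))
      + 2 powr (-\<kappa> * k) * 2 powr (- real k * N) * (v * 2 powr ((k + 1) * N))
      = 2 * v * 2 powr (-\<kappa> * k) * (2 powr ((k + 1) * N) * 2 powr (- real k * N))"
      by (simp add: algebra_simps)
    also have "2 powr ((k + 1) * N) * 2 powr (- real k * N) = 2 powr N"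
      unfolding powr_add[symmetric] by (simp add: algebra_simps)
    also have "2 powr (-\<kappa> * k) = (2 powr (-\<kappa>)) ^ k"
      by (simp add: powr_power mult.commute)
    also have "2 * v * (2 powr (-\<kappa>)) ^ k * 2 powr N = c * (2 powr (-\<kappa>)) ^ k"
      by (simp add: c_def)
    finally show ?thesis .
  qed
  have sm: "summable (\<lambda>k. c * (2 powr (-\<kappa>)) ^ k)"
    using \<kappa> by (intro summable_mult summable_geometric) (auto simp: powr_less_one)
  have "(\<integral>\<^sup>+z. ennreal (sing_kernel \<kappa> (z::'a)) \<partial>lborel) \<le> (\<integral>\<^sup>+z. (\<Sum>k. T k z) \<partial>lborel)"
    by (intro nn_integral_mono le)
  also have "\<dots> = (\<Sum>k. \<integral>\<^sup>+z. T k z \<partial>lborel)" by (rule nn_integral_suminf) auto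
  also have "\<dots> = (\<Sum>k. ennreal (c * (2 powr (-\<kappa>)) ^ k))" by (simp add: int)
  also have "\<dots> = ennreal (\<Sum>k. c * (2 powr (-\<kappa>)) ^ k)"
    using v sm by (intro suminf_ennreal2) (auto simp: c_def)
  also have "\<dots> < \<infinity>" by simp
  finally show ?thesis .
qed

text \<open>The Gagliardo energy as an iterated Borel integral. This form gives access to the inner
  integral at a fixed \<open>x\<close>, on which the Sobolev and the grid estimates work;
  \<open>gagliardo_energy_eq_gag\<close> identifies it with \<open>gagliardo_energy\<close>.\<close>

definition gag :: "real \<Rightarrow> real \<Rightarrow> ('a::euclidean_space \<Rightarrow> real) \<Rightarrow> ennreal" where
  "gag s t u = (\<integral>\<^sup>+x. \<integral>\<^sup>+y. ennreal (\<bar>u x - u y\<bar> powr t / norm (x - y) powr (real DIM('a) + s * t)) \<partial>lborel \<partial>lborel)"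

text \<open>By translation invariance and Tonelli each of the two summands gives the integral of
  \<open>W\<close> times that of the kernel. The weight is symmetric because a pair with
  \<open>u x \<noteq> u y\<close> may have only one point in \<Omega>.\<close>

lemma nn_integral_sing_kernel_weight:
  fixes W :: "'a::euclidean_space \<Rightarrow> real"
  assumes [measurable]: "W \<in> borel_measurable borel" and W: "\<And>x. 0 \<le> W x" "(\<integral>\<^sup>+x. ennreal (W x) \<partial>lborel) < \<infinity>"
    and \<kappa>: "0 < \<kappa>"
  shows "(\<integral>\<^sup>+x. \<integral>\<^sup>+y. ennreal ((W x + W y) * sing_kernel \<kappa> (x - y)) \<partial>lborel \<partial>lborel) < \<infinity>"
proof -
  define I where "I = (\<integral>\<^sup>+z. ennreal (sing_kernel \<kappa> (z::'a)) \<partial>lborel)"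
  have I: "I < \<infinity>" unfolding I_def by (rule nn_integral_sing_kernel_finite[OF \<kappa>])
  have k: "(\<integral>\<^sup>+y. ennreal (sing_kernel \<kappa> (x - y)) \<partial>lborel) = I" for x :: 'a
    unfolding I_def by (rule nn_integral_lborel_minus[of "\<lambda>z. ennreal (sing_kernel \<kappa> z)"]) simp
  have sym: "sing_kernel \<kappa> (x - y) = sing_kernel \<kappa> (y - x)" for x y :: 'a
    by (simp add: sing_kernel_def norm_minus_commute)
  have "(\<integral>\<^sup>+x. \<integral>\<^sup>+y. ennreal ((W x + W y) * sing_kernel \<kappa> (x - y)) \<partial>lborel \<partial>lborel)
    = (\<integral>\<^sup>+x. \<integral>\<^sup>+y. ennreal (W x) * ennreal (sing_kernel \<kappa> (x - y)) + ennreal (W y) * ennreal (sing_kernel \<kappa> (x - y)) \<partial>lborel \<partial>lborel)"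
    using W by (intro nn_integral_cong) (simp add: distrib_right ennreal_mult)
  also have "\<dots> = (\<integral>\<^sup>+x. (\<integral>\<^sup>+y. ennreal (W x) * ennreal (sing_kernel \<kappa> (x - y)) \<partial>lborel) + (\<integral>\<^sup>+y. ennreal (W y) * ennreal (sing_kernel \<kappa> (x - y)) \<partial>lborel) \<partial>lborel)"
    by (intro nn_integral_cong nn_integral_add) measurable
  also have "\<dots> = (\<integral>\<^sup>+x. (\<integral>\<^sup>+y. ennreal (W x) * ennreal (sing_kernel \<kappa> (x - y)) \<partial>lborel) \<partial>lborel) + (\<integral>\<^sup>+x. (\<integral>\<^sup>+y. ennreal (W y) * ennreal (sing_kernel \<kappa> (x - y)) \<partial>lborel) \<partial>lborel)"
    by (intro nn_integral_add) measurable
  also have "(\<integral>\<^sup>+x. (\<integral>\<^sup>+y. ennreal (W x) * ennreal (sing_kernel \<kappa> (x - y)) \<partial>lborel) \<partial>lborel) = (\<integral>\<^sup>+x. ennreal (W x) \<partial>lborel) * I"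
    by (simp add: nn_integral_cmult k nn_integral_multc)
  also have "(\<integral>\<^sup>+x. (\<integral>\<^sup>+y. ennreal (W y) * ennreal (sing_kernel \<kappa> (x - y)) \<partial>lborel) \<partial>lborel)
     = (\<integral>\<^sup>+y. (\<integral>\<^sup>+x. ennreal (W y) * ennreal (sing_kernel \<kappa> (x - y)) \<partial>lborel) \<partial>lborel)"
    by (rule lborel_pair.Fubini'[symmetric]) measurable
  also have "\<dots> = (\<integral>\<^sup>+x. ennreal (W x) \<partial>lborel) * I"
    by (subst sym) (simp add: nn_integral_cmult k nn_integral_multc)
  finally show ?thesis using W I by (simp add: ennreal_mult_less_top)
qed

text \<open>Near the diagonal the Lipschitz bound gains \<open>(1 - s) * t\<close> powers of the
  distance, and far from it boundedness leaves a decay of order \<open>s * t\<close>; \<kappa> is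
  the smaller of the two.\<close>

lemma gag_finite_lipschitz:
  fixes u :: "'a::euclidean_space \<Rightarrow> real"
  assumes [measurable]: "u \<in> borel_measurable borel" "\<Omega> \<in> sets borel" and fin: "emeasure lborel \<Omega> < \<infinity>"
    and off: "\<And>x. x \<notin> \<Omega> \<Longrightarrow> u x = 0"
    and lip: "\<And>x y. \<bar>u x - u y\<bar> \<le> norm (x - y)" and bd: "\<And>x y. \<bar>u x - u y\<bar> \<le> 1"
    and s: "0 < s" "s < 1" "0 < t"
  shows "gag s t u < \<infinity>"
proof -
  define \<kappa> where "\<kappa> = min ((1 - s) * t) (s * t)"
  have \<kappa>: "0 < \<kappa>" "\<kappa> \<le> (1 - s) * t" "\<kappa> \<le> s * t" using s by (auto simp: \<kappa>_def)
  have "\<bar>u x - u y\<bar> powr t / norm (x - y) powr (real DIM('a) + s * t)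
     \<le> (indicator \<Omega> x + indicator \<Omega> y) * sing_kernel \<kappa> (x - y)" for x y
  proof (cases "u x = u y")
    case True
    then show ?thesis using s by (auto intro!: mult_nonneg_nonneg add_nonneg_nonneg)
  next
    case False
    then have xy: "x \<in> \<Omega> \<or> y \<in> \<Omega>" "0 < norm (x - y)" using False off[of x] off[of y] by (metis, auto)
    define m where "m = norm (x - y)"
    have m: "0 < m" "\<bar>u x - u y\<bar> \<le> m" using xy lip by (auto simp: m_def)
    have "\<bar>u x - u y\<bar> powr t \<le> min (m powr \<kappa>) (m powr (-\<kappa>)) * m powr (s * t)"
    proof (cases "m \<le> 1")
      case True
      have "\<bar>u x - u y\<bar> powr t \<le> m powr t" using m s by (intro powr_mono2) auto
      also have "\<dots> = m powr ((1 - s) * t) * m powr (s * t)" by (simp add: algebra_simps flip: powr_add)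
      also have "\<dots> \<le> min (m powr \<kappa>) (m powr (-\<kappa>)) * m powr (s * t)"
        using m True \<kappa> by (intro mult_right_mono min.boundedI powr_mono') auto
      finally show ?thesis .
    next
      case False
      have "\<bar>u x - u y\<bar> powr t \<le> 1" using bd[of x y] s powr_mono2[of t "\<bar>u x - u y\<bar>" 1] by simp
      also have "1 = m powr (- (s * t)) * m powr (s * t)" using m by (simp flip: powr_add)
      also have "\<dots> \<le> min (m powr \<kappa>) (m powr (-\<kappa>)) * m powr (s * t)"
        using m False \<kappa> by (intro mult_right_mono min.boundedI powr_mono) auto
      finally show ?thesis .
    qed
    then have "\<bar>u x - u y\<bar> powr t / m powr (real DIM('a) + s * t) \<le> min (m powr \<kappa>) (m powr (-\<kappa>)) * m powr (s * t) / m powr (real DIM('a) + s * t)"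
      by (intro divide_right_mono) auto
    also have "\<dots> = sing_kernel \<kappa> (x - y)"
      using m by (simp add: sing_kernel_def m_def[symmetric] powr_add powr_minus field_simps)
    also have "\<dots> = 1 * sing_kernel \<kappa> (x - y)" by simp
    also have "\<dots> \<le> (indicator \<Omega> x + indicator \<Omega> y) * sing_kernel \<kappa> (x - y)"
      using xy by (intro mult_right_mono) (auto simp: indicator_def)
    finally show ?thesis by (simp add: m_def)
  qed
  then have "gag s t u \<le> (\<integral>\<^sup>+x. \<integral>\<^sup>+y. ennreal ((indicator \<Omega> x + indicator \<Omega> y) * sing_kernel \<kappa> (x - y)) \<partial>lborel \<partial>lborel)"
    unfolding gag_def by (intro nn_integral_mono ennreal_leI)
  also have "\<dots> < \<infinity>"
    using fin \<kappa> by (intro nn_integral_sing_kernel_weight) (auto simp: ennreal_indicator)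
  finally show ?thesis .
qed

text \<open>For close points Young's inequality is applied to
  \<open>\<bar>u x - u y\<bar> / norm (x - y) powr s1\<close>, and the spare
  \<open>(s1 - s2) * q\<close> powers of the distance make its constant term integrable. For distant
  points the differences are bounded by the integrable weight \<open>W\<close>, and the kernel
  decays.\<close>

lemma gag_finite_lower_order:
  fixes u :: "'a::euclidean_space \<Rightarrow> real"
  assumes [measurable]: "u \<in> borel_measurable borel" "\<Omega> \<in> sets borel" and fin: "emeasure lborel \<Omega> < \<infinity>"
    and off: "\<And>x. x \<notin> \<Omega> \<Longrightarrow> u x = 0"
    and up: "(\<integral>\<^sup>+x. ennreal (\<bar>u x\<bar> powr p) \<partial>lborel) < \<infinity>" and gp: "gag s1 p u < \<infinity>"
    and s: "0 < s2" "s2 < s1" and q: "0 < q" "q \<le> p"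
  shows "gag s2 q u < \<infinity>"
proof -
  define \<kappa> where "\<kappa> = min ((s1 - s2) * q) (s2 * q)"
  have \<kappa>: "0 < \<kappa>" "\<kappa> \<le> (s1 - s2) * q" "\<kappa> \<le> s2 * q" using s q by (auto simp: \<kappa>_def)
  have young: "X powr q \<le> X powr p + 1" if "0 \<le> X" for X :: real
  proof (cases "X \<le> 1")
    case True
    then have "X powr q \<le> 1" using powr_mono2[of q X 1] q that by simp
    then show ?thesis by (simp add: add_increasing)
  next
    case False
    then show ?thesis using q by (simp add: powr_mono add_increasing2)
  qed
  \<comment> \<open>\<open>W\<close> plays two roles: it is at least 1 on \<Omega>, hence
    \<open>1 \<le> W x + W y\<close> whenever \<open>u x \<noteq> u y\<close>, and it dominates
    \<open>2 powr q * \<bar>u x\<bar> powr q\<close>, which controls the differences of distant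
    points.\<close>
  define W where "W x = 2 powr q * (indicator \<Omega> x + \<bar>u x\<bar> powr p)" for x
  have W0: "0 \<le> W x" for x by (simp add: W_def)
  have uW: "2 powr q * \<bar>u x\<bar> powr q \<le> W x" for x
    using young[of "\<bar>u x\<bar>"] off[of x] q by (cases "x \<in> \<Omega>") (auto simp: W_def add.commute)
  have one: "1 \<le> 2 powr q" using q by (simp add: ge_one_powr_ge_zero)
  have key: "\<bar>u x - u y\<bar> powr q / norm (x - y) powr (real DIM('a) + s2 * q)
     \<le> \<bar>u x - u y\<bar> powr p / norm (x - y) powr (real DIM('a) + s1 * p) + (W x + W y) * sing_kernel \<kappa> (x - y)" for x y
  proof (cases "u x = u y")
    case True
    then show ?thesis using W0 by (auto intro!: mult_nonneg_nonneg add_nonneg_nonneg)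
  next
    case False
    define m where "m = norm (x - y)"
    define d where "d = \<bar>u x - u y\<bar>"
    have m: "0 < m" using False by (auto simp: m_def)
    have sk: "sing_kernel \<kappa> (x - y) = min (m powr \<kappa>) (m powr (-\<kappa>)) * m powr (- real DIM('a))"
      by (simp add: sing_kernel_def m_def)
    show ?thesis
    proof (cases "m \<le> 1")
      case True
      have xy: "x \<in> \<Omega> \<or> y \<in> \<Omega>" using False off[of x] off[of y] by metis
      have W1: "1 \<le> W x + W y"
      proof -
        have "1 \<le> W z" if "z \<in> \<Omega>" for z
        proof -
          have "1 * 1 \<le> W z" unfolding W_def using that by (intro mult_mono one) auto
          then show ?thesis by simp
        qed
        then show ?thesis using xy W0[of x] W0[of y] by fastforce
      qed
      have "d powr q / m powr (real DIM('a) + s2 * q) = (d / m powr s1) powr q * (m powr ((s1 - s2) * q) * m powr (- real DIM('a)))"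
        using m by (simp add: powr_divide powr_powr powr_add powr_minus powr_diff left_diff_distrib field_simps d_def)
      also have "\<dots> \<le> ((d / m powr s1) powr p + 1) * (m powr ((s1 - s2) * q) * m powr (- real DIM('a)))"
        by (intro mult_right_mono young) (auto simp: d_def)
      also have "\<dots> = (d / m powr s1) powr p * (m powr ((s1 - s2) * q) * m powr (- real DIM('a))) + m powr ((s1 - s2) * q) * m powr (- real DIM('a))"
        by (simp add: algebra_simps)
      also have "\<dots> \<le> (d / m powr s1) powr p * (1 * m powr (- real DIM('a))) + (W x + W y) * (min (m powr \<kappa>) (m powr (-\<kappa>)) * m powr (- real DIM('a)))"
      proof (intro add_mono mult_left_mono mult_right_mono)
        show "m powr ((s1 - s2) * q) \<le> 1" using powr_mono2[of "(s1 - s2) * q" m 1] m True s q by simp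
        have "1 * (m powr ((s1 - s2) * q) * m powr (- real DIM('a))) \<le> (W x + W y) * (min (m powr \<kappa>) (m powr (-\<kappa>)) * m powr (- real DIM('a)))"
          using m True \<kappa> W1 by (intro mult_mono min.boundedI powr_mono') auto
        then show "m powr ((s1 - s2) * q) * m powr (- real DIM('a)) \<le> (W x + W y) * (min (m powr \<kappa>) (m powr (-\<kappa>)) * m powr (- real DIM('a)))" by simp
      qed auto
      also have "(d / m powr s1) powr p * (1 * m powr (- real DIM('a))) = d powr p / m powr (real DIM('a) + s1 * p)"
        using m by (simp add: powr_divide powr_powr powr_add powr_minus field_simps d_def)
      finally show ?thesis by (simp add: sk d_def m_def)
    next
      case False
      have "d powr q / m powr (real DIM('a) + s2 * q) = d powr q * (m powr (- (s2 * q)) * m powr (- real DIM('a)))"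
        using m by (simp add: powr_add powr_minus field_simps)
      also have "\<dots> \<le> (W x + W y) * (min (m powr \<kappa>) (m powr (-\<kappa>)) * m powr (- real DIM('a)))"
      proof (intro mult_mono min.boundedI powr_mono)
        have "d \<le> 2 * max \<bar>u x\<bar> \<bar>u y\<bar>" by (auto simp: d_def)
        then have "d powr q \<le> (2 * max \<bar>u x\<bar> \<bar>u y\<bar>) powr q" using q by (intro powr_mono2) (auto simp: d_def)
        also have "\<dots> = 2 powr q * max \<bar>u x\<bar> \<bar>u y\<bar> powr q" by (simp add: powr_mult)
        also have "\<dots> \<le> W x + W y" using uW[of x] uW[of y] W0[of x] W0[of y] by (simp add: max_def)
        finally show "d powr q \<le> W x + W y" .
        show "- (s2 * q) \<le> \<kappa>" "- (s2 * q) \<le> - \<kappa>" using \<kappa> s q by (auto intro: order_trans[of _ 0])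
      qed (use False W0 in auto)
      also have "\<dots> \<le> d powr p / m powr (real DIM('a) + s1 * p) + \<dots>" by simp
      finally show ?thesis by (simp add: sk d_def m_def)
    qed
  qed
  have "gag s2 q u \<le> (\<integral>\<^sup>+x. \<integral>\<^sup>+y. ennreal (\<bar>u x - u y\<bar> powr p / norm (x - y) powr (real DIM('a) + s1 * p)) + ennreal ((W x + W y) * sing_kernel \<kappa> (x - y)) \<partial>lborel \<partial>lborel)"
    unfolding gag_def using key W0
    by (intro nn_integral_mono) (simp add: ennreal_leI flip: ennreal_plus)
  also have "\<dots> = (\<integral>\<^sup>+x. (\<integral>\<^sup>+y. ennreal (\<bar>u x - u y\<bar> powr p / norm (x - y) powr (real DIM('a) + s1 * p)) \<partial>lborel) + (\<integral>\<^sup>+y. ennreal ((W x + W y) * sing_kernel \<kappa> (x - y)) \<partial>lborel) \<partial>lborel)"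
    unfolding W_def by (intro nn_integral_cong nn_integral_add) measurable
  also have "\<dots> = gag s1 p u + (\<integral>\<^sup>+x. \<integral>\<^sup>+y. ennreal ((W x + W y) * sing_kernel \<kappa> (x - y)) \<partial>lborel \<partial>lborel)"
    unfolding gag_def W_def by (intro nn_integral_add) measurable
  also have "\<dots> < \<infinity>"
  proof -
    have "(\<integral>\<^sup>+x. ennreal (W x) \<partial>lborel) = (\<integral>\<^sup>+x. ennreal (2 powr q) * (indicator \<Omega> x + ennreal (\<bar>u x\<bar> powr p)) \<partial>lborel)"
      by (intro nn_integral_cong) (simp add: W_def ennreal_mult' ennreal_indicator)
    also have "\<dots> = ennreal (2 powr q) * (emeasure lborel \<Omega> + (\<integral>\<^sup>+x. ennreal (\<bar>u x\<bar> powr p) \<partial>lborel))"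
      by (simp add: nn_integral_cmult nn_integral_add)
    also have "\<dots> < \<infinity>" using fin up by (simp add: ennreal_mult_less_top)
    finally have "(\<integral>\<^sup>+x. ennreal (W x) \<partial>lborel) < \<infinity>" .
    moreover have "W \<in> borel_measurable borel" unfolding W_def by measurable
    ultimately show ?thesis using gp nn_integral_sing_kernel_weight[OF _ W0 _ \<kappa>(1)] by simp
  qed
  finally show ?thesis .
qed

section \<open>The fractional Sobolev inequality\<close>

lemma gag_superlevel_bound:
  fixes u :: "'a::euclidean_space \<Rightarrow> real"
  assumes [measurable]: "u \<in> borel_measurable borel"
    and sp: "0 < s" "0 < p" "s * p < real DIM('a)"
    and T: "0 < T" "(\<integral>\<^sup>+y. ennreal (\<bar>u y\<bar> powr crit_exp DIM('a) s p) \<partial>lborel) = ennreal T"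
    and v: "v = unit_ball_vol (real DIM('a))"
  shows "ennreal (\<bar>u x\<bar> powr crit_exp DIM('a) s p) \<le>
    ennreal (2 powr crit_exp DIM('a) s p * (2 / v) powr (1 + s * p / real DIM('a)) * T powr (s * p / real DIM('a)))
    * (\<integral>\<^sup>+y. ennreal (\<bar>u x - u y\<bar> powr p / norm (x - y) powr (real DIM('a) + s * p)) \<partial>lborel)"
proof (cases "u x = 0")
  case True then show ?thesis using sp by simp
next
  case False
  define N where "N = real DIM('a)"
  define \<sigma> where "\<sigma> = crit_exp DIM('a) s p"
  define \<beta> where "\<beta> = s * p / N"
  define a where "a = \<bar>u x\<bar>"
  have N: "0 < N" by (simp add: N_def)
  have a: "0 < a" using False by (simp add: a_def)
  have v0: "0 < v" by (simp add: v)
  have sg: "\<sigma> = N * p / (N - s * p)" "s * p < N" using sp by (simp_all add: \<sigma>_def crit_exp_def N_def)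
  have \<sigma>: "0 < \<sigma>" using sg N sp by simp
  \<comment> \<open>This identity singles out the critical exponent. As
    \<open>\<rho> powr (N + s * p)\<close> is of order \<open>m powr (1 + \<beta>)\<close> and
    \<open>m\<close> is of order \<open>T * a powr -\<sigma>\<close>, the lower bound
    \<open>c * m\<close> below is of order
    \<open>a powr (p + \<sigma> * \<beta>) / T powr \<beta>\<close>, which is
    \<open>a powr \<sigma> / T powr \<beta>\<close>.\<close>
  have ex: "p + \<sigma> * \<beta> = \<sigma>" using sg N by (simp add: \<beta>_def field_simps)
  define m where "m = T * (2 / a) powr \<sigma>"
  define \<rho> where "\<rho> = (2 * m / v) powr (1 / N)"
  have m: "0 < m" using T a by (simp add: m_def)
  have \<rho>: "0 < \<rho>" using m v0 by (simp add: \<rho>_def)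
  define S where "S = {y. a / 2 \<le> \<bar>u y\<bar>}"
  define G where "G = ball x \<rho> - S"
  have [measurable]: "S \<in> sets borel" "G \<in> sets borel" unfolding S_def G_def by measurable
  have "emeasure lborel (ball x \<rho>) = ennreal (v * \<rho> ^ DIM('a))"
    using \<rho> by (simp add: emeasure_ball v)
  also have "\<rho> ^ DIM('a) = 2 * m / v"
    using m v0 N by (simp add: \<rho>_def powr_power N_def)
  finally have eb: "emeasure lborel (ball x \<rho>) = ennreal (2 * m)" using v0 by simp
  have "ennreal ((a / 2) powr \<sigma>) * emeasure lborel S = (\<integral>\<^sup>+y. ennreal ((a / 2) powr \<sigma>) * indicator S y \<partial>lborel)"
    by (simp add: nn_integral_cmult_indicator)
  also have "\<dots> \<le> (\<integral>\<^sup>+y. ennreal (\<bar>u y\<bar> powr \<sigma>) \<partial>lborel)"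
    using a \<sigma> by (intro nn_integral_mono) (auto simp: indicator_def S_def intro!: ennreal_leI powr_mono2)
  also have "\<dots> = ennreal T" using T by (simp add: \<sigma>_def)
  finally have "ennreal ((2 / a) powr \<sigma>) * (ennreal ((a / 2) powr \<sigma>) * emeasure lborel S) \<le> ennreal ((2 / a) powr \<sigma>) * ennreal T"
    by (intro mult_left_mono) auto
  moreover have "(2 / a) powr \<sigma> * (a / 2) powr \<sigma> = 1" using a by (simp flip: powr_mult)
  then have "ennreal ((2 / a) powr \<sigma>) * ennreal ((a / 2) powr \<sigma>) = 1"
    by (metis ennreal_1 ennreal_mult'' powr_ge_zero)
  moreover have "ennreal ((2 / a) powr \<sigma>) * ennreal T = ennreal m"
    using T unfolding m_def by (subst mult.commute) (simp add: ennreal_mult'')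
  ultimately have eS: "emeasure lborel S \<le> ennreal m"
    by (simp only: mult.assoc[symmetric] mult_1_left)
  have "ennreal (2 * m) \<le> emeasure lborel (G \<union> S)"
    unfolding eb[symmetric] by (intro emeasure_mono) (auto simp: G_def)
  also have "\<dots> \<le> emeasure lborel G + emeasure lborel S" by (intro emeasure_subadditive) auto
  also have "\<dots> \<le> emeasure lborel G + ennreal m" using eS by (intro add_left_mono)
  finally have "ennreal m + ennreal m \<le> emeasure lborel G + ennreal m"
    using m by (simp flip: ennreal_plus)
  then have "ennreal m + ennreal m \<le> ennreal m + emeasure lborel G" by (simp add: add.commute)
  then have eG: "ennreal m \<le> emeasure lborel G" by (simp add: ennreal_add_left_cancel_le)
  \<comment> \<open>On \<open>G\<close> the difference is at least \<open>a / 2\<close> and the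
    distance is less than \<rho>, so \<open>c\<close> bounds the integrand there from below.\<close>
  define c where "c = (a / 2) powr p / \<rho> powr (N + s * p)"
  have "ennreal (c * m) \<le> ennreal c * emeasure lborel G"
    using eG m by (simp add: ennreal_mult'' mult_left_mono)
  also have "\<dots> = (\<integral>\<^sup>+y. ennreal c * indicator G y \<partial>lborel)" by (simp add: nn_integral_cmult_indicator)
  also have "\<dots> \<le> (\<integral>\<^sup>+y. ennreal (\<bar>u x - u y\<bar> powr p / norm (x - y) powr (N + s * p)) \<partial>lborel)"
  proof (intro nn_integral_mono)
    fix y
    show "ennreal c * indicator G y \<le> ennreal (\<bar>u x - u y\<bar> powr p / norm (x - y) powr (N + s * p))"
    proof (cases "y \<in> G")
      case True
      then have y: "\<bar>u y\<bar> < a / 2" "norm (x - y) < \<rho>" by (auto simp: G_def S_def dist_norm)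
      have xy: "x \<noteq> y" using y a by (auto simp: a_def)
      have "c \<le> \<bar>u x - u y\<bar> powr p / norm (x - y) powr (N + s * p)"
      proof -
        have "a / 2 \<le> \<bar>u x - u y\<bar>" using y by (simp add: a_def abs_if split: if_splits)
        then show ?thesis unfolding c_def using y xy a sp N by (intro frac_le powr_mono2) auto
      qed
      then show ?thesis using True by (simp add: ennreal_leI)
    qed simp
  qed
  finally have D: "ennreal (c * m) \<le> (\<integral>\<^sup>+y. ennreal (\<bar>u x - u y\<bar> powr p / norm (x - y) powr (N + s * p)) \<partial>lborel)" .
  have "a powr \<sigma> = 2 powr \<sigma> * (2 / v) powr (1 + \<beta>) * T powr \<beta> * (c * m)"
  proof -
    have r1: "\<rho> powr (N + s * p) = (2 * m / v) powr (1 + \<beta>)"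
      using N by (simp add: \<rho>_def powr_powr \<beta>_def field_simps)
    also have "\<dots> = (2 / v) powr (1 + \<beta>) * (m powr \<beta> * m)"
      using m v0 powr_mult[of "2 / v" m "1 + \<beta>"] by (simp add: powr_add)
    finally have "(2 / v) powr (1 + \<beta>) * (c * m) = (a / 2) powr p / m powr \<beta>"
      using m v0 by (simp add: c_def field_simps)
    also have "m powr \<beta> = T powr \<beta> * (2 / a) powr (\<sigma> * \<beta>)"
      using T a by (simp add: m_def powr_mult powr_powr)
    also have "(2 / a) powr (\<sigma> * \<beta>) = 1 / (a / 2) powr (\<sigma> * \<beta>)"
      using a by (simp add: powr_divide)
    finally have "(2 / v) powr (1 + \<beta>) * (c * m) * T powr \<beta> = (a / 2) powr p * (a / 2) powr (\<sigma> * \<beta>)"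
      using T by simp
    also have "\<dots> = (a / 2) powr \<sigma>" using ex by (simp flip: powr_add)
    also have "\<dots> = a powr \<sigma> / 2 powr \<sigma>" using a by (simp add: powr_divide)
    finally show ?thesis by (simp add: field_simps)
  qed
  then have "ennreal (a powr \<sigma>) = ennreal (2 powr \<sigma> * (2 / v) powr (1 + \<beta>) * T powr \<beta>) * ennreal (c * m)"
    by (simp add: ennreal_mult' )
  also have "\<dots> \<le> ennreal (2 powr \<sigma> * (2 / v) powr (1 + \<beta>) * T powr \<beta>) *
    (\<integral>\<^sup>+y. ennreal (\<bar>u x - u y\<bar> powr p / norm (x - y) powr (N + s * p)) \<partial>lborel)"
    by (intro mult_left_mono D) simp
  finally show ?thesis by (simp add: a_def \<sigma>_def N_def \<beta>_def)
qed

lemma crit_exp_gt: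
  assumes "0 < s" "0 < p" "s * p < real N" shows "p < crit_exp N s p"
  using assms by (simp add: crit_exp_def field_simps)

text \<open>Integrating \<open>gag_superlevel_bound\<close> gives
  \<open>T \<le> K * T powr (s * p / N) * A\<close>. Dividing by the power of \<open>T\<close>
  requires \<open>T\<close> to be finite, hence the integrability hypothesis; the exponent
  \<open>1 - s * p / N\<close> that remains equals \<open>p / \<sigma>\<close>.\<close>

lemma fractional_sobolev_bounded_integral:
  fixes u :: "'a::euclidean_space \<Rightarrow> real"
  assumes [measurable]: "u \<in> borel_measurable borel"
    and sp: "0 < s" "0 < p" "s * p < real DIM('a)"
    and \<sigma>: "\<sigma> = crit_exp DIM('a) s p"
    and fin: "integrable lborel (\<lambda>x. \<bar>u x\<bar> powr \<sigma>)"
    and gag: "gag s p u < \<infinity>"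
    and v: "v = unit_ball_vol (real DIM('a))"
  shows "(\<integral>x. \<bar>u x\<bar> powr \<sigma> \<partial>lborel) \<le>
    (2 powr \<sigma> * (2 / v) powr (1 + s * p / real DIM('a)) * enn2real (gag s p u)) powr (\<sigma> / p)"
proof -
  define T where "T = (\<integral>x. \<bar>u x\<bar> powr \<sigma> \<partial>lborel)"
  define N where "N = real DIM('a)"
  define K where "K = 2 powr \<sigma> * (2 / v) powr (1 + s * p / N)"
  define A where "A = enn2real (gag s p u)"
  have A: "gag s p u = ennreal A" "0 \<le> A" using gag by (simp_all add: A_def)
  have T0: "0 \<le> T" by (simp add: T_def)
  have "T \<le> (K * A) powr (\<sigma> / p)"
  proof (cases "T = 0")
    case False
    then have T: "0 < T" using T0 by simp
    have nT: "(\<integral>\<^sup>+y. ennreal (\<bar>u y\<bar> powr \<sigma>) \<partial>lborel) = ennreal T"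
      unfolding T_def using fin by (intro nn_integral_eq_integral) auto
    have "ennreal T = (\<integral>\<^sup>+y. ennreal (\<bar>u y\<bar> powr \<sigma>) \<partial>lborel)" by (simp add: nT)
    also have "\<dots> \<le> (\<integral>\<^sup>+x. ennreal (K * T powr (s * p / N))
        * (\<integral>\<^sup>+y. ennreal (\<bar>u x - u y\<bar> powr p / norm (x - y) powr (real DIM('a) + s * p)) \<partial>lborel) \<partial>lborel)"
      using gag_superlevel_bound[OF assms(1) sp T nT[unfolded \<sigma>] v]
      by (intro nn_integral_mono) (simp add: K_def \<sigma> N_def)
    also have "\<dots> = ennreal (K * T powr (s * p / N)) * gag s p u"
      unfolding gag_def by (intro nn_integral_cmult) measurable
    also have "\<dots> = ennreal (K * T powr (s * p / N) * A)"
      using A by (simp add: ennreal_mult'')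
    finally have "T \<le> K * T powr (s * p / N) * A"
      using A by (subst (asm) ennreal_le_iff) (auto simp: K_def)
    then have "T * T powr (- (s * p / N)) \<le> K * T powr (s * p / N) * A * T powr (- (s * p / N))"
      by (intro mult_right_mono) auto
    also have "\<dots> = K * A" using T by (simp add: powr_minus)
    also have "T * T powr (- (s * p / N)) = T powr (1 + - (s * p / N))"
      using T by (subst powr_add) simp
    also have "1 + - (s * p / N) = p / \<sigma>"
      using sp by (simp add: \<sigma> crit_exp_def N_def field_simps)
    finally have "(T powr (p / \<sigma>)) powr (\<sigma> / p) \<le> (K * A) powr (\<sigma> / p)"
      using crit_exp_gt[OF sp] sp by (intro powr_mono2) (auto simp: \<sigma>)
    then show ?thesis using crit_exp_gt[OF sp] sp T by (simp add: powr_powr \<sigma>)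
  qed simp
  then show ?thesis by (simp add: K_def A_def T_def N_def)
qed

lemma gag_contraction_le:
  fixes u :: "'a::euclidean_space \<Rightarrow> real"
  assumes "0 \<le> t" "\<And>x y. \<bar>w x - w y\<bar> \<le> \<bar>u x - u y\<bar>"
  shows "gag s t w \<le> gag s t u"
  unfolding gag_def using assms by (intro nn_integral_mono ennreal_leI divide_right_mono powr_mono2) auto

text \<open>The finiteness assumed in \<open>fractional_sobolev_bounded_integral\<close> holds for
  the truncations of \<open>u\<close> at \<open>n\<close> and \<open>- n\<close>, which are bounded
  and vanish off a set of finite measure. Truncation does not increase the energy, and Fatou's lemma
  removes it.\<close>

theorem fractional_sobolev:
  fixes \<Omega> :: "'a::euclidean_space set"
  assumes "0 < s" "1 \<le> p" "s * p < real DIM('a)" and \<Omega>: "\<Omega> \<in> sets borel" "emeasure lborel \<Omega> < \<infinity>"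
  shows "\<exists>K>0. \<forall>u\<in>borel_measurable borel. (\<forall>x. x \<notin> \<Omega> \<longrightarrow> u x = 0) \<longrightarrow> gag s p u < \<infinity> \<longrightarrow>
    integrable lborel (\<lambda>x. \<bar>u x\<bar> powr crit_exp DIM('a) s p) \<and>
    (\<integral>x. \<bar>u x\<bar> powr crit_exp DIM('a) s p \<partial>lborel) \<le> K * enn2real (gag s p u) powr (crit_exp DIM('a) s p / p)"
proof -
  define \<sigma> where "\<sigma> = crit_exp DIM('a) s p"
  define v where "v = unit_ball_vol (real DIM('a))"
  define K0 where "K0 = 2 powr \<sigma> * (2 / v) powr (1 + s * p / real DIM('a))"
  have "0 < v" by (simp add: v_def)
  then have K0: "0 < K0" by (simp add: K0_def)
  have \<sigma>: "0 < \<sigma>" using crit_exp_gt[of s p "DIM('a)"] assms by (simp add: \<sigma>_def)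
  show ?thesis
  proof (intro exI[of _ "K0 powr (\<sigma> / p)"] conjI ballI impI)
    show "0 < K0 powr (\<sigma> / p)" using K0 by simp
    fix u :: "'a \<Rightarrow> real"
    assume um[measurable]: "u \<in> borel_measurable borel" and off: "\<forall>x. x \<notin> \<Omega> \<longrightarrow> u x = 0" and fin: "gag s p u < \<infinity>"
    define A where "A = enn2real (gag s p u)"
    define f where "f n x = max (- real n) (min (real n) (u x))" for n x
    have [measurable]: "f n \<in> borel_measurable borel" for n unfolding f_def by measurable
    have fl: "\<bar>f n x - f n y\<bar> \<le> \<bar>u x - u y\<bar>" for n x y unfolding f_def by (auto simp: max_def min_def abs_if)
    have g1: "gag s p (f n) \<le> gag s p u" for n using assms fl by (intro gag_contraction_le) auto
    have i: "integrable lborel (\<lambda>x. \<bar>f n x\<bar> powr \<sigma>)" for n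
    proof (rule Bochner_Integration.integrable_bound)
      show "integrable lborel (\<lambda>x. real n powr \<sigma> * indicator \<Omega> x)" using \<Omega> by auto
      have "\<bar>f n x\<bar> powr \<sigma> \<le> real n powr \<sigma> * indicator \<Omega> x" for x
      proof (cases "x \<in> \<Omega>")
        case True
        have "\<bar>f n x\<bar> \<le> real n" by (auto simp: f_def max_def min_def abs_if)
        then show ?thesis using True \<sigma> by (auto intro!: powr_mono2)
      next
        case False
        then show ?thesis using off by (simp add: f_def)
      qed
      then show "AE x in lborel. norm (\<bar>f n x\<bar> powr \<sigma>) \<le> norm (real n powr \<sigma> * indicator \<Omega> x)"
        by (intro AE_I2) (auto intro: order_trans[OF _ abs_ge_self])
    qed measurable
    have b: "(\<integral>x. \<bar>f n x\<bar> powr \<sigma> \<partial>lborel) \<le> K0 powr (\<sigma> / p) * A powr (\<sigma> / p)" for n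
    proof -
      have "(\<integral>x. \<bar>f n x\<bar> powr \<sigma> \<partial>lborel) \<le> (K0 * enn2real (gag s p (f n))) powr (\<sigma> / p)"
        unfolding K0_def using assms i[of n] le_less_trans[OF g1 fin]
        by (intro fractional_sobolev_bounded_integral) (auto simp: \<sigma>_def v_def)
      also have "\<dots> \<le> (K0 * A) powr (\<sigma> / p)"
        using K0 \<sigma> assms fin g1[of n] unfolding A_def
        by (intro powr_mono2 mult_left_mono enn2real_mono) auto
      also have "\<dots> = K0 powr (\<sigma> / p) * A powr (\<sigma> / p)"
        using K0 by (simp add: powr_mult A_def)
      finally show ?thesis .
    qed
    have l: "AE x in lborel. (\<lambda>n. f n x) \<longlonglongrightarrow> u x"
    proof (rule AE_I2)
      fix x
      obtain m where m: "\<bar>u x\<bar> \<le> real m" using real_arch_simple by blast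
      have "eventually (\<lambda>n. f n x = u x) sequentially"
        using eventually_ge_at_top[of m] by eventually_elim (use m in \<open>auto simp: f_def\<close>)
      then show "(\<lambda>n. f n x) \<longlonglongrightarrow> u x" by (rule tendsto_eventually)
    qed
    show "integrable lborel (\<lambda>x. \<bar>u x\<bar> powr crit_exp DIM('a) s p)"
      using integrable_abs_powr_limit(1)[OF _ _ l \<sigma> i b] by (simp add: \<sigma>_def)
    show "(\<integral>x. \<bar>u x\<bar> powr crit_exp DIM('a) s p \<partial>lborel) \<le> K0 powr (\<sigma> / p) * enn2real (gag s p u) powr (crit_exp DIM('a) s p / p)"
      using integrable_abs_powr_limit(2)[OF _ _ l \<sigma> i b] by (simp add: \<sigma>_def A_def)
  qed
qed

section \<open>Compactness\<close>

text \<open>For positive \<open>k\<close>, the lower corner of the grid cube of side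
  \<open>1 / k\<close> that contains \<open>x\<close>. For fixed \<open>k\<close> it takes countably
  many values, and \<open>grid_average\<close> depends on \<open>x\<close> only through it, so a
  diagonal argument reaches all points at once.\<close>

definition grid_point :: "nat \<Rightarrow> 'a::euclidean_space \<Rightarrow> 'a" where
  "grid_point k x = (\<Sum>b\<in>Basis. (real_of_int \<lfloor>real k * (x \<bullet> b)\<rfloor> / real k) *\<^sub>R b)"

definition grid_cell :: "nat \<Rightarrow> 'a::euclidean_space \<Rightarrow> 'a set" where
  "grid_cell k x = cbox (grid_point k x) (grid_point k x + (1 / real k) *\<^sub>R One)"

definition grid_average :: "nat \<Rightarrow> ('a::euclidean_space \<Rightarrow> real) \<Rightarrow> 'a \<Rightarrow> real" where
  "grid_average k u x = real k ^ DIM('a) * (\<integral>y. indicator (grid_cell k x) y * u y \<partial>lborel)"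

lemma grid_point_inner: "b \<in> Basis \<Longrightarrow> grid_point k x \<bullet> b = real_of_int \<lfloor>real k * (x \<bullet> b)\<rfloor> / real k"
  by (simp add: grid_point_def inner_sum_left_Basis)

lemma countable_range_grid_point: "countable (range (grid_point k :: 'a::euclidean_space \<Rightarrow> 'a))"
proof (rule countable_subset)
  show "range (grid_point k :: 'a \<Rightarrow> 'a) \<subseteq>
    (\<lambda>z. \<Sum>b\<in>Basis. (real_of_int (z b) / real k) *\<^sub>R b) ` (\<Pi>\<^sub>E b\<in>Basis. (UNIV :: int set))"
  proof
    fix g :: 'a assume "g \<in> range (grid_point k)"
    then obtain x where x: "g = grid_point k x" by auto
    have "g = (\<Sum>b\<in>Basis. (real_of_int (restrict (\<lambda>b. \<lfloor>real k * (x \<bullet> b)\<rfloor>) Basis b) / real k) *\<^sub>R b)"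
      unfolding x grid_point_def by (intro sum.cong) auto
    then show "g \<in> (\<lambda>z. \<Sum>b\<in>Basis. (real_of_int (z b) / real k) *\<^sub>R b) ` (\<Pi>\<^sub>E b\<in>Basis. (UNIV :: int set))"
      by (intro image_eqI[of _ _ "restrict (\<lambda>b. \<lfloor>real k * (x \<bullet> b)\<rfloor>) Basis"]) auto
  qed
  show "countable ((\<lambda>z. \<Sum>b\<in>Basis. (real_of_int (z b) / real k) *\<^sub>R b :: 'a) ` (\<Pi>\<^sub>E b\<in>Basis. (UNIV :: int set)))"
    by (intro countable_image countable_PiE) auto
qed

lemma mem_grid_cell:
  "y \<in> grid_cell k x \<longleftrightarrow> (\<forall>b\<in>Basis. real_of_int \<lfloor>real k * (x \<bullet> b)\<rfloor> / real k \<le> y \<bullet> b \<and>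
     y \<bullet> b \<le> real_of_int \<lfloor>real k * (x \<bullet> b)\<rfloor> / real k + 1 / real k)"
  by (auto simp: grid_cell_def mem_box grid_point_inner inner_add_left)

lemma emeasure_grid_cell:
  assumes "0 < k" shows "emeasure lborel (grid_cell k (x::'a::euclidean_space)) = ennreal ((1 / real k) ^ DIM('a))"
  unfolding grid_cell_def by (subst emeasure_lborel_cbox) (auto simp: inner_add_left)

lemma norm_le_grid_cell:
  fixes x y :: "'a::euclidean_space"
  assumes k: "0 < k" and y: "y \<in> grid_cell k x"
  shows "norm (x - y) \<le> real DIM('a) / real k"
proof -
  have "\<bar>(x - y) \<bullet> b\<bar> \<le> 1 / real k" if b: "b \<in> Basis" for b
  proof -
    have "real_of_int \<lfloor>real k * (x \<bullet> b)\<rfloor> / real k \<le> x \<bullet> b"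
      using k by (simp add: field_simps)
    moreover have "x \<bullet> b \<le> real_of_int \<lfloor>real k * (x \<bullet> b)\<rfloor> / real k + 1 / real k"
    proof -
      have "real k * (x \<bullet> b) \<le> real_of_int \<lfloor>real k * (x \<bullet> b)\<rfloor> + 1" by linarith
      then show ?thesis using k by (simp add: field_simps)
    qed
    ultimately show ?thesis using y b by (auto simp: mem_grid_cell inner_diff_left abs_le_iff)
  qed
  then have "(\<Sum>b\<in>Basis. \<bar>(x - y) \<bullet> b\<bar>) \<le> (\<Sum>b\<in>(Basis::'a set). 1 / real k)" by (intro sum_mono) auto
  then show ?thesis using norm_le_l1[of "x - y"] by simp
qed

lemma borel_measurable_grid_average[measurable]:
  fixes u :: "'a::euclidean_space \<Rightarrow> real"
  assumes [measurable]: "u \<in> borel_measurable borel"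
  shows "grid_average k u \<in> borel_measurable borel"
proof -
  have "(\<lambda>x. \<integral>y. (if \<forall>b\<in>Basis. real_of_int \<lfloor>real k * (x \<bullet> b)\<rfloor> / real k \<le> y \<bullet> b \<and>
     y \<bullet> b \<le> real_of_int \<lfloor>real k * (x \<bullet> b)\<rfloor> / real k + 1 / real k then u y else 0) \<partial>lborel) \<in> borel_measurable borel"
    by measurable
  moreover have "(\<lambda>x. \<integral>y. (if \<forall>b\<in>Basis. real_of_int \<lfloor>real k * (x \<bullet> b)\<rfloor> / real k \<le> y \<bullet> b \<and>
     y \<bullet> b \<le> real_of_int \<lfloor>real k * (x \<bullet> b)\<rfloor> / real k + 1 / real k then u y else 0) \<partial>lborel)
    = (\<lambda>x. \<integral>y. indicator (grid_cell k x) y * u y \<partial>lborel)"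
    by (intro ext Bochner_Integration.integral_cong refl) (simp add: indicator_def mem_grid_cell)
  ultimately show ?thesis unfolding grid_average_def by simp
qed

lemma sets_grid_cell[measurable, simp]: "grid_cell k x \<in> sets borel"
  by (simp add: grid_cell_def)

lemma abs_grid_average_le:
  fixes u :: "'a::euclidean_space \<Rightarrow> real"
  assumes "integrable lborel u"
  shows "\<bar>grid_average k u x\<bar> \<le> real k ^ DIM('a) * (\<integral>y. \<bar>u y\<bar> \<partial>lborel)"
proof -
  have "integrable lborel (\<lambda>y. indicator (grid_cell k x) y * u y)"
    by (rule Bochner_Integration.integrable_bound[OF assms]) (use assms in \<open>auto simp: indicator_def\<close>)
  then have "\<bar>\<integral>y. indicator (grid_cell k x) y * u y \<partial>lborel\<bar> \<le> (\<integral>y. \<bar>u y\<bar> \<partial>lborel)"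
    using assms by (intro order_trans[OF integral_abs_bound] integral_mono) (auto simp: indicator_def)
  then show ?thesis by (simp add: grid_average_def abs_mult mult_left_mono)
qed

text \<open>A pointwise Poincare-type estimate. A difference \<open>t\<close> is at most
  \<open>d + d powr (1 - p) * t powr p\<close>, and within a cell the distance is at most
  \<open>N / k\<close> with N the dimension, so the Gagliardo weight can be inserted at the price of
  \<open>(N / k) powr (N + s * p)\<close>. The factor \<open>k ^ N\<close> is the reciprocal volume
  of a cell.\<close>

lemma grid_average_error:
  fixes u :: "'a::euclidean_space \<Rightarrow> real"
  assumes u[measurable]: "u \<in> borel_measurable borel" and ui: "integrable lborel u"
    and k: "0 < k" and d: "0 < d" and sp: "0 < s" "1 \<le> p"
  shows "ennreal \<bar>u x - grid_average k u x\<bar> \<le> ennreal d +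
    ennreal (real k ^ DIM('a) * d powr (1 - p) * (real DIM('a) / real k) powr (real DIM('a) + s * p)) *
    (\<integral>\<^sup>+y. ennreal (\<bar>u x - u y\<bar> powr p / norm (x - y) powr (real DIM('a) + s * p)) \<partial>lborel)"
proof -
  define Q where "Q = grid_cell k x"
  define h where "h = real DIM('a) / real k"
  define a where "a = real DIM('a) + s * p"
  have a: "0 < a" using sp by (simp add: a_def add_pos_nonneg)
  have [measurable]: "Q \<in> sets borel" by (simp add: Q_def)
  have eQ: "emeasure lborel Q = ennreal ((1 / real k) ^ DIM('a))" unfolding Q_def by (rule emeasure_grid_cell[OF k])
  have mQ: "measure lborel Q = (1 / real k) ^ DIM('a)" using eQ by (simp add: measure_def)
  have kk: "real k ^ DIM('a) * (1 / real k) ^ DIM('a) = 1" using k by (simp flip: power_mult_distrib)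
  have i1: "integrable lborel (\<lambda>y. indicator Q y * u y)"
    by (rule Bochner_Integration.integrable_bound[OF ui]) (auto simp: indicator_def)
  have i2: "integrable lborel (\<lambda>y. indicator Q y * u x)"
    using eQ by (intro integrable_mult_left integrable_real_indicator) auto
  have "u x - grid_average k u x = real k ^ DIM('a) * (\<integral>y. indicator Q y * u x \<partial>lborel) - real k ^ DIM('a) * (\<integral>y. indicator Q y * u y \<partial>lborel)"
    using kk by (simp add: grid_average_def Q_def[symmetric] mQ mult.assoc[symmetric])
  also have "\<dots> = real k ^ DIM('a) * (\<integral>y. indicator Q y * u x - indicator Q y * u y \<partial>lborel)"
    using i1 i2 by (simp add: right_diff_distrib)
  also have "\<dots> = real k ^ DIM('a) * (\<integral>y. indicator Q y * (u x - u y) \<partial>lborel)"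
    by (simp add: right_diff_distrib)
  finally have "ennreal \<bar>u x - grid_average k u x\<bar> = ennreal (real k ^ DIM('a)) * ennreal (norm (\<integral>y. indicator Q y * (u x - u y) \<partial>lborel))"
    by (simp add: abs_mult ennreal_mult)
  also have "\<dots> \<le> ennreal (real k ^ DIM('a)) * (\<integral>\<^sup>+y. norm (indicator Q y * (u x - u y)) \<partial>lborel)"
    using i1 i2 by (intro mult_left_mono integral_norm_bound_ennreal) (auto simp: right_diff_distrib)
  also have "(\<integral>\<^sup>+y. norm (indicator Q y * (u x - u y)) \<partial>lborel) \<le>
     (\<integral>\<^sup>+y. ennreal d * indicator Q y + ennreal (d powr (1 - p) * h powr a) * ennreal (\<bar>u x - u y\<bar> powr p / norm (x - y) powr a) \<partial>lborel)"
  proof (intro nn_integral_mono)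
    fix y
    show "ennreal (norm (indicator Q y * (u x - u y))) \<le> ennreal d * indicator Q y + ennreal (d powr (1 - p) * h powr a) * ennreal (\<bar>u x - u y\<bar> powr p / norm (x - y) powr a)"
    proof (cases "y \<in> Q \<and> u x \<noteq> u y")
      case True
      then have xy: "0 < norm (x - y)" "norm (x - y) \<le> h"
        using norm_le_grid_cell[OF k] by (auto simp: Q_def h_def)
      define t where "t = \<bar>u x - u y\<bar>"
      have t: "0 < t" using True by (simp add: t_def)
      have "t \<le> d + d powr (1 - p) * t powr p"
      proof (cases "t \<le> d")
        case False
        have "t = t powr (1 - p) * t powr p" using t by (simp flip: powr_add)
        also have "\<dots> \<le> d powr (1 - p) * t powr p" using False d sp by (intro mult_right_mono powr_mono2') auto
        finally show ?thesis using d by simp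
      qed (simp add: add_increasing2)
      also have "t powr p = norm (x - y) powr a * (t powr p / norm (x - y) powr a)" using xy by simp
      also have "d + d powr (1 - p) * \<dots> \<le> d + d powr (1 - p) * (h powr a * (t powr p / norm (x - y) powr a))"
        using xy a by (intro add_left_mono mult_left_mono mult_right_mono powr_mono2) auto
      also have "\<dots> = d + (d powr (1 - p) * h powr a) * (t powr p / norm (x - y) powr a)" by simp
      finally have "ennreal t \<le> ennreal (d + (d powr (1 - p) * h powr a) * (t powr p / norm (x - y) powr a))"
        by (rule ennreal_leI)
      also have "\<dots> = ennreal d + ennreal ((d powr (1 - p) * h powr a) * (t powr p / norm (x - y) powr a))"
        using d by (intro ennreal_plus) auto
      also have "ennreal ((d powr (1 - p) * h powr a) * (t powr p / norm (x - y) powr a))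
          = ennreal (d powr (1 - p) * h powr a) * ennreal (t powr p / norm (x - y) powr a)"
        by (intro ennreal_mult) auto
      finally show ?thesis using True by (simp add: t_def)
    qed (auto simp: indicator_def)
  qed
  also have "\<dots> = ennreal d * emeasure lborel Q + ennreal (d powr (1 - p) * h powr a) *
      (\<integral>\<^sup>+y. ennreal (\<bar>u x - u y\<bar> powr p / norm (x - y) powr a) \<partial>lborel)"
    by (simp add: nn_integral_add nn_integral_cmult nn_integral_cmult_indicator)
  also have "ennreal (real k ^ DIM('a)) * \<dots> = ennreal (real k ^ DIM('a)) * ennreal ((1 / real k) ^ DIM('a)) * ennreal d
     + ennreal (real k ^ DIM('a)) * ennreal (d powr (1 - p) * h powr a) * (\<integral>\<^sup>+y. ennreal (\<bar>u x - u y\<bar> powr p / norm (x - y) powr a) \<partial>lborel)"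
    unfolding eQ by (simp only: distrib_left mult_ac)
  also have "ennreal (real k ^ DIM('a)) * ennreal ((1 / real k) ^ DIM('a)) = 1"
    by (subst ennreal_mult[symmetric], simp, simp, subst kk, rule ennreal_1)
  also have "ennreal (real k ^ DIM('a)) * ennreal (d powr (1 - p) * h powr a) = ennreal (real k ^ DIM('a) * d powr (1 - p) * h powr a)"
    by (subst ennreal_mult[symmetric]) (simp_all add: mult.assoc)
  finally show ?thesis by (simp add: h_def a_def mult_left_mono)
qed

text \<open>First \<open>d\<close> makes the constant term small, then \<open>k\<close> the energy
  term: the factor \<open>k ^ N\<close> from averaging is beaten by
  \<open>(N / k) powr (N + s * p)\<close>, which leaves \<open>k powr (- (s * p))\<close>. One
  \<open>k\<close> serves all functions of bounded energy; this uniformity is the source of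
  compactness.\<close>

lemma grid_average_uniform_error:
  fixes \<Omega> :: "'a::euclidean_space set"
  assumes \<Omega>[measurable]: "\<Omega> \<in> sets borel" "emeasure lborel \<Omega> < \<infinity>" and sp: "0 < s" "1 \<le> p" and e: "0 < e" and M: "0 \<le> M"
  shows "\<exists>k. \<forall>u\<in>borel_measurable borel. integrable lborel u \<longrightarrow> gag s p u \<le> ennreal M \<longrightarrow>
     (\<integral>\<^sup>+x. ennreal \<bar>u x - grid_average k u x\<bar> * indicator \<Omega> x \<partial>lborel) \<le> ennreal e"
proof -
  define N where "N = real DIM('a)"
  define m where "m = measure lborel \<Omega>"
  have m: "emeasure lborel \<Omega> = ennreal m" "0 \<le> m"
    using \<Omega>(2) by (simp_all add: m_def emeasure_eq_ennreal_measure)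
  define d where "d = e / (2 * (m + 1))"
  have d: "0 < d" using e m by (simp add: d_def)
  have sp': "0 < s * p" using sp by simp
  have "((\<lambda>k. d powr (1 - p) * N powr (N + s * p) * M * real k powr (- (s * p))) \<longlongrightarrow> d powr (1 - p) * N powr (N + s * p) * M * 0) sequentially"
    using sp' by (intro tendsto_mult tendsto_const tendsto_neg_powr filterlim_real_sequentially) auto
  then have "eventually (\<lambda>k. d powr (1 - p) * N powr (N + s * p) * M * real k powr (- (s * p)) < e / 2) sequentially"
    using e by (intro order_tendstoD) auto
  then have "eventually (\<lambda>k. d powr (1 - p) * N powr (N + s * p) * M * real k powr (- (s * p)) < e / 2 \<and> 0 < k) sequentially"
    using eventually_gt_at_top[of 0] by eventually_elim auto
  then obtain k where k: "d powr (1 - p) * N powr (N + s * p) * M * real k powr (- (s * p)) < e / 2" "0 < k"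
    unfolding eventually_sequentially by blast
  define c where "c = real k ^ DIM('a) * d powr (1 - p) * (N / real k) powr (N + s * p)"
  have c: "c * M < e / 2" "0 \<le> c"
  proof -
    have "real k ^ DIM('a) = real k powr N" using k by (simp add: N_def powr_realpow)
    then have "c * M = d powr (1 - p) * N powr (N + s * p) * M * (real k powr N * real k powr (- (N + s * p)))"
    proof -
      have "(N / real k) powr (N + s * p) = N powr (N + s * p) * real k powr (- (N + s * p))"
        unfolding powr_minus_divide using k by (simp add: powr_divide N_def)
      then show ?thesis using \<open>real k ^ DIM('a) = real k powr N\<close> by (simp only: c_def mult_ac)
    qed
    also have "real k powr N * real k powr (- (N + s * p)) = real k powr (- (s * p))"
      by (simp flip: powr_add)
    finally have "c * M = d powr (1 - p) * N powr (N + s * p) * M * real k powr (- (s * p))" .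
    then show "c * M < e / 2" using k(1) by (simp only:)
    show "0 \<le> c" by (simp add: c_def)
  qed
  show ?thesis
  proof (intro exI[of _ k] ballI impI)
    fix u :: "'a \<Rightarrow> real" assume u[measurable]: "u \<in> borel_measurable borel" and ui: "integrable lborel u" and g: "gag s p u \<le> ennreal M"
    have "(\<integral>\<^sup>+x. ennreal \<bar>u x - grid_average k u x\<bar> * indicator \<Omega> x \<partial>lborel) \<le>
      (\<integral>\<^sup>+x. ennreal d * indicator \<Omega> x + ennreal c * (\<integral>\<^sup>+y. ennreal (\<bar>u x - u y\<bar> powr p / norm (x - y) powr (real DIM('a) + s * p)) \<partial>lborel) \<partial>lborel)"
      using grid_average_error[OF u ui k(2) d sp]
      by (intro nn_integral_mono) (auto simp: indicator_def c_def N_def)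
    also have "\<dots> = ennreal d * emeasure lborel \<Omega> + ennreal c * gag s p u"
      unfolding gag_def by (simp add: nn_integral_add nn_integral_cmult nn_integral_cmult_indicator)
    also have "\<dots> \<le> ennreal d * ennreal m + ennreal c * ennreal M"
      unfolding m by (intro add_left_mono mult_left_mono g) simp
    also have "\<dots> = ennreal (d * m + c * M)" using d c m M by (simp add: ennreal_mult)
    also have "\<dots> \<le> ennreal e"
    proof (rule ennreal_leI)
      have "d * m \<le> d * (m + 1)" using d by simp
      also have "\<dots> = e / 2" using m by (simp add: d_def field_simps)
      finally show "d * m + c * M \<le> e" using c by simp
    qed
    finally show "(\<integral>\<^sup>+x. ennreal \<bar>u x - grid_average k u x\<bar> * indicator \<Omega> x \<partial>lborel) \<le> ennreal e" .
  qed
qed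

text \<open>Only countably many pairs of scale and corner occur, and each integral over a cube is
  bounded by \<open>B\<close>, so one diagonal subsequence from
  \<open>function_convergent_subsequence\<close> serves all scales and all points.\<close>

lemma grid_averages_convergent_subsequence:
  fixes u :: "nat \<Rightarrow> 'a::euclidean_space \<Rightarrow> real"
  assumes ui: "\<And>n. integrable lborel (u n)" and b: "\<And>n. (\<integral>x. \<bar>u n x\<bar> \<partial>lborel) \<le> B"
  shows "\<exists>r. strict_mono (r :: nat \<Rightarrow> nat) \<and> (\<forall>k x. convergent (\<lambda>n. grid_average k (u (r n)) x))"
proof -
  define S where "S = (\<Union>k. (\<lambda>g. (k, g)) ` range (grid_point k :: 'a \<Rightarrow> 'a))"
  define f where "f n = (\<lambda>(k, g). \<integral>y. indicator (cbox g (g + (1 / real k) *\<^sub>R One)) y * u n y \<partial>lborel)" for n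
  have cS: "countable S" unfolding S_def by (intro countable_UN countable_image countable_range_grid_point) auto
  have fB: "norm (f n z) \<le> B" if "z \<in> S" for n z
  proof -
    obtain k g where z: "z = (k, g)" by force
    have "integrable lborel (\<lambda>y. indicator (cbox g (g + (1 / real k) *\<^sub>R One)) y * u n y)"
      by (rule Bochner_Integration.integrable_bound[OF ui[of n]]) (use ui[of n] in \<open>auto simp: indicator_def\<close>)
    then have "\<bar>f n z\<bar> \<le> (\<integral>y. \<bar>u n y\<bar> \<partial>lborel)"
      unfolding z f_def using ui by (auto intro!: order_trans[OF integral_abs_bound] integral_mono simp: indicator_def)
    then show ?thesis using b[of n] by simp
  qed
  obtain r where r: "strict_mono (r::nat\<Rightarrow>nat)" "\<And>z. z \<in> S \<Longrightarrow> \<exists>l. (\<lambda>n. f (r n) z) \<longlonglongrightarrow> l"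
    using function_convergent_subsequence[of S f B, OF cS fB] by blast
  have "convergent (\<lambda>n. grid_average k (u (r n)) x)" for k x
  proof -
    have "(k, grid_point k x) \<in> S" by (auto simp: S_def)
    from r(2)[OF this] obtain l where "(\<lambda>n. f (r n) (k, grid_point k x)) \<longlonglongrightarrow> l" by blast
    then have "(\<lambda>n. real k ^ DIM('a) * f (r n) (k, grid_point k x)) \<longlonglongrightarrow> real k ^ DIM('a) * l"
      by (rule tendsto_mult_left)
    then show ?thesis by (auto simp: f_def grid_average_def grid_cell_def convergent_def)
  qed
  with r show ?thesis by blast
qed

text \<open>The integrals of the increments have a finite sum, so almost everywhere the series of
  increments converges absolutely, and it telescopes.\<close>

lemma AE_convergent_fast_L1_Cauchy:
  fixes v :: "nat \<Rightarrow> 'a \<Rightarrow> real"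
  assumes [measurable]: "\<And>n. v n \<in> borel_measurable M"
    and b: "\<And>n. (\<integral>\<^sup>+x. ennreal \<bar>v (Suc n) x - v n x\<bar> \<partial>M) \<le> ennreal ((1/2) ^ n)"
  shows "AE x in M. convergent (\<lambda>n. v n x)"
proof -
  have "(\<integral>\<^sup>+x. (\<Sum>n. ennreal \<bar>v (Suc n) x - v n x\<bar>) \<partial>M) = (\<Sum>n. \<integral>\<^sup>+x. ennreal \<bar>v (Suc n) x - v n x\<bar> \<partial>M)"
    by (rule nn_integral_suminf) measurable
  also have "\<dots> \<le> (\<Sum>n. ennreal ((1/2) ^ n))" by (intro suminf_le b summableI)
  also have "\<dots> = ennreal (\<Sum>n. (1/2) ^ n)" by (intro suminf_ennreal2) (auto intro: summable_geometric)
  also have "\<dots> < \<infinity>" by simp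
  finally have "AE x in M. (\<Sum>n. ennreal \<bar>v (Suc n) x - v n x\<bar>) \<noteq> \<infinity>"
    by (intro nn_integral_PInf_AE) auto
  then show ?thesis
  proof eventually_elim
    case (elim x)
    then have "summable (\<lambda>n. \<bar>v (Suc n) x - v n x\<bar>)" by (intro summable_suminf_not_top) auto
    then have "summable (\<lambda>n. v (Suc n) x - v n x)" by (rule summable_rabs_cancel)
    then have "convergent (\<lambda>n. \<Sum>i<n. v (Suc i) x - v i x)" by (simp add: summable_iff_convergent)
    then have "convergent (\<lambda>n. v n x - v 0 x)" by (simp add: sum_lessThan_telescope[of "\<lambda>n. v n x"])
    then have "convergent (\<lambda>n. (v n x - v 0 x) + v 0 x)" by (intro convergent_add convergent_const)
    then show ?case by simp
  qed
qed

text \<open>A Rellich theorem with almost everywhere convergence. The grid averages converge at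
  every scale and are close to the functions in \<open>L^1\<close>, uniformly in \<open>n\<close>;
  so the subsequence is Cauchy in \<open>L^1\<close>, and a rapidly converging further subsequence
  converges almost everywhere.\<close>

lemma gag_compactness:
  fixes \<Omega> :: "'a::euclidean_space set" and u :: "nat \<Rightarrow> 'a \<Rightarrow> real"
  assumes \<Omega>[measurable]: "\<Omega> \<in> sets borel" and fin: "emeasure lborel \<Omega> < \<infinity>" and sp: "0 < s" "1 \<le> p"
    and um[measurable]: "\<And>n. u n \<in> borel_measurable borel"
    and off: "\<And>n x. x \<notin> \<Omega> \<Longrightarrow> u n x = 0"
    and ui: "\<And>n. integrable lborel (u n)" and b: "\<And>n. (\<integral>x. \<bar>u n x\<bar> \<partial>lborel) \<le> B"
    and g: "\<And>n. gag s p (u n) \<le> ennreal M"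
  shows "\<exists>r w. strict_mono (r :: nat \<Rightarrow> nat) \<and> w \<in> borel_measurable borel \<and> (\<forall>x. x \<notin> \<Omega> \<longrightarrow> w x = 0)
     \<and> (AE x in lborel. (\<lambda>n. u (r n) x) \<longlonglongrightarrow> w x)"
proof -
  obtain r where r: "strict_mono (r :: nat \<Rightarrow> nat)" and rc: "\<And>k x. convergent (\<lambda>n. grid_average k (u (r n)) x)"
    using grid_averages_convergent_subsequence[of u B, OF ui b] by blast
  have M: "gag s p (u n) \<le> ennreal (max 0 M)" for n by (rule order_trans[OF g]) (simp add: ennreal_leI)
  have dist: "(\<integral>\<^sup>+x. ennreal \<bar>f x - h x\<bar> * indicator \<Omega> x \<partial>lborel) \<le>
      (\<integral>\<^sup>+x. ennreal \<bar>f x - l x\<bar> * indicator \<Omega> x \<partial>lborel) + (\<integral>\<^sup>+x. ennreal \<bar>h x - l x\<bar> * indicator \<Omega> x \<partial>lborel)"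
    if [measurable]: "f \<in> borel_measurable borel" "h \<in> borel_measurable borel" "l \<in> borel_measurable borel" for f h l :: "'a \<Rightarrow> real"
  proof -
    have "(\<integral>\<^sup>+x. ennreal \<bar>f x - h x\<bar> * indicator \<Omega> x \<partial>lborel) \<le>
       (\<integral>\<^sup>+x. ennreal \<bar>f x - l x\<bar> * indicator \<Omega> x + ennreal \<bar>h x - l x\<bar> * indicator \<Omega> x \<partial>lborel)"
      by (intro nn_integral_mono) (auto simp: indicator_def ennreal_leI simp flip: ennreal_plus)
    also have "\<dots> = (\<integral>\<^sup>+x. ennreal \<bar>f x - l x\<bar> * indicator \<Omega> x \<partial>lborel) + (\<integral>\<^sup>+x. ennreal \<bar>h x - l x\<bar> * indicator \<Omega> x \<partial>lborel)"
      by (intro nn_integral_add) measurable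
    finally show ?thesis .
  qed
  \<comment> \<open>At one good scale the averages converge boundedly to \<open>L\<close>, hence
    also in the mean over \<Omega>. Eventually each function is within \<open>e / 4 + e / 4\<close>
    of \<open>L\<close>, and two of them are within \<open>e\<close> of each other.\<close>
  have cauchy: "\<exists>m. \<forall>i\<ge>m. \<forall>j\<ge>m. (\<integral>\<^sup>+x. ennreal \<bar>u (r i) x - u (r j) x\<bar> * indicator \<Omega> x \<partial>lborel) \<le> ennreal e"
    if e: "0 < e" for e
  proof -
    have "0 < e / 4" "0 \<le> max 0 M" using e by auto
    from grid_average_uniform_error[OF \<Omega> fin sp this]
    obtain k where k: "\<forall>u\<in>borel_measurable borel. integrable lborel u \<longrightarrow> gag s p u \<le> ennreal (max 0 M) \<longrightarrow>
      (\<integral>\<^sup>+x. ennreal \<bar>u x - grid_average k u x\<bar> * indicator \<Omega> x \<partial>lborel) \<le> ennreal (e / 4)"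
      by blast
    have k: "(\<integral>\<^sup>+x. ennreal \<bar>u n x - grid_average k (u n) x\<bar> * indicator \<Omega> x \<partial>lborel) \<le> ennreal (e / 4)" for n
      using k[rule_format, OF um ui M] .
    define L where "L x = lim (\<lambda>n. grid_average k (u (r n)) x)" for x
    have L: "(\<lambda>n. grid_average k (u (r n)) x) \<longlonglongrightarrow> L x" for x
      using rc[of k x] by (simp add: L_def convergent_LIMSEQ_iff)
    have [measurable]: "L \<in> borel_measurable borel"
      by (rule borel_measurable_LIMSEQ_real[OF L]) measurable
    define c where "c = real k ^ DIM('a) * B"
    have gb: "\<bar>grid_average k (u n) x\<bar> \<le> c" for n x
      unfolding c_def by (rule order_trans[OF abs_grid_average_le[OF ui] mult_left_mono[OF b]]) simp
    have Lb: "\<bar>L x\<bar> \<le> c" for x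
      by (rule LIMSEQ_le_const2[OF tendsto_rabs[OF L]]) (use gb in auto)
    have "(\<lambda>n. \<integral>\<^sup>+x. ennreal \<bar>grid_average k (u (r n)) x - L x\<bar> * indicator \<Omega> x \<partial>lborel) \<longlonglongrightarrow> (\<integral>\<^sup>+x. 0 \<partial>(lborel :: 'a measure))"
    proof (rule nn_integral_dominated_convergence[where w = "\<lambda>x. ennreal (2 * c) * indicator \<Omega> x"])
      show "(\<integral>\<^sup>+x. ennreal (2 * c) * indicator \<Omega> x \<partial>lborel) < \<infinity>"
        using fin by (simp add: nn_integral_cmult_indicator ennreal_mult_less_top)
      show "AE x in lborel. ennreal \<bar>grid_average k (u (r n)) x - L x\<bar> * indicator \<Omega> x \<le> ennreal (2 * c) * indicator \<Omega> x" for n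
      proof (intro AE_I2 mult_right_mono ennreal_leI)
        fix x show "\<bar>grid_average k (u (r n)) x - L x\<bar> \<le> 2 * c" using gb[of "r n" x] Lb[of x] by linarith
      qed simp
      show "AE x in lborel. (\<lambda>n. ennreal \<bar>grid_average k (u (r n)) x - L x\<bar> * indicator \<Omega> x) \<longlonglongrightarrow> 0"
      proof (rule AE_I2)
        fix x
        have "(\<lambda>n. ennreal \<bar>grid_average k (u (r n)) x - L x\<bar>) \<longlonglongrightarrow> ennreal \<bar>L x - L x\<bar>"
          by (intro tendsto_ennrealI tendsto_intros L)
        then show "(\<lambda>n. ennreal \<bar>grid_average k (u (r n)) x - L x\<bar> * indicator \<Omega> x) \<longlonglongrightarrow> 0"
          by (auto simp: indicator_def)
      qed
    qed measurable
    then have "eventually (\<lambda>n. (\<integral>\<^sup>+x. ennreal \<bar>grid_average k (u (r n)) x - L x\<bar> * indicator \<Omega> x \<partial>lborel) < ennreal (e / 4)) sequentially"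
      using e by (intro order_tendstoD) auto
    then obtain m where m: "\<And>n. n \<ge> m \<Longrightarrow> (\<integral>\<^sup>+x. ennreal \<bar>grid_average k (u (r n)) x - L x\<bar> * indicator \<Omega> x \<partial>lborel) \<le> ennreal (e / 4)"
      unfolding eventually_sequentially by (meson less_imp_le)
    have uL: "(\<integral>\<^sup>+x. ennreal \<bar>u (r n) x - L x\<bar> * indicator \<Omega> x \<partial>lborel) \<le> ennreal (e / 2)" if "n \<ge> m" for n
    proof -
      have "(\<integral>\<^sup>+x. ennreal \<bar>u (r n) x - L x\<bar> * indicator \<Omega> x \<partial>lborel) \<le>
        (\<integral>\<^sup>+x. ennreal \<bar>u (r n) x - grid_average k (u (r n)) x\<bar> * indicator \<Omega> x \<partial>lborel)
        + (\<integral>\<^sup>+x. ennreal \<bar>L x - grid_average k (u (r n)) x\<bar> * indicator \<Omega> x \<partial>lborel)"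
        by (rule dist) measurable
      also have "\<dots> \<le> ennreal (e / 4) + ennreal (e / 4)"
        using k m[OF that] by (intro add_mono) (simp_all add: abs_minus_commute)
      also have "\<dots> = ennreal (e / 2)" using e by (simp flip: ennreal_plus)
      finally show ?thesis .
    qed
    have "(\<integral>\<^sup>+x. ennreal \<bar>u (r i) x - u (r j) x\<bar> * indicator \<Omega> x \<partial>lborel) \<le> ennreal e" if "i \<ge> m" "j \<ge> m" for i j
    proof -
      have "(\<integral>\<^sup>+x. ennreal \<bar>u (r i) x - u (r j) x\<bar> * indicator \<Omega> x \<partial>lborel) \<le>
        (\<integral>\<^sup>+x. ennreal \<bar>u (r i) x - L x\<bar> * indicator \<Omega> x \<partial>lborel) + (\<integral>\<^sup>+x. ennreal \<bar>u (r j) x - L x\<bar> * indicator \<Omega> x \<partial>lborel)"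
        by (rule dist) measurable
      also have "\<dots> \<le> ennreal (e / 2) + ennreal (e / 2)" using uL that by (intro add_mono)
      also have "\<dots> = ennreal e" using e by (simp flip: ennreal_plus)
      finally show ?thesis .
    qed
    then show ?thesis by blast
  qed
  have "\<exists>t. \<forall>n. (\<forall>i\<ge>t n. \<forall>j\<ge>t n. (\<integral>\<^sup>+x. ennreal \<bar>u (r i) x - u (r j) x\<bar> * indicator \<Omega> x \<partial>lborel) \<le> ennreal ((1/2)^n)) \<and> t n < t (Suc n)"
  proof (rule dependent_nat_choice)
    show "\<exists>m. \<forall>i\<ge>m. \<forall>j\<ge>m. (\<integral>\<^sup>+x. ennreal \<bar>u (r i) x - u (r j) x\<bar> * indicator \<Omega> x \<partial>lborel) \<le> ennreal ((1/2)^0)"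
      by (rule cauchy) simp
    fix m0 :: nat and n :: nat
    obtain m where "\<forall>i\<ge>m. \<forall>j\<ge>m. (\<integral>\<^sup>+x. ennreal \<bar>u (r i) x - u (r j) x\<bar> * indicator \<Omega> x \<partial>lborel) \<le> ennreal ((1/2)^Suc n)"
      using cauchy[of "(1/2)^Suc n"] by auto
    then show "\<exists>m. (\<forall>i\<ge>m. \<forall>j\<ge>m. (\<integral>\<^sup>+x. ennreal \<bar>u (r i) x - u (r j) x\<bar> * indicator \<Omega> x \<partial>lborel) \<le> ennreal ((1/2)^Suc n)) \<and> m0 < m"
      by (intro exI[of _ "max m (Suc m0)"]) auto
  qed
  then obtain t where t: "\<And>n i j. i \<ge> t n \<Longrightarrow> j \<ge> t n \<Longrightarrow> (\<integral>\<^sup>+x. ennreal \<bar>u (r i) x - u (r j) x\<bar> * indicator \<Omega> x \<partial>lborel) \<le> ennreal ((1/2)^n)"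
    and tm: "\<And>n. t n < t (Suc n)" by blast
  have tm': "strict_mono t" using tm by (simp add: strict_mono_Suc_iff)
  define v where "v n = u (r (t n))" for n
  have [measurable]: "v n \<in> borel_measurable borel" for n by (simp add: v_def)
  have "AE x in lborel. convergent (\<lambda>n. v n x)"
  proof (rule AE_convergent_fast_L1_Cauchy)
    fix n
    have "(\<integral>\<^sup>+x. ennreal \<bar>v (Suc n) x - v n x\<bar> \<partial>lborel) = (\<integral>\<^sup>+x. ennreal \<bar>v (Suc n) x - v n x\<bar> * indicator \<Omega> x \<partial>lborel)"
      using off by (intro nn_integral_cong) (auto simp: v_def indicator_def)
    also have "\<dots> \<le> ennreal ((1/2)^n)" unfolding v_def using tm[of n] by (intro t) auto
    finally show "(\<integral>\<^sup>+x. ennreal \<bar>v (Suc n) x - v n x\<bar> \<partial>lborel) \<le> ennreal ((1/2)^n)" .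
  qed measurable
  then have "AE x in lborel. (\<lambda>n. v n x) \<longlonglongrightarrow> lim (\<lambda>n. v n x)"
    by eventually_elim (simp add: convergent_LIMSEQ_iff)
  moreover have "(\<lambda>x. lim (\<lambda>n. v n x)) \<in> borel_measurable borel" by measurable
  \<comment> \<open>Off \<Omega> the sequence is constantly 0, so \<open>lim\<close> vanishes there
    everywhere and not just almost everywhere.\<close>
  moreover have "\<forall>x. x \<notin> \<Omega> \<longrightarrow> lim (\<lambda>n. v n x) = 0" using off by (simp add: v_def)
  moreover have "strict_mono (r \<circ> t)" using r tm' by (rule strict_mono_o)
  ultimately show ?thesis
    by (intro exI[of _ "r \<circ> t"] exI[of _ "\<lambda>x. lim (\<lambda>n. v n x)"]) (auto simp: v_def)
qed

section \<open>The Nehari manifold\<close>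

text \<open>Moving the Gagliardo weight into the measure makes the energy the integral of
  \<open>\<bar>diff2 u z\<bar> powr t\<close>, with \<open>diff2\<close> linear in \<open>u\<close>.
  The general results on integrals of powers (Fatou, Brezis--Lieb, differentiation) then apply to it
  just as to the integrals over \<Omega>.\<close>

definition frac_measure :: "real \<Rightarrow> real \<Rightarrow> ('a::euclidean_space \<times> 'a) measure" where
  "frac_measure s t = density lborel (\<lambda>z. ennreal (1 / norm (fst z - snd z) powr (real DIM('a) + s * t)))"

definition diff2 :: "('a \<Rightarrow> real) \<Rightarrow> 'a \<times> 'a \<Rightarrow> real" where
  "diff2 u z = u (fst z) - u (snd z)"

lemma sets_frac_measure[measurable_cong, simp]: "sets (frac_measure s t) = sets borel"
  by (simp add: frac_measure_def)

lemma borel_measurable_diff2[measurable]: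
  fixes u :: "'a::euclidean_space \<Rightarrow> real"
  assumes [measurable]: "u \<in> borel_measurable borel"
  shows "diff2 u \<in> borel_measurable borel"
proof -
  have "(\<lambda>z. u (fst z) - u (snd z)) \<in> borel_measurable (borel \<Otimes>\<^sub>M borel :: ('a \<times> 'a) measure)" by measurable
  then show ?thesis by (simp add: diff2_def[abs_def] borel_prod)
qed

lemma borel_measurable_norm_diff[measurable]:
  "(\<lambda>z::'a::euclidean_space \<times> 'a. norm (fst z - snd z)) \<in> borel_measurable borel"
  by (intro borel_measurable_continuous_onI continuous_intros)

lemma gag_eq_frac_measure:
  fixes u :: "'a::euclidean_space \<Rightarrow> real"
  assumes [measurable]: "u \<in> borel_measurable borel"
  shows "gag s t u = (\<integral>\<^sup>+z. ennreal (\<bar>diff2 u z\<bar> powr t) \<partial>frac_measure s t)"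
proof -
  have "(\<integral>\<^sup>+z. ennreal (\<bar>diff2 u z\<bar> powr t) \<partial>frac_measure s t)
     = (\<integral>\<^sup>+z. ennreal (1 / norm (fst z - snd z) powr (real DIM('a) + s * t)) * ennreal (\<bar>diff2 u z\<bar> powr t) \<partial>lborel)"
    unfolding frac_measure_def by (subst nn_integral_density) simp_all
  also have "\<dots> = (\<integral>\<^sup>+x. \<integral>\<^sup>+y. ennreal (1 / norm (x - y) powr (real DIM('a) + s * t)) * ennreal (\<bar>diff2 u (x, y)\<bar> powr t) \<partial>lborel \<partial>lborel)"
    by (subst nn_integral_lborel_prod) simp_all
  also have "\<dots> = gag s t u"
    unfolding gag_def by (intro nn_integral_cong) (simp add: diff2_def flip: ennreal_mult')
  finally show ?thesis ..
qed

lemma gag_finite_iff_integrable: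
  fixes u :: "'a::euclidean_space \<Rightarrow> real"
  assumes [measurable]: "u \<in> borel_measurable borel"
  shows "gag s t u < \<infinity> \<longleftrightarrow> integrable (frac_measure s t) (\<lambda>z. \<bar>diff2 u z\<bar> powr t)"
  by (simp add: gag_eq_frac_measure integrable_iff_bounded)

lemma enn2real_gag:
  fixes u :: "'a::euclidean_space \<Rightarrow> real"
  assumes [measurable]: "u \<in> borel_measurable borel"
  shows "enn2real (gag s t u) = (\<integral>z. \<bar>diff2 u z\<bar> powr t \<partial>frac_measure s t)"
  by (simp add: gag_eq_frac_measure integral_eq_nn_integral)

lemma AE_frac_measure:
  assumes "AE z in lborel. P z" shows "AE z in frac_measure s t. P z"
  unfolding frac_measure_def using assms by (subst AE_density) (auto elim: eventually_mono)

text \<open>For a null set \<open>Z\<close> both \<open>Z \<times> UNIV\<close> and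
  \<open>UNIV \<times> Z\<close> are null; in this way almost everywhere statements about
  \<open>u\<close> carry over to \<open>diff2 u\<close>.\<close>

lemma AE_lborel_fst_snd:
  assumes "AE x in (lborel::'a::euclidean_space measure). P x"
  shows "AE z in (lborel :: ('a \<times> 'a) measure). P (fst z) \<and> P (snd z)"
proof -
  obtain Z :: "'a set" where Z: "Z \<in> null_sets lborel" "{x. \<not> P x} \<subseteq> Z"
    using assms by (auto simp: eventually_ae_filter)
  have "Z \<times> UNIV \<in> null_sets (lborel \<Otimes>\<^sub>M (lborel::'a measure))" "UNIV \<times> Z \<in> null_sets ((lborel::'a measure) \<Otimes>\<^sub>M lborel)"
    using Z by (auto simp: null_sets_def lborel.emeasure_pair_measure_Times)
  then have "(Z \<times> UNIV) \<union> (UNIV \<times> Z) \<in> null_sets (lborel :: ('a \<times> 'a) measure)"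
    by (simp add: lborel_prod null_sets.Un)
  then show ?thesis by (rule AE_I') (use Z in auto)
qed

section \<open>The function space and its functionals\<close>

locale pq_problem =
  fixes \<Omega> :: "'a::euclidean_space set" and s1 s2 p q r :: real
  assumes open_\<Omega>: "open \<Omega>" and bounded_\<Omega>: "bounded \<Omega>" and nonempty_\<Omega>: "\<Omega> \<noteq> {}"
    and s: "0 < s2" "s2 < s1" "s1 < 1" and subcrit: "s1 * p < real DIM('a)"
    and exponents: "2 \<le> q" "q < p" "p < r" "r < crit_exp DIM('a) s1 p"
begin

definition "\<sigma> = crit_exp DIM('a) s1 p"

text \<open>Borel representatives that vanish everywhere off \<Omega>, which keeps null sets and
  completions out of the variational argument. Integrability of
  \<open>\<bar>u x\<bar> powr p\<close> comes from the Sobolev inequality; \<open>X_imp_X0\<close>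
  and \<open>X0_representative\<close> relate this set to \<open>X0\<close>.\<close>

definition X :: "('a \<Rightarrow> real) set" where
  "X = {u \<in> borel_measurable borel. (\<forall>x. x \<notin> \<Omega> \<longrightarrow> u x = 0) \<and> gag s1 p u < \<infinity>}"

definition "A u = (\<integral>z. \<bar>diff2 u z\<bar> powr p \<partial>frac_measure s1 p)"
definition "B u = (\<integral>z. \<bar>diff2 u z\<bar> powr q \<partial>frac_measure s2 q)"
definition "R u = (\<integral>x. \<bar>u x\<bar> powr r \<partial>(lborel :: 'a measure))"
definition "C u = (\<integral>x. \<bar>u x\<bar> powr \<sigma> \<partial>(lborel :: 'a measure))"

lemma exps: "1 < q" "q < p" "p < r" "r < \<sigma>" "2 \<le> q" "2 < p" "1 < p" "0 < \<sigma>" "0 < s1"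
  using exponents s by (auto simp: \<sigma>_def)

lemma \<Omega>_borel[measurable]: "\<Omega> \<in> sets borel" using open_\<Omega> by simp

lemma \<Omega>_finite: "emeasure lborel \<Omega> < \<infinity>"
  using bounded_\<Omega> emeasure_bounded_finite by auto

lemma functional_nonneg: "0 \<le> A u" "0 \<le> B u" "0 \<le> R u" "0 \<le> C u"
  by (simp_all add: A_def B_def R_def C_def)

lemma XD:
  assumes "u \<in> X"
  shows "u \<in> borel_measurable borel" "x \<notin> \<Omega> \<Longrightarrow> u x = 0" "gag s1 p u < \<infinity>"
    "integrable (frac_measure s1 p) (\<lambda>z. \<bar>diff2 u z\<bar> powr p)"
    "gag s1 p u = ennreal (A u)"
proof -
  show *: "u \<in> borel_measurable borel" "x \<notin> \<Omega> \<Longrightarrow> u x = 0" "gag s1 p u < \<infinity>" using assms by (auto simp: X_def)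
  then show "integrable (frac_measure s1 p) (\<lambda>z. \<bar>diff2 u z\<bar> powr p)" using gag_finite_iff_integrable by blast
  show "gag s1 p u = ennreal (A u)" using *(3) enn2real_gag[OF *(1)] unfolding A_def by (metis ennreal_enn2real infinity_ennreal_def)
qed

lemma sobolev: "\<exists>K>0. \<forall>u\<in>X. integrable lborel (\<lambda>x. \<bar>u x\<bar> powr \<sigma>) \<and> C u \<le> K * A u powr (\<sigma> / p)"
proof -
  obtain K where K: "K > 0" "\<forall>u\<in>borel_measurable borel. (\<forall>x. x \<notin> \<Omega> \<longrightarrow> u x = 0) \<longrightarrow> gag s1 p u < \<infinity> \<longrightarrow>
    integrable lborel (\<lambda>x. \<bar>u x\<bar> powr crit_exp DIM('a) s1 p) \<and>
    (\<integral>x. \<bar>u x\<bar> powr crit_exp DIM('a) s1 p \<partial>lborel) \<le> K * enn2real (gag s1 p u) powr (crit_exp DIM('a) s1 p / p)"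
    using fractional_sobolev[OF exps(9) less_imp_le[OF exps(7)] subcrit \<Omega>_borel \<Omega>_finite] by blast
  show ?thesis
  proof (intro exI[of _ K] conjI ballI K(1))
    fix u assume u: "u \<in> X"
    from K(2)[rule_format, OF XD(1)[OF u] XD(2)[OF u] XD(3)[OF u]]
    show "integrable lborel (\<lambda>x. \<bar>u x\<bar> powr \<sigma>)" "C u \<le> K * A u powr (\<sigma> / p)"
      using u XD(1)[OF u] by (simp_all add: \<sigma>_def C_def A_def enn2real_gag)
  qed
qed

lemma X_integrable_crit: "u \<in> X \<Longrightarrow> integrable lborel (\<lambda>x. \<bar>u x\<bar> powr \<sigma>)"
  using sobolev by blast

text \<open>Values up to the level \<open>L\<close> are bounded and live on \<Omega>, larger ones
  are dominated by the critical power. The free level takes the place of Hoelder's inequality and is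
  chosen at each use.\<close>

lemma powr_interpolation:
  assumes u: "u \<in> X" and t: "0 < t" "t \<le> \<sigma>" and L: "0 < L"
  shows "\<bar>u x\<bar> powr t \<le> L powr t * indicator \<Omega> x + L powr (t - \<sigma>) * \<bar>u x\<bar> powr \<sigma>"
proof (cases "\<bar>u x\<bar> \<le> L")
  case True
  then show ?thesis using XD(2)[OF u, of x] t L
    by (cases "x \<in> \<Omega>") (auto intro!: powr_mono2 add_increasing2)
next
  case False
  have "\<bar>u x\<bar> powr t = \<bar>u x\<bar> powr (t - \<sigma>) * \<bar>u x\<bar> powr \<sigma>" by (simp flip: powr_add)
  also have "\<dots> \<le> L powr (t - \<sigma>) * \<bar>u x\<bar> powr \<sigma>"
    using False L t by (intro mult_right_mono powr_mono2') auto
  finally show ?thesis by (simp add: add_increasing)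
qed

lemma X_integrable_powr:
  assumes u: "u \<in> X" and t: "0 < t" "t \<le> \<sigma>"
  shows "integrable lborel (\<lambda>x. \<bar>u x\<bar> powr t)"
    and "0 < L \<Longrightarrow> (\<integral>x. \<bar>u x\<bar> powr t \<partial>lborel) \<le> L powr t * measure lborel \<Omega> + L powr (t - \<sigma>) * C u"
proof -
  have [measurable]: "u \<in> borel_measurable borel" by (rule XD[OF u])
  have ii: "integrable lborel (\<lambda>x. L powr t * indicator \<Omega> x + L powr (t - \<sigma>) * \<bar>u x\<bar> powr \<sigma>)" for L
    using X_integrable_crit[OF u] \<Omega>_finite by simp
  show i: "integrable lborel (\<lambda>x. \<bar>u x\<bar> powr t)"
    by (rule Bochner_Integration.integrable_bound[OF ii[of 1]])
      (use powr_interpolation[OF u t zero_less_one] in \<open>auto intro!: AE_I2 order_trans[OF _ abs_ge_self]\<close>)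
  show "(\<integral>x. \<bar>u x\<bar> powr t \<partial>lborel) \<le> L powr t * measure lborel \<Omega> + L powr (t - \<sigma>) * C u" if L: "0 < L" for L
  proof -
    have "(\<integral>x. \<bar>u x\<bar> powr t \<partial>lborel) \<le> (\<integral>x. L powr t * indicator \<Omega> x + L powr (t - \<sigma>) * \<bar>u x\<bar> powr \<sigma> \<partial>lborel)"
      by (intro integral_mono i ii powr_interpolation[OF u t L])
    also have "\<dots> = L powr t * measure lborel \<Omega> + L powr (t - \<sigma>) * C u"
      using X_integrable_crit[OF u] \<Omega>_finite by (simp add: C_def)
    finally show ?thesis .
  qed
qed

lemma X_gag_lower:
  assumes u: "u \<in> X" shows "gag s2 q u < \<infinity>" "integrable (frac_measure s2 q) (\<lambda>z. \<bar>diff2 u z\<bar> powr q)"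
proof -
  have [measurable]: "u \<in> borel_measurable borel" by (rule XD[OF u])
  have "(\<integral>\<^sup>+x. ennreal (\<bar>u x\<bar> powr p) \<partial>lborel) < \<infinity>"
    using X_integrable_powr(1)[OF u, of p] exps by (simp add: integrable_iff_bounded)
  then show "gag s2 q u < \<infinity>"
    using XD[OF u] s exps \<Omega>_finite by (intro gag_finite_lower_order[of u \<Omega> p s1 s2 q]) auto
  then show "integrable (frac_measure s2 q) (\<lambda>z. \<bar>diff2 u z\<bar> powr q)" using gag_finite_iff_integrable[of u] by simp
qed

lemma A_zero_imp_R_zero:
  assumes u: "u \<in> X" and A: "A u = 0" shows "R u = 0"
proof -
  have [measurable]: "u \<in> borel_measurable borel" by (rule XD[OF u])
  have "C u \<le> 0" using sobolev u A exps by force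
  then have "C u = 0" using functional_nonneg by (simp add: order_antisym)
  then have "AE x in lborel. \<bar>u x\<bar> powr \<sigma> = 0"
    unfolding C_def using X_integrable_crit[OF u] by (subst (asm) integral_nonneg_eq_0_iff_AE) auto
  then have "AE x in lborel. \<bar>u x\<bar> powr r = 0" by eventually_elim simp
  then show ?thesis unfolding R_def by (rule integral_eq_zero_AE)
qed

lemma R_le_A_powr: "\<exists>K>0. \<forall>u\<in>X. R u \<le> K * A u powr (r / p)"
proof -
  obtain K where K: "K > 0" "\<And>u. u \<in> X \<Longrightarrow> C u \<le> K * A u powr (\<sigma> / p)" using sobolev by blast
  show ?thesis
  proof (intro exI[of _ "measure lborel \<Omega> + K"] conjI ballI)
    show "0 < measure lborel \<Omega> + K" using K by (simp add: add_nonneg_pos)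
    fix u assume u: "u \<in> X"
    show "R u \<le> (measure lborel \<Omega> + K) * A u powr (r / p)"
    proof (cases "A u = 0")
      case True
      then show ?thesis using A_zero_imp_R_zero[OF u] by simp
    next
      case False
      then have A: "0 < A u" using functional_nonneg[of u] by simp
      \<comment> \<open>At this level both terms of the interpolation become multiples of
        \<open>A u powr (r / p)\<close>, the homogeneity of \<open>R\<close>. The level must be
        positive, hence the separate case \<open>A u = 0\<close>.\<close>
      define L where "L = A u powr (1 / p)"
      have L: "0 < L" using A by (simp add: L_def)
      have "R u \<le> L powr r * measure lborel \<Omega> + L powr (r - \<sigma>) * C u"
        unfolding R_def using X_integrable_powr(2)[OF u _ _ L, of r] exps by simp
      also have "\<dots> \<le> L powr r * measure lborel \<Omega> + L powr (r - \<sigma>) * (K * A u powr (\<sigma> / p))"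
        using K(2)[OF u] by (intro add_left_mono mult_left_mono) auto
      also have "A u powr (\<sigma> / p) = L powr \<sigma>" by (simp add: L_def powr_powr)
      also have "L powr r * measure lborel \<Omega> + L powr (r - \<sigma>) * (K * L powr \<sigma>) = L powr r * measure lborel \<Omega> + K * (L powr (r - \<sigma>) * L powr \<sigma>)"
        by simp
      also have "L powr (r - \<sigma>) * L powr \<sigma> = L powr r" by (simp flip: powr_add)
      also have "L powr r = A u powr (r / p)" by (simp add: L_def powr_powr)
      finally show ?thesis by (simp add: algebra_simps)
    qed
  qed
qed

lemma X_lincomb:
  assumes u: "u \<in> X" and v: "v \<in> X" shows "(\<lambda>x. u x + e * v x) \<in> X"
proof -
  have [measurable]: "u \<in> borel_measurable borel" "v \<in> borel_measurable borel" using u v by (simp_all add: X_def)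
  have "diff2 (\<lambda>x. u x + e * v x) z = diff2 u z + e * diff2 v z" for z
    by (simp add: diff2_def algebra_simps)
  then have "integrable (frac_measure s1 p) (\<lambda>z. \<bar>diff2 (\<lambda>x. u x + e * v x) z\<bar> powr p)"
    using integrable_abs_powr_add[of p "diff2 u" "frac_measure s1 p" "diff2 v" e] exps XD(4)[OF u] XD(4)[OF v] by simp
  then have "gag s1 p (\<lambda>x. u x + e * v x) < \<infinity>" by (subst gag_finite_iff_integrable) simp_all
  then show ?thesis using XD(2)[OF u] XD(2)[OF v] by (simp add: X_def)
qed

lemma X_scale:
  assumes u: "u \<in> X" and t: "0 < t"
  shows "(\<lambda>x. t * u x) \<in> X" "A (\<lambda>x. t * u x) = t powr p * A u" "B (\<lambda>x. t * u x) = t powr q * B u"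
    "R (\<lambda>x. t * u x) = t powr r * R u" "C (\<lambda>x. t * u x) = t powr \<sigma> * C u"
proof -
  have d: "diff2 (\<lambda>x. t * u x) z = t * diff2 u z" for z by (simp add: diff2_def algebra_simps)
  show "(\<lambda>x. t * u x) \<in> X" using X_lincomb[OF u u, of "t - 1"] by (simp add: algebra_simps)
  show "A (\<lambda>x. t * u x) = t powr p * A u" "B (\<lambda>x. t * u x) = t powr q * B u"
    "R (\<lambda>x. t * u x) = t powr r * R u" "C (\<lambda>x. t * u x) = t powr \<sigma> * C u"
    using t by (simp_all add: A_def B_def R_def C_def d abs_mult powr_mult)
qed

lemma X_abs:
  assumes u: "u \<in> X"
  shows "(\<lambda>x. \<bar>u x\<bar>) \<in> X" "A (\<lambda>x. \<bar>u x\<bar>) \<le> A u" "B (\<lambda>x. \<bar>u x\<bar>) \<le> B u"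
    "R (\<lambda>x. \<bar>u x\<bar>) = R u" "C (\<lambda>x. \<bar>u x\<bar>) = C u"
proof -
  have [measurable]: "u \<in> borel_measurable borel" by (rule XD[OF u])
  have "gag s1 p (\<lambda>x. \<bar>u x\<bar>) \<le> gag s1 p u" using exps by (intro gag_contraction_le) auto
  then have "gag s1 p (\<lambda>x. \<bar>u x\<bar>) < \<infinity>" using XD(3)[OF u] by (rule le_less_trans)
  then show x: "(\<lambda>x. \<bar>u x\<bar>) \<in> X" using XD(2)[OF u] by (auto simp: X_def)
  have d: "\<bar>diff2 (\<lambda>x. \<bar>u x\<bar>) z\<bar> \<le> \<bar>diff2 u z\<bar>" for z by (simp add: diff2_def)
  show "A (\<lambda>x. \<bar>u x\<bar>) \<le> A u" unfolding A_def
    using XD(4)[OF u] XD(4)[OF x] d exps by (intro integral_mono powr_mono2) auto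
  show "B (\<lambda>x. \<bar>u x\<bar>) \<le> B u" unfolding B_def
    using X_gag_lower(2)[OF u] X_gag_lower(2)[OF x] d exps by (intro integral_mono powr_mono2) auto
qed (simp_all add: R_def C_def)

lemma X_bump: "\<exists>u\<in>X. 0 < R u"
proof -
  obtain x0 where x0: "x0 \<in> \<Omega>" using nonempty_\<Omega> by blast
  obtain d where d: "0 < d" "ball x0 d \<subseteq> \<Omega>" using open_\<Omega> x0 open_contains_ball by blast
  \<comment> \<open>The test function is a cone of height \<rho>: \<open>\<rho> \<le> d\<close>
    keeps it zero off \<Omega>, and \<open>\<rho> \<le> 1\<close> bounds its oscillation by 1, as
    \<open>gag_finite_lipschitz\<close> asks.\<close>
  define \<rho> where "\<rho> = min d 1"
  define u where "u x = max 0 (\<rho> - norm (x - x0))" for x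
  have \<rho>: "0 < \<rho>" "\<rho> \<le> 1" "\<rho> \<le> d" using d by (auto simp: \<rho>_def)
  have um[measurable]: "u \<in> borel_measurable borel" unfolding u_def by measurable
  have off: "u x = 0" if "x \<notin> \<Omega>" for x
  proof -
    have "x \<notin> ball x0 d" using that d by auto
    then show ?thesis using \<rho> by (simp add: u_def dist_norm norm_minus_commute)
  qed
  have u01: "0 \<le> u x" "u x \<le> 1" for x using \<rho> norm_ge_zero[of "x - x0"] unfolding u_def by linarith+
  have lip: "\<bar>u x - u y\<bar> \<le> norm (x - y)" for x y
  proof -
    have "\<bar>norm (x - x0) - norm (y - x0)\<bar> \<le> norm (x - y)"
      using norm_triangle_ineq3[of "x - x0" "y - x0"] by simp
    then show ?thesis unfolding u_def by (auto simp: max_def abs_if split: if_splits)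
  qed
  have bd: "\<bar>u x - u y\<bar> \<le> 1" for x y using u01[of x] u01[of y] by (simp add: abs_if)
  have "gag s1 p u < \<infinity>"
    using s exps by (intro gag_finite_lipschitz[OF um \<Omega>_borel \<Omega>_finite off lip bd]) auto
  then have X: "u \<in> X" using off by (simp add: X_def)
  have "R u \<noteq> 0"
  proof
    assume "R u = 0"
    then have "AE x in lborel. \<bar>u x\<bar> powr r = 0"
      unfolding R_def using X_integrable_powr(1)[OF X, of r] exps by (subst (asm) integral_nonneg_eq_0_iff_AE) auto
    then have "AE x in lborel. x \<notin> ball x0 \<rho>"
      by eventually_elim (auto simp: u_def dist_norm norm_minus_commute max_def split: if_splits)
    then have "emeasure lborel (ball x0 \<rho>) = 0" by (subst (asm) AE_iff_measurable[of "ball x0 \<rho>"]) auto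
    then have "ennreal (unit_ball_vol (real DIM('a)) * \<rho> ^ DIM('a)) = 0"
      using emeasure_ball[of \<rho> x0] \<rho> by (metis less_imp_le)
    moreover have "0 < unit_ball_vol (real DIM('a)) * \<rho> ^ DIM('a)" using \<rho> by simp
    ultimately show False unfolding ennreal_eq_0_iff by linarith
  qed
  then show ?thesis using X functional_nonneg[of u] by (intro bexI[of _ u]) auto
qed

end

section \<open>Projection onto the Nehari manifold and minimisation\<close>

context pq_problem
begin

definition "fiber \<theta> u = fib p q r \<sigma> (A u) (B u) (\<theta> * R u) (C u)"
definition "energy \<theta> u = fib_energy p q r \<sigma> (A u) (B u) (\<theta> * R u) (C u) 1"
text \<open>\<open>0 < R u\<close> expresses that \<open>u\<close> is not almost everywhere zero, in
  the form that the fibering lemmas ask of the coefficient of \<open>t powr r\<close>.\<close>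

definition "nehari \<theta> = {u \<in> X. 0 < R u \<and> fiber \<theta> u 1 = 0}"

lemma A_pos: "u \<in> X \<Longrightarrow> 0 < R u \<Longrightarrow> 0 < A u"
  using A_zero_imp_R_zero[of u] functional_nonneg(1)[of u] by fastforce

lemma energy_eq: "energy \<theta> u = A u / p + B u / q - \<theta> * R u / r - C u / \<sigma>"
  by (simp add: energy_def fib_energy_def)

lemma fiber_1: "fiber \<theta> u 1 = A u + B u - \<theta> * R u - C u"
  by (simp add: fiber_def fib_def)

text \<open>The Nehari identity eliminates one functional. Without \<open>R\<close> the energy
  bounds \<open>A\<close> and \<open>B\<close>; without \<open>A\<close> it is, for positive
  \<theta>, increasing in \<open>B\<close>, \<open>R\<close> and \<open>C\<close>, which suits
  scaling down and passing to the limit.\<close>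

lemma nehari_energy:
  assumes "u \<in> nehari \<theta>"
  shows "energy \<theta> u = (1/p - 1/r) * A u + (1/q - 1/r) * B u + (1/r - 1/\<sigma>) * C u" (is ?e1)
    and "energy \<theta> u = (1/q - 1/p) * B u + \<theta> * (1/p - 1/r) * R u + (1/p - 1/\<sigma>) * C u" (is ?e2)
proof -
  have "A u + B u - \<theta> * R u - C u = 0" using assms by (simp add: nehari_def fiber_1)
  then have 1: "\<theta> * R u = A u + B u - C u" "A u = \<theta> * R u + C u - B u" by auto
  show ?e1 unfolding energy_eq 1(1) by (simp add: algebra_simps add_divide_distrib diff_divide_distrib)
  show ?e2 unfolding energy_eq by (subst 1(2)) (simp add: algebra_simps add_divide_distrib diff_divide_distrib)
qed

lemma nehari_scale:
  assumes u: "u \<in> X" "0 < R u" and t: "0 < t" and F: "fiber \<theta> u t = 0"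
  shows "(\<lambda>x. t * u x) \<in> nehari \<theta>"
    and "energy \<theta> (\<lambda>x. t * u x) = fib_energy p q r \<sigma> (A u) (B u) (\<theta> * R u) (C u) t"
proof -
  show "(\<lambda>x. t * u x) \<in> nehari \<theta>"
    using F X_scale[OF u(1) t] t u by (simp add: nehari_def fiber_1) (simp add: fiber_def fib_def algebra_simps)
  show "energy \<theta> (\<lambda>x. t * u x) = fib_energy p q r \<sigma> (A u) (B u) (\<theta> * R u) (C u) t"
    using X_scale[OF u(1) t] by (simp add: energy_eq fib_energy_def mult_ac)
qed

lemma exponent_gaps: "0 < 1/p - 1/r" "0 < 1/q - 1/r" "0 < 1/r - 1/\<sigma>" "0 < 1/q - 1/p" "0 < 1/p - 1/\<sigma>"
  using exps by (simp_all add: frac_less2)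

text \<open>The projection time is at most 1, so each term of the energy in the form without
  \<open>A\<close> can only decrease. This serves both for \<open>\<bar>u x\<bar>\<close> and for
  the limit of a minimising sequence.\<close>

lemma nehari_below:
  assumes u: "u \<in> X" "0 < R u" and F: "fiber \<theta> u 1 \<le> 0" and \<theta>: "0 < \<theta>"
  shows "\<exists>t>0. (\<lambda>x. t * u x) \<in> nehari \<theta> \<and>
    energy \<theta> (\<lambda>x. t * u x) \<le> (1/q - 1/p) * B u + \<theta> * (1/p - 1/r) * R u + (1/p - 1/\<sigma>) * C u"
proof -
  obtain t where t: "0 < t" "t \<le> 1" "fiber \<theta> u t = 0"
    using fib_zero_below[of q p r \<sigma> "A u" "B u" 1 "\<theta> * R u" "C u"] A_pos[OF u] functional_nonneg[of u] exps F
    unfolding fiber_def by auto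
  have N: "(\<lambda>x. t * u x) \<in> nehari \<theta>" by (rule nehari_scale[OF u t(1,3)])
  have tp: "t powr a * b \<le> b" if "0 < a" "0 \<le> b" for a b
    using t powr_mono2[of a t 1] that mult_right_mono[of "t powr a" 1 b] by simp
  have "energy \<theta> (\<lambda>x. t * u x) = (1/q - 1/p) * (t powr q * B u) + \<theta> * (1/p - 1/r) * (t powr r * R u) + (1/p - 1/\<sigma>) * (t powr \<sigma> * C u)"
    using nehari_energy(2)[OF N] X_scale[OF u(1) t(1)] by simp
  also have "\<dots> \<le> (1/q - 1/p) * B u + \<theta> * (1/p - 1/r) * R u + (1/p - 1/\<sigma>) * C u"
    using exponent_gaps \<theta> functional_nonneg[of u] exps by (intro add_mono mult_left_mono tp) auto
  finally show ?thesis using t N by blast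
qed

text \<open>Used on the minimising sequence rather than on a minimiser, so that the almost
  everywhere limit inherits the sign.\<close>

lemma nehari_nonneg_competitor:
  assumes u: "u \<in> nehari \<theta>" and \<theta>: "0 < \<theta>"
  shows "\<exists>v\<in>nehari \<theta>. (\<forall>x. 0 \<le> v x) \<and> energy \<theta> v \<le> energy \<theta> u"
proof -
  have uX: "u \<in> X" "0 < R u" "fiber \<theta> u 1 = 0" using u by (auto simp: nehari_def)
  note ab = X_abs[OF uX(1)]
  have "fiber \<theta> (\<lambda>x. \<bar>u x\<bar>) 1 \<le> 0" using uX(3) ab unfolding fiber_1 by simp
  then obtain t where t: "0 < t" "(\<lambda>x. t * \<bar>u x\<bar>) \<in> nehari \<theta>"
     "energy \<theta> (\<lambda>x. t * \<bar>u x\<bar>) \<le> (1/q - 1/p) * B (\<lambda>x. \<bar>u x\<bar>) + \<theta> * (1/p - 1/r) * R u + (1/p - 1/\<sigma>) * C u"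
    using nehari_below[OF ab(1)] uX ab \<theta> by auto
  have "(1/q - 1/p) * B (\<lambda>x. \<bar>u x\<bar>) \<le> (1/q - 1/p) * B u"
    using ab(3) exponent_gaps by (intro mult_left_mono) auto
  then have "energy \<theta> (\<lambda>x. t * \<bar>u x\<bar>) \<le> energy \<theta> u"
    using t(3) nehari_energy(2)[OF u] by simp
  with t show ?thesis by (intro bexI[of _ "\<lambda>x. t * \<bar>u x\<bar>"]) auto
qed

text \<open>One fixed bump is projected for every \<theta>. As \<theta> grows, its projection time
  \<open>t\<close> falls below a prescribed \<open>d\<close>, and the projected energy is at most
  \<open>A u * t powr p + B u * t powr q\<close>.\<close>

lemma nehari_energy_small:
  assumes \<epsilon>: "0 < \<epsilon>"
  shows "\<exists>\<theta>s>0. \<forall>\<theta>>\<theta>s. \<exists>u\<in>nehari \<theta>. energy \<theta> u < \<epsilon>"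
proof -
  obtain u where u: "u \<in> X" "0 < R u" using X_bump by blast
  have A: "0 < A u" by (rule A_pos[OF u])
  have "((\<lambda>t. A u * t powr p + B u * t powr q) \<longlongrightarrow> A u * 0 + B u * 0) (at_right 0)"
  proof -
    have z: "((\<lambda>x. x powr a) \<longlongrightarrow> 0) (at_right (0::real))" if "a > 0" for a
      using that by real_asymp
    show ?thesis using exps by (intro tendsto_intros z) auto
  qed
  then have "eventually (\<lambda>t. A u * t powr p + B u * t powr q < \<epsilon>) (at_right 0)"
    using \<epsilon> by (intro order_tendstoD) auto
  then have "eventually (\<lambda>t. A u * t powr p + B u * t powr q < \<epsilon> \<and> 0 < t) (at_right 0)"
    using eventually_at_right_less by eventually_elim auto
  from eventually_happens'[OF trivial_limit_at_right_real this]
  obtain d where d: "A u * d powr p + B u * d powr q < \<epsilon>" "0 < d" by blast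
  \<comment> \<open>If \<open>d \<le> t\<close>, the Nehari identity divided by
    \<open>t powr r\<close> would give \<open>\<theta> * R u \<le> A u * d powr (p - r) + B u * d
    powr (q - r)\<close>, that is \<open>\<theta> \<le> \<theta>s\<close>.\<close>
  define \<theta>s where "\<theta>s = (A u * d powr (p - r) + B u * d powr (q - r)) / R u"
  show ?thesis
  proof (intro exI[of _ \<theta>s] conjI allI impI)
    show s0: "0 < \<theta>s" unfolding \<theta>s_def using A d u functional_nonneg[of u]
      by (intro divide_pos_pos add_pos_nonneg mult_pos_pos) auto
    fix \<theta> assume \<theta>: "\<theta>s < \<theta>"
    then have \<theta>0: "0 < \<theta>" using s0 by simp
    obtain t where t: "0 < t" "fiber \<theta> u t = 0"
      using fib_zero_exists[of q p r \<sigma> "A u" "B u" "\<theta> * R u" "C u"] exps A functional_nonneg[of u] \<theta>0 u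
      unfolding fiber_def by auto
    have "t < d"
    proof (rule ccontr)
      assume "\<not> t < d"
      then have dt: "d \<le> t" by simp
      have "\<theta> * R u * t powr r \<le> A u * t powr p + B u * t powr q"
        using t functional_nonneg[of u] unfolding fiber_def fib_def by (simp add: algebra_simps)
      then have "\<theta> * R u * t powr r * t powr (-r) \<le> (A u * t powr p + B u * t powr q) * t powr (-r)"
        by (intro mult_right_mono) auto
      also have "\<dots> = A u * t powr (p - r) + B u * t powr (q - r)"
        by (simp add: distrib_right mult.assoc flip: powr_add)
      also have "\<dots> \<le> A u * d powr (p - r) + B u * d powr (q - r)"
        using dt d exps functional_nonneg[of u] by (intro add_mono mult_left_mono powr_mono2') auto
      also have "\<dots> = \<theta>s * R u" using u by (simp add: \<theta>s_def)
      also have "\<theta> * R u * t powr r * t powr (-r) = \<theta> * R u" using t by (simp add: powr_minus)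
      finally show False using \<theta> u by simp
    qed
    have "energy \<theta> (\<lambda>x. t * u x) = fib_energy p q r \<sigma> (A u) (B u) (\<theta> * R u) (C u) t"
      by (rule nehari_scale[OF u t])
    also have "\<dots> \<le> A u / p * t powr p + B u / q * t powr q"
    proof -
      have "0 \<le> \<theta> * R u / r * t powr r" "0 \<le> C u / \<sigma> * t powr \<sigma>"
        using \<theta>0 functional_nonneg[of u] exps by auto
      then show ?thesis unfolding fib_energy_def by linarith
    qed
    also have "\<dots> \<le> A u * t powr p + B u * t powr q"
      using functional_nonneg[of u] exps by (intro add_mono mult_right_mono) (auto simp: divide_le_eq mult_le_cancel_left1)
    also have "\<dots> \<le> A u * d powr p + B u * d powr q"
      using t \<open>t < d\<close> functional_nonneg[of u] exps by (intro add_mono mult_left_mono powr_mono2) auto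
    also have "\<dots> < \<epsilon>" by (rule d)
    finally show "\<exists>u\<in>nehari \<theta>. energy \<theta> u < \<epsilon>" using nehari_scale(1)[OF u t] by blast
  qed
qed

text \<open>Below the compactness threshold the critical term is dominated by half of the Gagliardo
  energy, both along a minimising sequence and, by Brezis--Lieb, for its differences from the limit.\<close>

lemma nehari_minimizer:
  "\<exists>\<epsilon>>0. \<forall>\<theta>>0. (\<exists>u\<in>nehari \<theta>. energy \<theta> u < \<epsilon>) \<longrightarrow>
     (\<exists>u\<in>nehari \<theta>. (AE x in lborel. 0 \<le> u x) \<and> (\<forall>v\<in>nehari \<theta>. energy \<theta> u \<le> energy \<theta> v))"
proof -
  obtain K where K: "K > 0" "\<And>u. u \<in> X \<Longrightarrow> C u \<le> K * A u powr (\<sigma> / p)" using sobolev by blast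
  obtain K' where K': "K' > 0" "\<And>u. u \<in> X \<Longrightarrow> R u \<le> K' * A u powr (r / p)" using R_le_A_powr by blast
  obtain \<rho> where \<rho>: "0 < \<rho>" "\<And>x. 0 \<le> x \<Longrightarrow> x \<le> \<rho> \<Longrightarrow> K * x powr (\<sigma> / p) \<le> x / 2"
    using powr_small_le_half[OF K(1), of "\<sigma> / p"] exps by auto
  have CA: "C u \<le> A u / 2" if "u \<in> X" "A u \<le> \<rho>" for u
    using K(2)[OF that(1)] \<rho>(2)[of "A u"] that functional_nonneg[of u] by linarith
  \<comment> \<open>Energy below this value forces \<open>A \<le> \<rho> / 2\<close> by the form
    without \<open>R\<close>. The other half of \<rho> is room for the differences from the limit,
    for which the bound holds only asymptotically.\<close>
  define \<epsilon> where "\<epsilon> = (1/p - 1/r) * (\<rho> / 2)"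
  show ?thesis
  proof (intro exI[of _ \<epsilon>] conjI allI impI)
    show \<epsilon>: "0 < \<epsilon>" using \<rho> exponent_gaps by (simp add: \<epsilon>_def)
    fix \<theta> :: real assume \<theta>: "0 < \<theta>" and "\<exists>u\<in>nehari \<theta>. energy \<theta> u < \<epsilon>"
    then obtain u0 where u0: "u0 \<in> nehari \<theta>" "energy \<theta> u0 < \<epsilon>" by blast
    have E0: "0 \<le> energy \<theta> u" if "u \<in> nehari \<theta>" for u
      unfolding nehari_energy(1)[OF that] using exponent_gaps functional_nonneg[of u]
      by (intro add_nonneg_nonneg mult_nonneg_nonneg) auto
    define c where "c = (INF u\<in>nehari \<theta>. energy \<theta> u)"
    have bdd: "bdd_below (energy \<theta> ` nehari \<theta>)" using E0 by (intro bdd_belowI[of _ 0]) auto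
    have c_le: "c \<le> energy \<theta> u" if "u \<in> nehari \<theta>" for u
      unfolding c_def using bdd that by (rule cINF_lower)
    have "\<exists>v\<in>nehari \<theta>. (\<forall>x. 0 \<le> v x) \<and> energy \<theta> v < \<epsilon> \<and> energy \<theta> v < c + 1 / Suc n" for n
    proof -
      have "c < min \<epsilon> (c + 1 / Suc n)" using c_le[OF u0(1)] u0(2) by simp
      then obtain w where w: "w \<in> nehari \<theta>" "energy \<theta> w < min \<epsilon> (c + 1 / Suc n)"
        unfolding c_def using u0 bdd by (subst (asm) cINF_less_iff) auto
      from nehari_nonneg_competitor[OF w(1) \<theta>]
      obtain v where "v \<in> nehari \<theta>" "\<forall>x. 0 \<le> v x" "energy \<theta> v \<le> energy \<theta> w" by blast
      then show ?thesis using w(2) by (intro bexI[of _ v]) auto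
    qed
    then obtain v where v: "\<And>n. v n \<in> nehari \<theta>" "\<And>n x. 0 \<le> v n x" "\<And>n. energy \<theta> (v n) < \<epsilon>" "\<And>n. energy \<theta> (v n) < c + 1 / Suc n"
      by metis
    have vX: "v n \<in> X" "0 < R (v n)" "fiber \<theta> (v n) 1 = 0" for n using v(1)[of n] by (auto simp: nehari_def)
    have vA: "A (v n) \<le> \<rho> / 2" for n
    proof -
      have "(1/p - 1/r) * A (v n) \<le> energy \<theta> (v n)"
        unfolding nehari_energy(1)[OF v(1)] using exponent_gaps functional_nonneg[of "v n"] by simp
      also have "\<dots> < (1/p - 1/r) * (\<rho> / 2)" using v(3) by (simp add: \<epsilon>_def)
      finally show ?thesis using exponent_gaps by (subst (asm) mult_less_cancel_left_pos) auto
    qed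
    have vC: "C (v n) \<le> A (v n) / 2" for n using CA[OF vX(1)] vA[of n] \<rho> by simp
    define MB where "MB = \<epsilon> / (1/q - 1/r)"
    have vB: "B (v n) \<le> MB" for n
    proof -
      have "(1/q - 1/r) * B (v n) \<le> energy \<theta> (v n)"
        unfolding nehari_energy(1)[OF v(1)] using exponent_gaps functional_nonneg[of "v n"] by simp
      also have "\<dots> \<le> \<epsilon>" using v(3)[of n] by simp
      finally show ?thesis unfolding MB_def using exponent_gaps by (simp add: pos_le_divide_eq mult.commute)
    qed
    \<comment> \<open>From \<open>A \<le> 2 * \<theta> * R \<le> 2 * \<theta> * K' * A powr (r /
      p)\<close> and \<open>p < r\<close>, this constant bounds \<open>A\<close> from below along
      the sequence. The resulting bound for \<open>R\<close> survives the limit and makes it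
      nontrivial.\<close>
    define a0 where "a0 = (1 / (2 * \<theta> * K')) powr (1 / (r / p - 1))"
    have vR: "a0 / (2 * \<theta>) \<le> R (v n)" for n
    proof -
      have Apos: "0 < A (v n)" by (rule A_pos[OF vX(1,2)])
      have "A (v n) \<le> \<theta> * R (v n) + A (v n) / 2"
        using vX(3)[of n] vC[of n] functional_nonneg[of "v n"] unfolding fiber_1 by simp
      then have 1: "A (v n) \<le> 2 * \<theta> * R (v n)" by simp
      also have "\<dots> \<le> 2 * \<theta> * (K' * A (v n) powr (r / p))" using K'(2)[OF vX(1)] \<theta> by (intro mult_left_mono) auto
      finally have "A (v n) * A (v n) powr (-1) \<le> 2 * \<theta> * (K' * A (v n) powr (r / p)) * A (v n) powr (-1)"
        by (intro mult_right_mono) auto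
      moreover have "A (v n) * A (v n) powr (-1) = 1" using Apos by (simp add: powr_minus)
      moreover have "2 * \<theta> * (K' * A (v n) powr (r / p)) * A (v n) powr (-1) = 2 * \<theta> * K' * A (v n) powr (r / p - 1)"
        using powr_add[of "A (v n)" "r / p" "-1"] by simp
      ultimately have "1 / (2 * \<theta> * K') \<le> A (v n) powr (r / p - 1)"
        using \<theta> K' by (simp add: field_simps)
      then have "a0 \<le> (A (v n) powr (r / p - 1)) powr (1 / (r / p - 1))"
        unfolding a0_def using exps \<theta> K' by (intro powr_mono2) auto
      also have "\<dots> = A (v n)" using exps Apos by (simp add: powr_powr)
      finally show ?thesis using 1 \<theta> by (simp add: field_simps)
    qed
    have a0: "0 < a0" using \<theta> K' by (simp add: a0_def)
    have vm[measurable]: "v n \<in> borel_measurable borel" for n by (rule XD[OF vX(1)])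
    \<comment> \<open>Interpolation with exponent 1 and level 1, together with
      \<open>C \<le> A / 2 \<le> \<rho> / 4\<close>, gives the \<open>L^1\<close> bound for
      \<open>gag_compactness\<close>.\<close>
    have vi: "integrable lborel (v n)" "(\<integral>x. \<bar>v n x\<bar> \<partial>lborel) \<le> measure lborel \<Omega> + \<rho> / 4" for n
    proof -
      show "integrable lborel (v n)" using X_integrable_powr(1)[OF vX(1), of 1 n] exps v(2) by simp
      show "(\<integral>x. \<bar>v n x\<bar> \<partial>lborel) \<le> measure lborel \<Omega> + \<rho> / 4"
        using X_integrable_powr(2)[OF vX(1), of 1 1 n] exps vC[of n] vA[of n] by simp
    qed
    have vg: "gag s1 p (v n) \<le> ennreal (\<rho> / 2)" for n
      unfolding XD(5)[OF vX(1)] using vA by (rule ennreal_leI)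
    obtain k w where k: "strict_mono (k :: nat \<Rightarrow> nat)" and wm[measurable]: "w \<in> borel_measurable borel"
      and w0: "\<And>x. x \<notin> \<Omega> \<Longrightarrow> w x = 0" and wl: "AE x in lborel. (\<lambda>n. v (k n) x) \<longlonglongrightarrow> w x"
      using gag_compactness[of \<Omega> s1 p v, OF \<Omega>_borel \<Omega>_finite exps(9) less_imp_le[OF exps(7)] vm XD(2)[OF vX(1)] vi vg]
      by blast
    define f where "f n = v (k n)" for n
    have [measurable]: "f n \<in> borel_measurable borel" for n by (simp add: f_def)
    have fX: "f n \<in> X" for n by (simp add: f_def vX)
    have fl: "AE x in lborel. (\<lambda>n. f n x) \<longlonglongrightarrow> w x" using wl by (simp add: f_def)
    have dl: "AE z in frac_measure a b. (\<lambda>n. diff2 (f n) z) \<longlonglongrightarrow> diff2 w z" for a b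
      by (rule AE_frac_measure, use AE_lborel_fst_snd[OF fl] in eventually_elim)
        (auto simp: diff2_def intro!: tendsto_diff)
    have fA: "(\<integral>z. \<bar>diff2 (f n) z\<bar> powr p \<partial>frac_measure s1 p) \<le> \<rho> / 2" for n
      using vA by (simp add: A_def f_def)
    have fB: "(\<integral>z. \<bar>diff2 (f n) z\<bar> powr q \<partial>frac_measure s2 q) \<le> MB" for n
      using vB by (simp add: B_def f_def)
    have fC: "(\<integral>x. \<bar>f n x\<bar> powr \<sigma> \<partial>lborel) \<le> \<rho> / 4" for n
      using vC[of "k n"] vA[of "k n"] by (simp add: C_def f_def)
    have "integrable (frac_measure s1 p) (\<lambda>z. \<bar>diff2 w z\<bar> powr p)"
      by (rule integrable_abs_powr_limit(1)[OF _ _ dl _ XD(4)[OF fX] fA]) (use exps in auto)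
    then have "gag s1 p w < \<infinity>" by (subst gag_finite_iff_integrable) simp_all
    then have wX: "w \<in> X" using w0 by (simp add: X_def)
    define h where "h n x = f n x - w x" for n x
    have hX: "h n \<in> X" for n using X_lincomb[OF fX wX, of n "-1"] by (simp add: h_def[abs_def])
    have dh: "diff2 (h n) z = diff2 (f n) z - diff2 w z" for n z by (simp add: diff2_def h_def)
    have limA: "(\<lambda>n. A (f n) - A (h n)) \<longlonglongrightarrow> A w"
      unfolding A_def dh by (rule brezis_lieb[OF _ _ dl _ XD(4)[OF fX] fA]) (use exps in auto)
    have limB: "(\<lambda>n. B (f n) - B (h n)) \<longlonglongrightarrow> B w"
      unfolding B_def dh by (rule brezis_lieb[OF _ _ dl _ X_gag_lower(2)[OF fX] fB]) (use exps in auto)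
    have limC: "(\<lambda>n. C (f n) - C (h n)) \<longlonglongrightarrow> C w"
      unfolding C_def h_def by (rule brezis_lieb[OF _ _ fl _ X_integrable_crit[OF fX] fC]) (use exps in auto)
    have limR: "(\<lambda>n. R (f n)) \<longlonglongrightarrow> R w"
      unfolding R_def
      by (rule integral_subcritical_tendsto[OF _ _ fl _ _ X_integrable_crit[OF fX] fC, of r \<Omega>])
        (use exps \<Omega>_finite XD(2)[OF fX] X_integrable_powr(1)[OF fX] X_integrable_powr(1)[OF wX] in auto)
    \<comment> \<open>Since \<open>0 \<le> A w\<close>, eventually
      \<open>A (h n) \<le> A (f n) + \<rho> / 2 \<le> \<rho>\<close>, so that \<open>CA\<close>
      applies to the differences as well.\<close>
    have "eventually (\<lambda>n. - (\<rho> / 2) < A (f n) - A (h n)) sequentially"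
      using limA functional_nonneg[of w] \<rho> by (intro order_tendstoD) auto
    \<comment> \<open>The left-hand side is the Nehari identity of \<open>f n\<close> minus
      \<open>A (h n) + B (h n) - C (h n)\<close>, and the latter is nonnegative.\<close>
    then have ev: "eventually (\<lambda>n. (A (f n) - A (h n)) + (B (f n) - B (h n)) - \<theta> * R (f n) - (C (f n) - C (h n)) \<le> 0) sequentially"
    proof eventually_elim
      case (elim n)
      then have "A (h n) \<le> \<rho>" using vA[of "k n"] by (simp add: f_def)
      then have "C (h n) \<le> A (h n) / 2" by (rule CA[OF hX])
      moreover have "A (f n) + B (f n) - \<theta> * R (f n) - C (f n) = 0"
        using vX(3)[of "k n"] by (simp add: f_def fiber_1)
      ultimately show ?case using functional_nonneg[of "h n"] by simp
    qed
    have "(\<lambda>n. (A (f n) - A (h n)) + (B (f n) - B (h n)) - \<theta> * R (f n) - (C (f n) - C (h n))) \<longlonglongrightarrow> A w + B w - \<theta> * R w - C w"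
      by (intro tendsto_intros limA limB limC limR)
    then have F: "fiber \<theta> w 1 \<le> 0" unfolding fiber_1
      using ev by (intro tendsto_upperbound) auto
    have "a0 / (2 * \<theta>) \<le> R w"
      by (rule LIMSEQ_le_const[OF limR]) (use vR in \<open>auto simp: f_def\<close>)
    then have Rw: "0 < R w" using a0 \<theta> by (auto intro: less_le_trans[rotated])
    obtain t where t: "t > 0" "(\<lambda>x. t * w x) \<in> nehari \<theta>"
      "energy \<theta> (\<lambda>x. t * w x) \<le> (1/q - 1/p) * B w + \<theta> * (1/p - 1/r) * R w + (1/p - 1/\<sigma>) * C w"
      using nehari_below[OF wX Rw F \<theta>] by blast
    \<comment> \<open>In the form without \<open>A\<close>, dropping the nonnegative
      \<open>B (h n)\<close> and \<open>C (h n)\<close> only raises the value back to the energy of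
      \<open>f n\<close>, which tends to \<open>c\<close>.\<close>
    have "(1/q - 1/p) * B w + \<theta> * (1/p - 1/r) * R w + (1/p - 1/\<sigma>) * C w \<le> c"
    proof (rule LIMSEQ_le)
      show "(\<lambda>n. (1/q - 1/p) * (B (f n) - B (h n)) + \<theta> * (1/p - 1/r) * R (f n) + (1/p - 1/\<sigma>) * (C (f n) - C (h n)))
        \<longlonglongrightarrow> (1/q - 1/p) * B w + \<theta> * (1/p - 1/r) * R w + (1/p - 1/\<sigma>) * C w"
        by (intro tendsto_intros limB limC limR)
      show "(\<lambda>n. c + inverse (real (Suc n))) \<longlonglongrightarrow> c"
        using tendsto_add[OF tendsto_const[of c] LIMSEQ_inverse_real_of_nat] by simp
      have "(1/q - 1/p) * (B (f n) - B (h n)) + \<theta> * (1/p - 1/r) * R (f n) + (1/p - 1/\<sigma>) * (C (f n) - C (h n))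
         \<le> c + inverse (real (Suc n))" for n
      proof -
        have "(1/q - 1/p) * (B (f n) - B (h n)) + \<theta> * (1/p - 1/r) * R (f n) + (1/p - 1/\<sigma>) * (C (f n) - C (h n))
          \<le> (1/q - 1/p) * B (f n) + \<theta> * (1/p - 1/r) * R (f n) + (1/p - 1/\<sigma>) * C (f n)"
          using functional_nonneg[of "h n"] exponent_gaps \<theta> by (intro add_mono mult_left_mono mult_nonneg_nonneg) auto
        also have "\<dots> = energy \<theta> (f n)" unfolding f_def by (rule nehari_energy(2)[OF v(1), symmetric])
        also have "\<dots> \<le> c + 1 / Suc (k n)" unfolding f_def using v(4)[of "k n"] by simp
        also have "\<dots> \<le> c + 1 / Suc n" using seq_suble[OF k, of n] by (intro add_left_mono divide_left_mono) auto
        finally show ?thesis by (simp add: inverse_eq_divide)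
      qed
      then show "\<exists>N. \<forall>n\<ge>N. (1/q - 1/p) * (B (f n) - B (h n)) + \<theta> * (1/p - 1/r) * R (f n) + (1/p - 1/\<sigma>) * (C (f n) - C (h n))
         \<le> c + inverse (real (Suc n))" by blast
    qed
    then have wmin: "energy \<theta> (\<lambda>x. t * w x) \<le> energy \<theta> u" if "u \<in> nehari \<theta>" for u
      using t(3) c_le[OF that] by simp
    have wnn: "AE x in lborel. 0 \<le> t * w x" using fl
    proof eventually_elim
      case (elim x)
      have "0 \<le> w x" by (rule LIMSEQ_le_const[OF elim]) (use v(2) in \<open>auto simp: f_def\<close>)
      then show ?case using t by simp
    qed
    show "\<exists>u\<in>nehari \<theta>. (AE x in lborel. 0 \<le> u x) \<and> (\<forall>v\<in>nehari \<theta>. energy \<theta> u \<le> energy \<theta> v)"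
      by (intro bexI[of _ "\<lambda>x. t * w x"] conjI ballI wnn t(2)) (rule wmin)
  qed
qed

section \<open>The Euler--Lagrange equation\<close>

lemma minimizer_one_sided:
  assumes u: "u \<in> nehari \<theta>" and min: "\<And>v. v \<in> nehari \<theta> \<Longrightarrow> energy \<theta> u \<le> energy \<theta> v"
    and \<theta>: "0 < \<theta>" and \<phi>: "\<phi> \<in> X"
  shows "0 \<le> (\<integral>z. \<bar>diff2 u z\<bar> powr (p - 2) * diff2 u z * diff2 \<phi> z \<partial>frac_measure s1 p)
      + (\<integral>z. \<bar>diff2 u z\<bar> powr (q - 2) * diff2 u z * diff2 \<phi> z \<partial>frac_measure s2 q)
      - \<theta> * (\<integral>x. \<bar>u x\<bar> powr (r - 2) * u x * \<phi> x \<partial>lborel)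
      - (\<integral>x. \<bar>u x\<bar> powr (\<sigma> - 2) * u x * \<phi> x \<partial>lborel)" (is "0 \<le> ?I1 + ?I2 - \<theta> * ?I3 - ?I4")
proof -
  have uX: "u \<in> X" "0 < R u" "fiber \<theta> u 1 = 0" using u by (auto simp: nehari_def)
  have [measurable]: "u \<in> borel_measurable borel" "\<phi> \<in> borel_measurable borel"
    using XD(1)[OF uX(1)] XD(1)[OF \<phi>] by auto
  have d: "diff2 (\<lambda>x. u x + e * \<phi> x) z = diff2 u z + e * diff2 \<phi> z" for e z
    by (simp add: diff2_def algebra_simps)
  let ?w = "\<lambda>e x. u x + e * \<phi> x"
  have w0: "?w 0 = u" by simp
  have dA: "((\<lambda>e. A (?w e)) has_real_derivative p * ?I1) (at 0)"
    unfolding A_def d using exps XD(4)[OF uX(1)] XD(4)[OF \<phi>] by (intro integral_abs_powr_deriv(2)) auto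
  have dB: "((\<lambda>e. B (?w e)) has_real_derivative q * ?I2) (at 0)"
    unfolding B_def d using exps X_gag_lower(2)[OF uX(1)] X_gag_lower(2)[OF \<phi>] by (intro integral_abs_powr_deriv(2)) auto
  have dR: "((\<lambda>e. \<theta> * R (?w e)) has_real_derivative \<theta> * (r * ?I3)) (at 0)"
    unfolding R_def using exps X_integrable_powr(1)[OF uX(1)] X_integrable_powr(1)[OF \<phi>]
    by (intro DERIV_cmult integral_abs_powr_deriv(2)) auto
  have dC: "((\<lambda>e. C (?w e)) has_real_derivative \<sigma> * ?I4) (at 0)"
    unfolding C_def using exps X_integrable_crit[OF uX(1)] X_integrable_crit[OF \<phi>]
    by (intro integral_abs_powr_deriv(2)) auto
  \<comment> \<open>The curve is \<open>u + e * \<phi>\<close>; the factors \<open>p\<close>,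
    \<open>q\<close>, \<open>r\<close>, \<open>\<sigma>\<close> from differentiating the powers
    cancel the denominators in the energy.\<close>
  have "0 \<le> p * ?I1 / p + q * ?I2 / q - \<theta> * (r * ?I3) / r - \<sigma> * ?I4 / \<sigma>"
  proof (rule nehari_one_sided_derivative[OF _ _ _ _ _ _ _ _ dA dB dR dC])
    show "fib p q r \<sigma> (A (?w 0)) (B (?w 0)) (\<theta> * R (?w 0)) (C (?w 0)) 1 = 0"
      using uX(3) by (simp add: fiber_def)
    fix e t :: real assume t: "0 < t" "0 < \<theta> * R (?w e)"
      "fib p q r \<sigma> (A (?w e)) (B (?w e)) (\<theta> * R (?w e)) (C (?w e)) t = 0"
    have "0 < R (?w e)" using t(2) \<theta> by (simp add: zero_less_mult_iff)
    note sc = nehari_scale[OF X_lincomb[OF uX(1) \<phi>] this t(1) t(3)[folded fiber_def]]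
    show "fib_energy p q r \<sigma> (A (?w 0)) (B (?w 0)) (\<theta> * R (?w 0)) (C (?w 0)) 1
      \<le> fib_energy p q r \<sigma> (A (?w e)) (B (?w e)) (\<theta> * R (?w e)) (C (?w e)) t"
      using min[OF sc(1)] unfolding sc(2) by (simp add: energy_def)
  qed (use exps functional_nonneg A_pos[OF uX(1,2)] uX(2) \<theta> in auto)
  then show ?thesis using exps by simp
qed

text \<open>The expression in \<open>minimizer_one_sided\<close> is linear in \<phi>, so its sign
  for \<phi> and for \<open>- \<phi>\<close> forces it to vanish.\<close>

lemma minimizer_euler_lagrange:
  assumes u: "u \<in> nehari \<theta>" and min: "\<And>v. v \<in> nehari \<theta> \<Longrightarrow> energy \<theta> u \<le> energy \<theta> v"
    and \<theta>: "0 < \<theta>" and \<phi>: "\<phi> \<in> X"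
  shows "(\<integral>z. \<bar>diff2 u z\<bar> powr (p - 2) * diff2 u z * diff2 \<phi> z \<partial>frac_measure s1 p)
      + (\<integral>z. \<bar>diff2 u z\<bar> powr (q - 2) * diff2 u z * diff2 \<phi> z \<partial>frac_measure s2 q)
      = \<theta> * (\<integral>x. \<bar>u x\<bar> powr (r - 2) * u x * \<phi> x \<partial>lborel)
      + (\<integral>x. \<bar>u x\<bar> powr (\<sigma> - 2) * u x * \<phi> x \<partial>lborel)"
proof -
  have m: "(\<lambda>x. - \<phi> x) \<in> X" using X_lincomb[OF \<phi> \<phi>, of "-2"] by simp
  have d: "diff2 (\<lambda>x. - \<phi> x) z = - diff2 \<phi> z" for z by (simp add: diff2_def)
  show ?thesis
    using minimizer_one_sided[OF u min \<theta> \<phi>] minimizer_one_sided[OF u min \<theta> m] by (simp add: d)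
qed

end

section \<open>Weak solutions\<close>

text \<open>Completeness of Lebesgue measure makes \<open>h\<close> measurable as soon as it agrees
  almost everywhere with a Borel function.\<close>

lemma integral_lebesgue_AE_borel:
  fixes f h :: "'b::euclidean_space \<Rightarrow> real"
  assumes f: "integrable lborel f" and ae: "AE x in lborel. h x = f x"
  shows "integrable lebesgue h" "integral\<^sup>L lebesgue h = integral\<^sup>L lborel f"
proof -
  have fm: "f \<in> borel_measurable lborel" using f by simp
  then have fL: "f \<in> borel_measurable lebesgue" by (rule measurable_completion)
  have ae': "AE x in lebesgue. f x = h x" using ae by (intro AE_completion) (auto elim: eventually_mono)
  have hL: "h \<in> borel_measurable lebesgue" by (rule borel_measurable_AE[OF fL ae'])
  have fi: "integrable lebesgue f" using f fm by (simp add: integrable_completion)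
  show "integrable lebesgue h" by (rule integrable_cong_AE_imp[OF fi hL ae'])
  have "integral\<^sup>L lebesgue h = integral\<^sup>L lebesgue f"
    using hL fL ae' by (intro integral_cong_AE) (auto elim: eventually_mono)
  then show "integral\<^sup>L lebesgue h = integral\<^sup>L lborel f" by (simp add: integral_completion[OF fm])
qed

text \<open>The nonnegative integral over the completion agrees with that over \<open>lborel\<close>
  for every integrand, so Tonelli is invoked only for the Borel function \<open>v\<close>.\<close>

lemma gagliardo_energy_eq_gag:
  fixes u v :: "'a::euclidean_space \<Rightarrow> real"
  assumes [measurable]: "v \<in> borel_measurable borel" and ae: "AE x in lborel. u x = v x"
  shows "gagliardo_energy s t u = gag s t v"
proof -
  have "gagliardo_energy s t u = (\<integral>\<^sup>+z. ennreal (\<bar>diff2 u z\<bar> powr t / norm (fst z - snd z) powr (real DIM('a) + s * t)) \<partial>lborel)"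
    unfolding gagliardo_energy_def nn_integral_completion by (simp add: diff2_def case_prod_unfold)
  also have "\<dots> = (\<integral>\<^sup>+z. ennreal (\<bar>diff2 v z\<bar> powr t / norm (fst z - snd z) powr (real DIM('a) + s * t)) \<partial>lborel)"
    by (rule nn_integral_cong_AE, use AE_lborel_fst_snd[OF ae] in eventually_elim) (simp add: diff2_def)
  also have "\<dots> = gag s t v"
    unfolding gag_def by (subst nn_integral_lborel_prod, measurable) (simp add: diff2_def)
  finally show ?thesis .
qed

text \<open>Test functions from \<open>X0\<close> are only Lebesgue measurable; \<phi> is exchanged
  for its Borel representative \<psi>, while the solution \<open>u\<close> is Borel already.\<close>

lemma frac_integrand_integral:
  fixes u \<phi> \<psi> :: "'a::euclidean_space \<Rightarrow> real"
  assumes [measurable]: "u \<in> borel_measurable borel" "\<psi> \<in> borel_measurable borel"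
    and ae: "AE x in lborel. \<phi> x = \<psi> x"
    and int: "integrable (frac_measure s t) (\<lambda>z. \<bar>diff2 u z\<bar> powr (t - 2) * diff2 u z * diff2 \<psi> z)"
  shows "integrable lebesgue (frac_integrand s t u \<phi>)"
    and "(\<integral>z. frac_integrand s t u \<phi> z \<partial>lebesgue) = (\<integral>z. \<bar>diff2 u z\<bar> powr (t - 2) * diff2 u z * diff2 \<psi> z \<partial>frac_measure s t)"
proof -
  let ?w = "\<lambda>z::'a\<times>'a. 1 / norm (fst z - snd z) powr (real DIM('a) + s * t)"
  let ?g = "\<lambda>z. \<bar>diff2 u z\<bar> powr (t - 2) * diff2 u z * diff2 \<psi> z"
  have i: "integrable lborel (\<lambda>z. ?w z *\<^sub>R ?g z)"
    using int unfolding frac_measure_def by (subst (asm) integrable_density) auto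
  have a: "AE z in lborel. frac_integrand s t u \<phi> z = ?w z *\<^sub>R ?g z"
    using AE_lborel_fst_snd[OF ae]
    by eventually_elim (simp add: frac_integrand_def case_prod_beta diff2_def mult.commute)
  show "integrable lebesgue (frac_integrand s t u \<phi>)" by (rule integral_lebesgue_AE_borel(1)[OF i a])
  have "(\<integral>z. frac_integrand s t u \<phi> z \<partial>lebesgue) = (\<integral>z. ?w z *\<^sub>R ?g z \<partial>lborel)"
    by (rule integral_lebesgue_AE_borel(2)[OF i a])
  also have "\<dots> = (\<integral>z. ?g z \<partial>frac_measure s t)"
    unfolding frac_measure_def by (subst integral_density) auto
  finally show "(\<integral>z. frac_integrand s t u \<phi> z \<partial>lebesgue) = (\<integral>z. ?g z \<partial>frac_measure s t)" .
qed

section \<open>Correspondence between \<open>X\<close> and \<open>X0\<close>, and the weak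
  formulation\<close>

context pq_problem
begin

lemma lebesgue_on_integral:
  fixes h f :: "'a \<Rightarrow> real"
  assumes f: "integrable lborel f" and ae: "AE x in lborel. h x = f x" and off: "\<And>x. x \<notin> \<Omega> \<Longrightarrow> f x = 0"
  shows "integrable (lebesgue_on \<Omega>) h" "(\<integral>x. h x \<partial>lebesgue_on \<Omega>) = (\<integral>x. f x \<partial>lborel)"
proof -
  have a: "AE x in lborel. indicator \<Omega> x *\<^sub>R h x = f x"
    using ae by eventually_elim (use off in \<open>auto simp: indicator_def\<close>)
  have s: "\<Omega> \<inter> space lebesgue \<in> sets lebesgue" by simp
  show "integrable (lebesgue_on \<Omega>) h"
    using integral_lebesgue_AE_borel(1)[OF f a] by (subst integrable_restrict_space[OF s])
  show "(\<integral>x. h x \<partial>lebesgue_on \<Omega>) = (\<integral>x. f x \<partial>lborel)"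
    using integral_lebesgue_AE_borel(2)[OF f a] by (subst integral_restrict_space[OF s])
qed

lemma X_imp_X0:
  assumes u: "u \<in> X" shows "u \<in> X0 s1 p \<Omega>"
proof -
  have [measurable]: "u \<in> borel_measurable borel" by (rule XD[OF u])
  have "u \<in> borel_measurable lborel" by simp
  then have "u \<in> borel_measurable lebesgue" by (rule measurable_completion)
  moreover have "integrable (lebesgue_on \<Omega>) (\<lambda>x. \<bar>u x\<bar> powr p)"
    using X_integrable_powr(1)[OF u, of p] exps XD(2)[OF u]
    by (intro lebesgue_on_integral(1)[where f = "\<lambda>x. \<bar>u x\<bar> powr p"]) auto
  moreover have "gagliardo_energy s1 p u < \<infinity>"
    using gagliardo_energy_eq_gag[of u u s1 p] XD(3)[OF u] by simp
  ultimately show ?thesis using XD(2)[OF u] by (simp add: X0_def gagliardo_norm_def)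
qed

text \<open>A Borel version multiplied by the indicator of \<Omega> vanishes everywhere off
  \<Omega>, as \<open>X\<close> demands, and still equals \<phi> almost everywhere.\<close>

lemma X0_representative:
  assumes \<phi>: "\<phi> \<in> X0 s1 p \<Omega>"
  shows "\<exists>\<psi>\<in>X. AE x in lborel. \<phi> x = \<psi> x"
proof -
  have \<phi>m: "\<phi> \<in> borel_measurable lebesgue" and off: "AE x in lborel. x \<notin> \<Omega> \<longrightarrow> \<phi> x = 0"
    and n: "gagliardo_norm s1 p \<phi> < \<infinity>"
    using \<phi> by (auto simp: X0_def AE_completion_iff)
  obtain g where g[measurable]: "g \<in> borel_measurable lborel" and ae: "AE x in lborel. \<phi> x = g x"
    using completion_ex_borel_measurable_real[OF \<phi>m] by blast
  have [measurable]: "g \<in> borel_measurable borel" using g by simp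
  define \<psi> where "\<psi> x = indicator \<Omega> x * g x" for x
  have [measurable]: "\<psi> \<in> borel_measurable borel" unfolding \<psi>_def by measurable
  have ae': "AE x in lborel. \<phi> x = \<psi> x" using ae off by eventually_elim (auto simp: \<psi>_def indicator_def)
  have "gagliardo_energy s1 p \<phi> < \<infinity>" using n by (auto simp: gagliardo_norm_def less_top split: if_splits)
  then have "gag s1 p \<psi> < \<infinity>" using gagliardo_energy_eq_gag[OF _ ae', of s1 p] by simp
  then have "\<psi> \<in> X" by (simp add: X_def \<psi>_def[abs_def])
  then show ?thesis using ae' by blast
qed

lemma minimizer_weak_solution:
  assumes u: "u \<in> nehari \<theta>" and min: "\<And>v. v \<in> nehari \<theta> \<Longrightarrow> energy \<theta> u \<le> energy \<theta> v" and \<theta>: "0 < \<theta>"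
  shows "weak_solution s1 s2 p q r \<theta> \<Omega> u"
  unfolding weak_solution_def
proof (intro conjI ballI)
  have uX: "u \<in> X" using u by (simp add: nehari_def)
  show "u \<in> X0 s1 p \<Omega>" by (rule X_imp_X0[OF uX])
  fix \<phi> assume "\<phi> \<in> X0 s1 p \<Omega>"
  then obtain \<psi> where \<psi>: "\<psi> \<in> X" and ae: "AE x in lborel. \<phi> x = \<psi> x" using X0_representative by blast
  note um[measurable] = XD(1)[OF uX] and \<psi>m[measurable] = XD(1)[OF \<psi>]
  have 1: "integrable (frac_measure s1 p) (\<lambda>z. \<bar>diff2 u z\<bar> powr (p - 2) * diff2 u z * diff2 \<psi> z)"
    using exps XD(4)[OF uX] XD(4)[OF \<psi>] by (intro integral_abs_powr_deriv(1)) auto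
  have 2: "integrable (frac_measure s2 q) (\<lambda>z. \<bar>diff2 u z\<bar> powr (q - 2) * diff2 u z * diff2 \<psi> z)"
    using exps X_gag_lower(2)[OF uX] X_gag_lower(2)[OF \<psi>] by (intro integral_abs_powr_deriv(1)) auto
  have 3: "integrable lborel (\<lambda>x. \<bar>u x\<bar> powr (t - 2) * u x * \<psi> x)" if "1 < t" "t \<le> \<sigma>" for t
    using that X_integrable_powr(1)[OF uX] X_integrable_powr(1)[OF \<psi>] by (intro integral_abs_powr_deriv(1)) auto
  have 4: "AE x in lborel. \<bar>u x\<bar> powr (t - 2) * u x * \<phi> x = \<bar>u x\<bar> powr (t - 2) * u x * \<psi> x" for t
    using ae by eventually_elim simp
  have 5: "\<bar>u x\<bar> powr (t - 2) * u x * \<psi> x = 0" if "x \<notin> \<Omega>" for t x using XD(2)[OF uX that] by simp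
  note L = lebesgue_on_integral[OF 3 4 5]
  show "integrable lebesgue (frac_integrand s1 p u \<phi>)" "integrable lebesgue (frac_integrand s2 q u \<phi>)"
    using frac_integrand_integral(1)[OF um \<psi>m ae] 1 2 by auto
  show "integrable (lebesgue_on \<Omega>) (\<lambda>x. \<bar>u x\<bar> powr (r - 2) * u x * \<phi> x)"
    "integrable (lebesgue_on \<Omega>) (\<lambda>x. \<bar>u x\<bar> powr (crit_exp DIM('a) s1 p - 2) * u x * \<phi> x)"
    using L(1)[of r] L(1)[of \<sigma>] exps by (simp_all add: \<sigma>_def)
  show "(\<integral>z. frac_integrand s1 p u \<phi> z \<partial>lebesgue) + (\<integral>z. frac_integrand s2 q u \<phi> z \<partial>lebesgue)
        = \<theta> * (\<integral>x. \<bar>u x\<bar> powr (r - 2) * u x * \<phi> x \<partial>lebesgue_on \<Omega>)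
          + (\<integral>x. \<bar>u x\<bar> powr (crit_exp DIM('a) s1 p - 2) * u x * \<phi> x \<partial>lebesgue_on \<Omega>)"
    using minimizer_euler_lagrange[OF u min \<theta> \<psi>] L(2)[of r] L(2)[of \<sigma>] exps
      frac_integrand_integral(2)[OF um \<psi>m ae 1] frac_integrand_integral(2)[OF um \<psi>m ae 2]
    by (simp add: \<sigma>_def)
qed

theorem exists_weak_solution:
  "\<exists>\<theta>s>0. \<forall>\<theta>>\<theta>s. \<exists>u. weak_solution s1 s2 p q r \<theta> \<Omega> u \<and>
     (AE x in lebesgue. u x \<ge> 0) \<and> \<not> (AE x in lebesgue. u x = 0)"
proof -
  \<comment> \<open>\<epsilon> is uniform in \<theta>, so the threshold that pushes the minimal
    energy below \<epsilon> can be chosen after it.\<close>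
  obtain \<epsilon> where \<epsilon>: "0 < \<epsilon>" "\<And>\<theta>. 0 < \<theta> \<Longrightarrow> \<exists>u\<in>nehari \<theta>. energy \<theta> u < \<epsilon> \<Longrightarrow>
     \<exists>u\<in>nehari \<theta>. (AE x in lborel. 0 \<le> u x) \<and> (\<forall>v\<in>nehari \<theta>. energy \<theta> u \<le> energy \<theta> v)"
    using nehari_minimizer by blast
  obtain \<theta>s where \<theta>s: "0 < \<theta>s" "\<And>\<theta>. \<theta>s < \<theta> \<Longrightarrow> \<exists>u\<in>nehari \<theta>. energy \<theta> u < \<epsilon>"
    using nehari_energy_small[OF \<epsilon>(1)] by blast
  show ?thesis
  proof (intro exI[of _ \<theta>s] conjI allI impI \<theta>s(1))
    fix \<theta> assume "\<theta>s < \<theta>"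
    then have \<theta>: "0 < \<theta>" using \<theta>s by simp
    obtain u where u: "u \<in> nehari \<theta>" "AE x in lborel. 0 \<le> u x" "\<And>v. v \<in> nehari \<theta> \<Longrightarrow> energy \<theta> u \<le> energy \<theta> v"
      using \<epsilon>(2)[OF \<theta> \<theta>s(2)[OF \<open>\<theta>s < \<theta>\<close>]] by blast
    have "\<not> (AE x in lborel. u x = 0)"
    proof
      assume "AE x in lborel. u x = 0"
      then have "AE x in lborel. \<bar>u x\<bar> powr r = 0" by eventually_elim simp
      then have "R u = 0" unfolding R_def by (rule integral_eq_zero_AE)
      then show False using u(1) by (simp add: nehari_def)
    qed
    then show "\<exists>u. weak_solution s1 s2 p q r \<theta> \<Omega> u \<and> (AE x in lebesgue. u x \<ge> 0) \<and> \<not> (AE x in lebesgue. u x = 0)"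
      using minimizer_weak_solution[OF u(1,3) \<theta>] u(2) by (auto simp: AE_completion_iff)
  qed
qed

end

theorem theorem1p2:
  fixes \<Omega> :: "(real ^ 'n) set" and s1 s2 p q r :: real
  assumes "smooth_bounded_domain \<Omega>"
    and "0 < s2" and "s2 < s1" and "s1 < 1"
    and "real CARD('n) > s1 * p"
    and "2 \<le> q" and "q < p" and "p < r" and "r < crit_exp CARD('n) s1 p"
  shows "\<exists>\<theta>s>0. \<forall>\<theta>>\<theta>s. \<exists>u. weak_solution s1 s2 p q r \<theta> \<Omega> u \<and>
           (AE x in lebesgue. u x \<ge> 0) \<and> \<not> (AE x in lebesgue. u x = 0)"
proof -
  interpret pq_problem \<Omega> s1 s2 p q r
    using assms by unfold_locales (auto simp: smooth_bounded_domain_def)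
  show ?thesis by (rule exists_weak_solution)
qed

end
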